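(* Let $\mathcal{R}$ be an o-minimal expansion of the real ordered field $(\mathbb{R},+,\cdot,<)$ and let $\mathcal{G}_{\mathcal{R}}$ be the ordered group of germs defined in the context. Assume that $\mathcal{R}$ is levelled, i.e. for every $f \in \mathcal{G}_{\mathcal{R}}$ with $f > \mathrm{id}$ there is an $l \in \mathbb{N}$ such that for all sufficiently large $k \in \mathbb{N}$ we have $-1 \leqslant \log^{[k]} \circ f - \log^{[k-l]} \leqslant 1$ (as germs at $+\infty$). Then $\mathcal{G}_{\mathcal{R}}$ is a growth order group. Moreover, the centraliser of every non-trivial element of $\mathcal{G}_{\mathcal{R}}$ is Archimedean.
   Context: $\mathcal{G}_{\mathcal{R}}$ is the set of germs at $+\infty$ of unary functions $\mathbb{R}\to\mathbb{R}$ definable (with parameters) in $\mathcal{R}$ that tend to $+\infty$ at $+\infty$; it is a group under composition of germs with identity the germ $\mathrm{id}$ of the identity map, linearly ordered by $[f]<[g]$ iff $f(t)<g(t)$ for all sufficiently large $t$. For a germ $g$, $g^{[n]}$ is its $n$-fold compositional iterate; $\log^{[m]}$ for $m<0$ means $\exp^{[-m]}$. An ordered group is a group $(\mathcal{G},\cdot,1)$ with a linear order $<$ such that $g>h$ implies $fg>fh$ and $gf>hf$ for all $f$. For $g\in\mathcal{G}$, $\mathcal{C}(g)=\{h: hg=gh\}$; $\mathcal{G}^{>}=\{f: f>1\}$. For $f,g\in\mathcal{G}$ write $f\preccurlyeq g$ if $f=1$, or if $g\neq 1$ and there are $g_0,g_1\in\mathcal{C}(g)$ with $g_0\leqslant f\leqslant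 g_1$; write $f\asymp g$ if $f\preccurlyeq g$ and $g\preccurlyeq f$, and $f\prec g$ if $f\preccurlyeq g$ and not $g\preccurlyeq f$. For $g,h\neq 1$ write $g\sim h$ if $gh^{-1}\prec g$. An element $\mathcal{s}\in\mathcal{G}^{>}$ is scaling if $\mathcal{C}(\mathcal{s})$ is Abelian and for every $f$ with $f\asymp\mathcal{s}$ there is $g\in\mathcal{C}(\mathcal{s})\setminus\{1\}$ with $g\sim f$. A growth order group is an ordered group satisfying: (GOG1) for all $f,g\in\mathcal{G}^{>}$ with $f\geqslant g$ and all $g_0\in\mathcal{C}(g)$ there is $f_0\in\mathcal{C}(f)$ with $f_0\geqslant g_0$; (GOG2) for all $f,g\in\mathcal{G}^{>}$, if $f>h$ for every $h\in\mathcal{C}(g)$ then $fg>gf$; (GOG3) for every $f\neq 1$ there is a scaling $\mathcal{s}$ with $\mathcal{s}\asymp f$. An ordered group is Archimedean if for all non-identity $f,g$ there is $n\in\mathbb{Z}$ with $f^n\geqslant g$. *)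

theory Defs
  imports Complex_Main "HOL-Library.Extended_Real" "HOL-Algebra.Group"
begin

section \<open>Expansions of the real ordered field and definability\<close>

text \<open>
  Symbols carry no arity: a symbol applied to argument lists of different lengths acts as
  a family of unrelated symbols, one for each arity. A signature with fixed arities
  is obtained by interpreting the unused arities trivially.
\<close>

datatype 'f tm =
    Var nat
  | Add "'f tm" "'f tm"
  | Mul "'f tm" "'f tm"
  | Fn 'f "'f tm list"

datatype ('f, 'r) fm =
    Eq "'f tm" "'f tm"
  | Less "'f tm" "'f tm"
  | Rel 'r "'f tm list"
  | Neg "('f, 'r) fm"
  | Conj "('f, 'r) fm" "('f, 'r) fm"
  | Ex nat "('f, 'r) fm"

datatype ('f, 'r) real_field_expansion =
  Real_Field_Expansion (fn_int: "'f \<Rightarrow> real list \<Rightarrow> real") (rel_int: "'r \<Rightarrow> real list \<Rightarrow> bool")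

primrec tm_val :: "('f, 'r) real_field_expansion \<Rightarrow> (nat \<Rightarrow> real) \<Rightarrow> 'f tm \<Rightarrow> real" where
  "tm_val R e (Var i) = e i"
| "tm_val R e (Add s t) = tm_val R e s + tm_val R e t"
| "tm_val R e (Mul s t) = tm_val R e s * tm_val R e t"
| "tm_val R e (Fn f ts) = fn_int R f (map (tm_val R e) ts)"

primrec sat :: "('f, 'r) real_field_expansion \<Rightarrow> (nat \<Rightarrow> real) \<Rightarrow> ('f, 'r) fm \<Rightarrow> bool" where
  "sat R e (Eq s t) \<longleftrightarrow> tm_val R e s = tm_val R e t"
| "sat R e (Less s t) \<longleftrightarrow> tm_val R e s < tm_val R e t"
| "sat R e (Rel r ts) \<longleftrightarrow> rel_int R r (map (tm_val R e) ts)"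
| "sat R e (Neg p) \<longleftrightarrow> \<not> sat R e p"
| "sat R e (Conj p q) \<longleftrightarrow> sat R e p \<and> sat R e q"
| "sat R e (Ex i p) \<longleftrightarrow> (\<exists>x. sat R (e(i := x)) p)"

text \<open>
  In both definitions the assignment \<open>e\<close> supplies the parameters, as the values of the
  variables other than \<open>0\<close> (and \<open>1\<close>).
\<close>

definition definable_set :: "('f, 'r) real_field_expansion \<Rightarrow> real set \<Rightarrow> bool" where
  "definable_set R A \<longleftrightarrow> (\<exists>p e. A = {x. sat R (e(0 := x)) p})"

definition definable_fun :: "('f, 'r) real_field_expansion \<Rightarrow> (real \<Rightarrow> real) \<Rightarrow> bool" where
  "definable_fun R f \<longleftrightarrow> (\<exists>p e. \<forall>x y. sat R (e(0 := x, 1 := y)) p \<longleftrightarrow> y = f x)"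

definition o_minimal :: "('f, 'r) real_field_expansion \<Rightarrow> bool" where
  "o_minimal R \<longleftrightarrow> (\<forall>A. definable_set R A \<longrightarrow>
     (\<exists>F. finite F \<and> A = \<Union>F \<and>
       (\<forall>I\<in>F. (\<exists>a. I = {a}) \<or> (\<exists>a b :: ereal. I = {x. a < ereal x \<and> ereal x < b}))))"


section \<open>Germs at infinity\<close>

text \<open>Germs at \<open>+\<infinity>\<close> of real functions that tend to \<open>+\<infinity>\<close>.\<close>

quotient_type germ = "real \<Rightarrow> real" / partial:
  "\<lambda>f g. filterlim f at_top at_top \<and> filterlim g at_top at_top \<and>
         (\<forall>\<^sub>F t in at_top. f t = g t)"
proof (rule part_equivpI)
  show "\<exists>f :: real \<Rightarrow> real. filterlim f at_top at_top \<and> filterlim f at_top at_top \<and>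
         (\<forall>\<^sub>F t in at_top. f t = f t)"
    by (rule exI[of _ "\<lambda>t. t"]) (simp add: filterlim_ident)
qed (auto intro!: sympI transpI elim: eventually_elim2 eventually_mono)

lift_definition germ_comp :: "germ \<Rightarrow> germ \<Rightarrow> germ" is "\<lambda>f g. f \<circ> g"
proof -
  fix f f' g g' :: "real \<Rightarrow> real"
  assume f: "filterlim f at_top at_top \<and> filterlim f' at_top at_top \<and>
             (\<forall>\<^sub>F t in at_top. f t = f' t)"
    and g: "filterlim g at_top at_top \<and> filterlim g' at_top at_top \<and>
             (\<forall>\<^sub>F t in at_top. g t = g' t)"
  have "\<forall>\<^sub>F t in at_top. f (g t) = f' (g t)"
    using f g by (auto simp: filterlim_iff)
  with g have "\<forall>\<^sub>F t in at_top. (f \<circ> g) t = (f' \<circ> g') t"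
    by (auto elim: eventually_elim2)
  with f g show "filterlim (f \<circ> g) at_top at_top \<and> filterlim (f' \<circ> g') at_top at_top \<and>
             (\<forall>\<^sub>F t in at_top. (f \<circ> g) t = (f' \<circ> g') t)"
    unfolding comp_def by (auto intro: filterlim_compose)
qed

lift_definition germ_id :: germ is "\<lambda>t. t"
  by (simp add: filterlim_ident)

lift_definition germ_less :: "germ \<Rightarrow> germ \<Rightarrow> bool" is
  "\<lambda>f g. \<forall>\<^sub>F t in at_top. f t < g t"
proof -
  fix f f' g g' :: "real \<Rightarrow> real"
  assume "filterlim f at_top at_top \<and> filterlim f' at_top at_top \<and>
             (\<forall>\<^sub>F t in at_top. f t = f' t)"
    and "filterlim g at_top at_top \<and> filterlim g' at_top at_top \<and>
             (\<forall>\<^sub>F t in at_top. g t = g' t)"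
  then have "\<forall>\<^sub>F t in at_top. (f t < g t) = (f' t < g' t)"
    by (auto elim: eventually_elim2)
  then show "(\<forall>\<^sub>F t in at_top. f t < g t) = (\<forall>\<^sub>F t in at_top. f' t < g' t)"
    by (rule eventually_subst)
qed

definition germ_group :: "('f, 'r) real_field_expansion \<Rightarrow> germ monoid" where
  "germ_group R =
     \<lparr>carrier = {abs_germ f | f. definable_fun R f \<and> filterlim f at_top at_top},
      mult = germ_comp,
      one = germ_id\<rparr>"

definition iter_log :: "int \<Rightarrow> real \<Rightarrow> real" where
  "iter_log m = (if 0 \<le> m then ln ^^ nat m else exp ^^ nat (- m))"

definition levelled :: "('f, 'r) real_field_expansion \<Rightarrow> bool" where
  "levelled R \<longleftrightarrow>
     (\<forall>f. definable_fun R f \<and> filterlim f at_top at_top \<and> (\<forall>\<^sub>F t in at_top. t < f t) \<longrightarrow>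
       (\<exists>l :: nat. \<forall>\<^sub>F k :: nat in sequentially. \<forall>\<^sub>F t in at_top.
          - 1 \<le> iter_log (int k) (f t) - iter_log (int k - int l) t \<and>
          iter_log (int k) (f t) - iter_log (int k - int l) t \<le> 1))"


section \<open>Ordered groups and growth order groups\<close>

definition centraliser :: "('a, 'm) monoid_scheme \<Rightarrow> 'a \<Rightarrow> 'a set" where
  "centraliser G g = {h \<in> carrier G. h \<otimes>\<^bsub>G\<^esub> g = g \<otimes>\<^bsub>G\<^esub> h}"

locale ordered_group = group G for G (structure) +
  fixes lt :: "'a \<Rightarrow> 'a \<Rightarrow> bool" (infix \<open><\<^sub>G\<close> 50)
  assumes lt_irrefl: "f \<in> carrier G \<Longrightarrow> \<not> f <\<^sub>G f"
    and lt_trans: "\<lbrakk>f \<in> carrier G; g \<in> carrier G; h \<in> carrier G; f <\<^sub>G g; g <\<^sub>G h\<rbrakk> \<Longrightarrow> f <\<^sub>G h"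
    and lt_total: "\<lbrakk>f \<in> carrier G; g \<in> carrier G\<rbrakk> \<Longrightarrow> f <\<^sub>G g \<or> f = g \<or> g <\<^sub>G f"
    and lt_mult_left:
      "\<lbrakk>f \<in> carrier G; g \<in> carrier G; h \<in> carrier G; h <\<^sub>G g\<rbrakk> \<Longrightarrow> f \<otimes> h <\<^sub>G f \<otimes> g"
    and lt_mult_right:
      "\<lbrakk>f \<in> carrier G; g \<in> carrier G; h \<in> carrier G; h <\<^sub>G g\<rbrakk> \<Longrightarrow> h \<otimes> f <\<^sub>G g \<otimes> f"
begin

abbreviation le :: "'a \<Rightarrow> 'a \<Rightarrow> bool" (infix \<open>\<le>\<^sub>G\<close> 50) where
  "f \<le>\<^sub>G g \<equiv> f <\<^sub>G g \<or> f = g"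

definition positive :: "'a set" where
  "positive = {f \<in> carrier G. \<one> <\<^sub>G f}"

definition preceq :: "'a \<Rightarrow> 'a \<Rightarrow> bool" where
  "preceq f g \<longleftrightarrow>
     f = \<one> \<or> (g \<noteq> \<one> \<and> (\<exists>g0 \<in> centraliser G g. \<exists>g1 \<in> centraliser G g. g0 \<le>\<^sub>G f \<and> f \<le>\<^sub>G g1))"

definition asymp_eq :: "'a \<Rightarrow> 'a \<Rightarrow> bool" where
  "asymp_eq f g \<longleftrightarrow> preceq f g \<and> preceq g f"

definition prec :: "'a \<Rightarrow> 'a \<Rightarrow> bool" where
  "prec f g \<longleftrightarrow> preceq f g \<and> \<not> preceq g f"

definition sim :: "'a \<Rightarrow> 'a \<Rightarrow> bool" where
  "sim g h \<longleftrightarrow> g \<noteq> \<one> \<and> h \<noteq> \<one> \<and> prec (g \<otimes> inv h) g"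

definition scaling :: "'a \<Rightarrow> bool" where
  "scaling s \<longleftrightarrow> s \<in> positive \<and>
     (\<forall>a \<in> centraliser G s. \<forall>b \<in> centraliser G s. a \<otimes> b = b \<otimes> a) \<and>
     (\<forall>f \<in> carrier G. asymp_eq f s \<longrightarrow> (\<exists>g \<in> centraliser G s - {\<one>}. sim g f))"

end

locale growth_order_group = ordered_group +
  assumes GOG1:
      "\<lbrakk>f \<in> positive; g \<in> positive; g \<le>\<^sub>G f; g0 \<in> centraliser G g\<rbrakk>
         \<Longrightarrow> \<exists>f0 \<in> centraliser G f. g0 \<le>\<^sub>G f0"
    and GOG2:
      "\<lbrakk>f \<in> positive; g \<in> positive; \<And>h. h \<in> centraliser G g \<Longrightarrow> h <\<^sub>G f\<rbrakk>
         \<Longrightarrow> g \<otimes> f <\<^sub>G f \<otimes> g"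
    and GOG3:
      "\<lbrakk>f \<in> carrier G; f \<noteq> \<one>\<rbrakk> \<Longrightarrow> \<exists>s. scaling s \<and> asymp_eq s f"

locale archimedean_ordered_group = ordered_group +
  assumes archimedean:
    "\<lbrakk>f \<in> carrier G; g \<in> carrier G; f \<noteq> \<one>; g \<noteq> \<one>\<rbrakk> \<Longrightarrow> \<exists>n :: int. g \<le>\<^sub>G f [^] n"

end

theory Submission
  imports Defs "HOL-Analysis.Continuum_Not_Denumerable"
begin

text \<open>
  The key property of the group of germs is that \<open>g f < f g\<close> whenever \<open>f, g > 1\<close> and
  \<open>g\<^sup>n < f\<close> for all \<open>n\<close>: comparing orbits of \<open>g\<close> shows that \<open>f g \<le> g f\<close> would bound \<open>f\<close> by a
  power of \<open>g\<close>. Hence centralisers are Archimedean, thus Abelian, and \<open>f \<preceq> g\<close> means that \<open>f\<close> is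
  bounded by powers of \<open>g\<close>; this gives GOG1 and GOG2.

  For GOG3, a one-parameter subgroup \<open>\<sigma> : \<real> \<rightarrow> \<G>\<close> yields a scaling element \<open>\<sigma>(1)\<close>. Such a subgroup
  comparable to \<open>f = t + \<epsilon>\<close> with \<open>\<epsilon> \<rightarrow> 0\<close> is obtained by conjugating \<open>f\<close> to a germ between
  \<open>t + 1/3\<close> and \<open>t + 3\<close>; derivatives are avoided by using that definable functions tending to
  \<open>\<infinity>\<close> increase. If \<open>exp\<close> is definable, a germ of level \<open>0\<close> becomes \<open>t + o(1)\<close> after conjugation by
  iterated logarithms, and \<open>exp\<close> itself is a scaling element comparable to the germs of positive
  level. If \<open>exp\<close> is not definable, Miller's dichotomy gives a growth exponent \<open>r\<close> to
  every \<open>f - t\<close>, and the cases \<open>r > 1\<close>, \<open>r = 1\<close>, \<open>r < 1\<close> are settled by \<open>t\<^sup>2\<close>, by dilations, and by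
  conjugation with a root.
\<close>

section \<open>Ordered groups\<close>

text \<open>There is no calculus to rely on: a definable function is only known to increase near
  infinity when it tends to infinity. Growth estimates are therefore proved by contradiction: if one
  failed, some definable \<open>\<Phi>\<close> above a known unbounded function, hence eventually
  increasing, would satisfy \<open>\<Phi> (u t) \<le> \<Phi> t\<close> for a germ \<open>u\<close>
  above the identity. The bound on displacements and the slow variation of increments both arise in
  this way. Flows give scaling elements by completeness of the reals: an element comparable to
  \<open>\<sigma> 1\<close> cuts the flow at a real \<open>c\<close>, and \<open>\<sigma> c\<close>
  is its approximant. Two scaling elements escape this: \<open>t^2\<close>, since irrational powers
  need not be definable, and \<open>exp\<close>, since fractional iterates need not be. Their
  approximants are built directly: \<open>pw r\<close> for the growth exponent \<open>r\<close>,
  definable as a limit of ratios, and the integral iterates of \<open>exp\<close> provided by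
  levelledness. As only rational powers are definable from the outset, real exponents are reached
  through rational ones.\<close>

context ordered_group
begin

lemma le_trans:
  assumes "x \<in> carrier G" "y \<in> carrier G" "z \<in> carrier G" "x \<le>\<^sub>G y" "y \<le>\<^sub>G z"
  shows "x \<le>\<^sub>G z"
  using assms lt_trans[of x y z] by auto

lemma lt_le_trans:
  assumes "x \<in> carrier G" "y \<in> carrier G" "z \<in> carrier G" "x <\<^sub>G y" "y \<le>\<^sub>G z"
  shows "x <\<^sub>G z"
  using assms lt_trans[of x y z] by auto

lemma le_lt_trans:
  assumes "x \<in> carrier G" "y \<in> carrier G" "z \<in> carrier G" "x \<le>\<^sub>G y" "y <\<^sub>G z"
  shows "x <\<^sub>G z"
  using assms lt_trans[of x y z] by auto

lemma not_lt_iff_le: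
  assumes "x \<in> carrier G" "y \<in> carrier G"
  shows "\<not> x <\<^sub>G y \<longleftrightarrow> y \<le>\<^sub>G x"
  using assms lt_irrefl[of x] lt_trans[of x y x] lt_total[of x y] by auto

lemma lt_mult_left_iff:
  assumes "x \<in> carrier G" "y \<in> carrier G" "z \<in> carrier G"
  shows "z \<otimes> x <\<^sub>G z \<otimes> y \<longleftrightarrow> x <\<^sub>G y"
  using assms lt_mult_left[of z y x] lt_mult_left[of z x y] lt_total[of x y]
    lt_irrefl[of "z \<otimes> x"] lt_trans[of "z \<otimes> x" "z \<otimes> y" "z \<otimes> x"] by auto

lemma lt_mult_right_iff:
  assumes "x \<in> carrier G" "y \<in> carrier G" "z \<in> carrier G"
  shows "x \<otimes> z <\<^sub>G y \<otimes> z \<longleftrightarrow> x <\<^sub>G y"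
  using assms lt_mult_right[of z y x] lt_mult_right[of z x y] lt_total[of x y]
    lt_irrefl[of "x \<otimes> z"] lt_trans[of "x \<otimes> z" "y \<otimes> z" "x \<otimes> z"] by auto

lemma le_mult_mono:
  assumes "x \<in> carrier G" "y \<in> carrier G" "z \<in> carrier G" "w \<in> carrier G"
    and "x \<le>\<^sub>G y" "z \<le>\<^sub>G w"
  shows "x \<otimes> z \<le>\<^sub>G y \<otimes> w"
proof (rule le_trans[of _ "y \<otimes> z"])
  show "x \<otimes> z \<le>\<^sub>G y \<otimes> z" "y \<otimes> z \<le>\<^sub>G y \<otimes> w"
    using assms lt_mult_left[of y w z] lt_mult_right[of z y x] by blast+
qed (use assms in simp_all)

lemma lt_mult_mono:
  assumes "x \<in> carrier G" "y \<in> carrier G" "z \<in> carrier G" "w \<in> carrier G"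
    and "x <\<^sub>G y" "z <\<^sub>G w"
  shows "x \<otimes> z <\<^sub>G y \<otimes> w"
  using assms lt_trans[of "x \<otimes> z" "y \<otimes> z" "y \<otimes> w"] lt_mult_left[of y w z] lt_mult_right[of z y x]
  by auto

lemma inv_lt_inv_iff:
  assumes "x \<in> carrier G" "y \<in> carrier G"
  shows "inv x <\<^sub>G inv y \<longleftrightarrow> y <\<^sub>G x"
proof -
  have "inv x <\<^sub>G inv y \<longleftrightarrow> x \<otimes> inv x <\<^sub>G x \<otimes> inv y"
    using assms by (intro lt_mult_left_iff[symmetric]) auto
  also have "\<dots> \<longleftrightarrow> (x \<otimes> inv x) \<otimes> y <\<^sub>G (x \<otimes> inv y) \<otimes> y"
    using assms by (intro lt_mult_right_iff[symmetric]) auto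
  also have "\<dots> \<longleftrightarrow> y <\<^sub>G x"
    using assms by (simp add: m_assoc)
  finally show ?thesis .
qed

lemma one_lt_inv_iff: "x \<in> carrier G \<Longrightarrow> \<one> <\<^sub>G inv x \<longleftrightarrow> x <\<^sub>G \<one>"
  using inv_lt_inv_iff[of \<one> x] by simp

lemma inv_le_inv_iff:
  assumes "x \<in> carrier G" "y \<in> carrier G"
  shows "inv x \<le>\<^sub>G inv y \<longleftrightarrow> y \<le>\<^sub>G x"
  using assms inv_lt_inv_iff inv_inj[THEN inj_onD, of x y] by auto

lemma inv_le_swap:
  assumes "x \<in> carrier G" "y \<in> carrier G"
  shows "inv x \<le>\<^sub>G y \<longleftrightarrow> inv y \<le>\<^sub>G x"
  using inv_le_inv_iff[of x "inv y"] assms by auto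

lemma lt_mult_inv_iff:
  assumes "x \<in> carrier G" "y \<in> carrier G" "z \<in> carrier G"
  shows "x \<otimes> inv y <\<^sub>G z \<longleftrightarrow> x <\<^sub>G z \<otimes> y"
  using lt_mult_right_iff[of "x \<otimes> inv y" z y] assms by (simp add: m_assoc)

lemma positive_or_inv_positive:
  assumes "x \<in> carrier G" "x \<noteq> \<one>"
  shows "x \<in> positive \<or> inv x \<in> positive"
  using assms lt_total[of x \<one>] by (auto simp: positive_def one_lt_inv_iff)

lemma nat_pow_mono:
  assumes "x \<in> carrier G" "y \<in> carrier G" "x \<le>\<^sub>G y"
  shows "x [^] (n::nat) \<le>\<^sub>G y [^] n"
proof (induction n)
  case (Suc n)
  then show ?case
    using assms le_mult_mono[of "x [^] n" "y [^] n" x y] by simp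
qed simp

lemma nat_pow_lt_Suc:
  assumes "x \<in> positive"
  shows "x [^] (n::nat) <\<^sub>G x [^] Suc n"
  using lt_mult_left[of "x [^] n" x \<one>] assms by (auto simp: positive_def)

lemma in_centraliser_iff:
  "h \<in> centraliser G g \<longleftrightarrow> h \<in> carrier G \<and> h \<otimes> g = g \<otimes> h"
  by (auto simp: centraliser_def)

lemma centraliser_sym:
  "g \<in> carrier G \<Longrightarrow> h \<in> centraliser G g \<Longrightarrow> g \<in> centraliser G h"
  by (auto simp: centraliser_def)

lemma subgroup_centraliser:
  assumes g: "g \<in> carrier G"
  shows "subgroup (centraliser G g) G"
proof (rule subgroupI)
  show "centraliser G g \<subseteq> carrier G" "centraliser G g \<noteq> {}"
    using g by (auto simp: centraliser_def intro!: exI[of _ \<one>])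
next
  fix a assume a: "a \<in> centraliser G g"
  then have ac: "a \<in> carrier G"
    by (simp add: in_centraliser_iff)
  have "inv a \<otimes> g = inv a \<otimes> (g \<otimes> a) \<otimes> inv a"
    using g ac by (simp add: m_assoc)
  also have "\<dots> = inv a \<otimes> (a \<otimes> g) \<otimes> inv a"
    using a by (simp add: in_centraliser_iff)
  also have "\<dots> = g \<otimes> inv a"
    using ac g by (simp add: m_assoc[symmetric])
  finally show "inv a \<in> centraliser G g"
    using ac by (auto simp: in_centraliser_iff)
next
  fix a b assume "a \<in> centraliser G g" "b \<in> centraliser G g"
  then have ab: "a \<in> carrier G" "b \<in> carrier G" "a \<otimes> g = g \<otimes> a" "b \<otimes> g = g \<otimes> b"
    by (auto simp: in_centraliser_iff)
  have "a \<otimes> b \<otimes> g = a \<otimes> (g \<otimes> b)"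
    using g ab by (simp add: m_assoc)
  also have "\<dots> = (g \<otimes> a) \<otimes> b"
    using g ab(1,2) by (simp add: m_assoc[symmetric] ab(3))
  also have "\<dots> = g \<otimes> (a \<otimes> b)"
    using g ab(1,2) by (simp add: m_assoc)
  finally show "a \<otimes> b \<in> centraliser G g"
    using ab(1,2) by (simp add: in_centraliser_iff)
qed

lemma centraliser_closed:
  assumes "g \<in> carrier G" "a \<in> centraliser G g"
  shows "a \<in> carrier G" "inv a \<in> centraliser G g" "a [^] (n::nat) \<in> centraliser G g"
    "b \<in> centraliser G g \<Longrightarrow> a \<otimes> b \<in> centraliser G g"
proof -
  interpret S: subgroup "centraliser G g" G
    by (rule subgroup_centraliser) fact
  show "a \<in> carrier G" "inv a \<in> centraliser G g"
    "b \<in> centraliser G g \<Longrightarrow> a \<otimes> b \<in> centraliser G g"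
    using assms(2) by auto
  show "a [^] (n::nat) \<in> centraliser G g"
    using assms(2) by (induction n) auto
qed

lemma self_in_centraliser: "g \<in> carrier G \<Longrightarrow> g \<in> centraliser G g"
  by (simp add: in_centraliser_iff)

lemma centraliser_inv:
  assumes "g \<in> carrier G"
  shows "centraliser G (inv g) = centraliser G g"
proof -
  have *: "centraliser G x \<subseteq> centraliser G (inv x)" if x: "x \<in> carrier G" for x
  proof
    fix h assume h: "h \<in> centraliser G x"
    then have "x \<in> centraliser G h"
      using x by (rule centraliser_sym[rotated])
    then have "inv x \<in> centraliser G h"
      using h by (intro centraliser_closed(2)) (auto simp: in_centraliser_iff)
    then show "h \<in> centraliser G (inv x)"
      using h by (auto simp: in_centraliser_iff)
  qed
  show ?thesis
    using *[of g] *[of "inv g"] assms by auto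
qed

lemma preceq_inv_right:
  assumes "g \<in> carrier G"
  shows "preceq f (inv g) \<longleftrightarrow> preceq f g"
  using assms by (simp add: preceq_def centraliser_inv inv_eq_1_iff)

lemma preceq_inv_left:
  assumes f: "f \<in> carrier G" and g: "g \<in> carrier G"
  shows "preceq (inv f) g \<longleftrightarrow> preceq f g"
proof -
  have *: "preceq (inv f) g" if f: "f \<in> carrier G" and p: "preceq f g" for f
  proof (cases "f = \<one>")
    case True
    then show ?thesis by (simp add: preceq_def)
  next
    case False
    then obtain g0 g1 where g01: "g \<noteq> \<one>" "g0 \<in> centraliser G g" "g1 \<in> centraliser G g"
      and le: "g0 \<le>\<^sub>G f" "f \<le>\<^sub>G g1"
      using p unfolding preceq_def by blast
    have "inv g1 \<le>\<^sub>G inv f" "inv f \<le>\<^sub>G inv g0"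
      using le f inv_le_inv_iff[OF centraliser_closed(1)[OF g g01(3)] f]
        inv_le_inv_iff[OF f centraliser_closed(1)[OF g g01(2)]] by blast+
    then show ?thesis
      using g01 centraliser_closed(2)[OF g] unfolding preceq_def by blast
  qed
  show ?thesis
    using *[of f] *[of "inv f"] f by auto
qed

lemma asymp_eq_inv_right:
  "f \<in> carrier G \<Longrightarrow> g \<in> carrier G \<Longrightarrow> asymp_eq f (inv g) \<longleftrightarrow> asymp_eq f g"
  by (simp add: asymp_eq_def preceq_inv_left preceq_inv_right)

lemma preceq_if_le_pow:
  assumes f: "f \<in> positive" and s: "s \<in> positive" and le: "f \<le>\<^sub>G s [^] (n::nat)"
  shows "preceq f s"
proof -
  have c: "s \<in> carrier G" and "s \<noteq> \<one>"
    using s lt_irrefl by (auto simp: positive_def)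
  have "s [^] n \<in> centraliser G s" "\<one> \<in> centraliser G s"
    using centraliser_closed(3)[OF c self_in_centraliser[OF c]] c by (auto simp: in_centraliser_iff)
  then show ?thesis
    unfolding preceq_def using \<open>s \<noteq> \<one>\<close> f le by (auto simp: positive_def)
qed

lemma asymp_eqI:
  assumes "s \<in> positive" "f \<in> positive" "s \<le>\<^sub>G f [^] (m::nat)" "f \<le>\<^sub>G s [^] (n::nat)"
  shows "asymp_eq s f"
  unfolding asymp_eq_def using assms preceq_if_le_pow by blast

end

text \<open>GOG2 with the powers of \<open>g\<close> in place of its whole centraliser, hence with a
  weaker premise on \<open>f\<close>. In this form it can be checked on orbits of functions, and it
  makes those powers cofinal in the centraliser.\<close>

locale dominant_ordered_group = ordered_group +
  assumes dominant:
    "\<lbrakk>f \<in> positive; g \<in> positive; \<And>n::nat. g [^] n <\<^sub>G f\<rbrakk> \<Longrightarrow> g \<otimes> f <\<^sub>G f \<otimes> g"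
begin

text \<open>An element above all powers of \<open>g\<close> satisfies
  \<open>g \<otimes> a <\<^sub>G a \<otimes> g\<close> by \<open>dominant\<close>, so it cannot
  commute with \<open>g\<close>.\<close>

lemma centraliser_le_pow:
  assumes g: "g \<in> positive" and a: "a \<in> centraliser G g"
  shows "\<exists>n::nat. a \<le>\<^sub>G g [^] n"
proof (rule ccontr)
  have c: "g \<in> carrier G" "a \<in> carrier G"
    using g a by (auto simp: positive_def in_centraliser_iff)
  assume "\<not> ?thesis"
  then have *: "g [^] n <\<^sub>G a" for n :: nat
    using c not_lt_iff_le[of "g [^] n" a] by auto
  from *[of 0] have "a \<in> positive"
    using c by (auto simp: positive_def)
  then have "g \<otimes> a <\<^sub>G a \<otimes> g"
    using g * by (rule dominant)
  then show False
    using a c lt_irrefl[of "g \<otimes> a"] by (auto simp: in_centraliser_iff)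
qed

text \<open>Commuting is symmetric, so \<open>g\<close> is in turn bounded by a power of
  \<open>a\<close>; chaining both bounds makes the centraliser Archimedean before it is known to be
  Abelian.\<close>

lemma centraliser_le_pow_pos:
  assumes g: "g \<in> positive" and a: "a \<in> centraliser G g" "a \<in> positive" and b: "b \<in> centraliser G g"
  shows "\<exists>n::nat. b \<le>\<^sub>G a [^] n"
proof -
  have c: "g \<in> carrier G" "a \<in> carrier G" "b \<in> carrier G"
    using g a b by (auto simp: positive_def in_centraliser_iff)
  obtain m :: nat where m: "b \<le>\<^sub>G g [^] m"
    using centraliser_le_pow[OF g b] by blast
  obtain n :: nat where n: "g \<le>\<^sub>G a [^] n"
    using centraliser_le_pow[OF a(2), of g] centraliser_sym[OF c(1) a(1)] by blast
  have "g [^] m \<le>\<^sub>G (a [^] n) [^] m"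
    using c n nat_pow_mono[of g "a [^] n" m] by blast
  then have "b \<le>\<^sub>G (a [^] n) [^] m"
    using le_trans[of b "g [^] m" "(a [^] n) [^] m"] m c by blast
  then have "b \<le>\<^sub>G a [^] (n * m)"
    using c by (simp add: nat_pow_pow)
  then show ?thesis ..
qed

lemma centraliser_pow_bracket:
  assumes g: "g \<in> positive" and d: "d \<in> centraliser G g" "d \<in> positive"
    and a: "a \<in> centraliser G g" "a \<in> positive"
  shows "\<exists>m::nat. d [^] m \<le>\<^sub>G a \<and> a <\<^sub>G d [^] Suc m"
proof -
  have c: "d \<in> carrier G" "a \<in> carrier G"
    using d a by (auto simp: positive_def)
  define P where "P m \<longleftrightarrow> a <\<^sub>G d [^] Suc m" for m :: nat
  obtain n :: nat where n: "a \<le>\<^sub>G d [^] n"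
    using centraliser_le_pow_pos[OF g d a(1)] by blast
  have "P n"
    unfolding P_def by (rule le_lt_trans[OF _ _ _ n nat_pow_lt_Suc[OF d(2)]]) (use c in simp_all)
  then have L: "P (LEAST m. P m)"
    by (rule LeastI)
  have "d [^] (LEAST m. P m) \<le>\<^sub>G a"
  proof (cases "LEAST m. P m")
    case 0
    then show ?thesis
      using a by (simp add: positive_def)
  next
    case (Suc k)
    then have "\<not> P k"
      using not_less_Least[of k P] by simp
    then have "d [^] Suc k \<le>\<^sub>G a"
      unfolding P_def using c not_lt_iff_le[of a "d [^] Suc k"] by blast
    then show ?thesis
      by (simp only: Suc)
  qed
  with L show ?thesis
    unfolding P_def by blast
qed

text \<open>Hoelder's argument: a non-trivial commutator \<open>c\<close> of an Archimedean ordered group would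
  be smaller than the square of any \<open>d > 1\<close>, so that the group would be cyclic.\<close>

lemma centraliser_commute_pos:
  assumes g: "g \<in> positive" and a: "a \<in> centraliser G g" "a \<in> positive"
    and b: "b \<in> centraliser G g" "b \<in> positive"
  shows "\<not> b \<otimes> a <\<^sub>G a \<otimes> b"
proof
  assume lt: "b \<otimes> a <\<^sub>G a \<otimes> b"
  have gc: "g \<in> carrier G"
    using g by (simp add: positive_def)
  note cl = centraliser_closed[OF gc]
  have ac: "a \<in> carrier G" and bc: "b \<in> carrier G"
    using a b by (auto simp: positive_def)
  define c where "c = (a \<otimes> b) \<otimes> inv (b \<otimes> a)"
  have cc: "c \<in> carrier G"
    using ac bc by (simp add: c_def)
  have cC: "c \<in> centraliser G g"
    unfolding c_def using a b cl(2,4) by blast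
  have "(b \<otimes> a) \<otimes> inv (b \<otimes> a) <\<^sub>G c"
    unfolding c_def by (rule lt_mult_right[OF _ _ _ lt]) (use ac bc in simp_all)
  then have c1: "\<one> <\<^sub>G c"
    using ac bc by (simp del: inv_mult_group)
  then have cpos: "c \<in> positive"
    using cc by (simp add: positive_def)
  have cba: "c \<otimes> (b \<otimes> a) = a \<otimes> b"
  proof -
    have "c \<otimes> (b \<otimes> a) = (a \<otimes> b) \<otimes> (inv (b \<otimes> a) \<otimes> (b \<otimes> a))"
      unfolding c_def by (rule m_assoc) (use ac bc in simp_all)
    also have "inv (b \<otimes> a) \<otimes> (b \<otimes> a) = \<one>"
      using ac bc by (intro l_inv) simp
    finally show ?thesis
      using ac bc by simp
  qed
  show False
  \<comment> \<open>If nothing lies strictly between \<open>\<one>\<close> and \<open>c\<close>,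
    then \<open>c\<close> is the least positive element and generates; otherwise some
    \<open>d\<close> above \<open>\<one>\<close> has its square at most \<open>c\<close>.\<close>
  proof (cases "\<exists>e\<in>centraliser G g. \<one> <\<^sub>G e \<and> e <\<^sub>G c")
    case True
    then obtain e where e: "e \<in> centraliser G g" "\<one> <\<^sub>G e" "e <\<^sub>G c"
      by blast
    have ec: "e \<in> carrier G"
      using e cl(1) by blast
    have "\<exists>d\<in>centraliser G g. \<one> <\<^sub>G d \<and> d \<otimes> d \<le>\<^sub>G c"
    proof (cases "e \<otimes> e \<le>\<^sub>G c")
      case True
      then show ?thesis using e by blast
    next
      case False
      then have ce: "c <\<^sub>G e \<otimes> e"
        using lt_total[of c "e \<otimes> e"] cc ec by auto
      \<comment> \<open>If \<open>e\<close> is too large, its complement in \<open>c\<close> works: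
        \<open>c <\<^sub>G e \<otimes> e\<close> makes \<open>d\<close> smaller than
        \<open>e\<close>, so \<open>d \<otimes> d <\<^sub>G d \<otimes> e = c\<close>.\<close>
      define d where "d = c \<otimes> inv e"
      have dc: "d \<in> carrier G"
        using cc ec by (simp add: d_def)
      have "e \<otimes> inv e <\<^sub>G d"
        unfolding d_def by (rule lt_mult_right[OF _ _ _ e(3)]) (use cc ec in simp_all)
      then have d1: "\<one> <\<^sub>G d"
        using ec by simp
      have de: "d <\<^sub>G e"
        unfolding d_def using ce lt_mult_inv_iff[of c e e] cc ec by simp
      have "d \<otimes> d <\<^sub>G d \<otimes> e"
        using lt_mult_left[OF dc ec dc de] .
      also have "d \<otimes> e = c"
        using cc ec by (simp add: d_def m_assoc)
      finally have "d \<otimes> d <\<^sub>G c" .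
      moreover have "d \<in> centraliser G g"
        unfolding d_def using cC e(1) cl(2,4) by blast
      ultimately show ?thesis
        using d1 by blast
    qed
    then obtain d where d: "d \<in> centraliser G g" "\<one> <\<^sub>G d" "d \<otimes> d \<le>\<^sub>G c"
      by blast
    have dc: "d \<in> carrier G"
      using d cl(1) by blast
    then have dpos: "d \<in> positive"
      using d by (simp add: positive_def)
    obtain m :: nat where m: "d [^] m \<le>\<^sub>G a" "a <\<^sub>G d [^] Suc m"
      using centraliser_pow_bracket[OF g d(1) dpos a] by blast
    obtain n :: nat where n: "d [^] n \<le>\<^sub>G b" "b <\<^sub>G d [^] Suc n"
      using centraliser_pow_bracket[OF g d(1) dpos b] by blast
    \<comment> \<open>The power of \<open>d\<close> with exponent m + n + 2. The brackets give
      \<open>a \<otimes> b <\<^sub>G x\<close>, while \<open>d \<otimes> d \<le>\<^sub>G c\<close>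
      gives \<open>x \<le>\<^sub>G c \<otimes> (b \<otimes> a)\<close>, which equals
      \<open>a \<otimes> b\<close>.\<close>
    define x where "x = (d \<otimes> d) \<otimes> (d [^] n \<otimes> d [^] m)"
    have xc: "x \<in> carrier G"
      using dc by (simp add: x_def)
    have "d [^] Suc m \<otimes> d [^] Suc n = d [^] (Suc m + Suc n)"
      using dc by (simp only: nat_pow_mult)
    also have "\<dots> = d [^] (Suc (Suc 0) + (n + m))"
      by (simp add: add.commute)
    also have "\<dots> = d [^] Suc (Suc 0) \<otimes> (d [^] n \<otimes> d [^] m)"
      using dc by (simp only: nat_pow_mult)
    also have "\<dots> = x"
      using dc by (simp add: x_def)
    finally have x_eq: "d [^] Suc m \<otimes> d [^] Suc n = x" .
    have 1: "a \<otimes> b <\<^sub>G x"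
      unfolding x_eq[symmetric] by (rule lt_mult_mono[OF _ _ _ _ m(2) n(2)]) (use ac bc dc in simp_all)
    have "d [^] n \<otimes> d [^] m \<le>\<^sub>G b \<otimes> a"
      by (rule le_mult_mono[OF _ _ _ _ n(1) m(1)]) (use ac bc dc in simp_all)
    then have "x \<le>\<^sub>G c \<otimes> (b \<otimes> a)"
      unfolding x_def by (intro le_mult_mono[OF _ _ _ _ d(3)]) (use ac bc dc cc in simp_all)
    then have "x \<le>\<^sub>G a \<otimes> b"
      by (simp only: cba)
    then show False
      using 1 ac bc xc lt_irrefl[of "a \<otimes> b"] lt_trans[of "a \<otimes> b" x "a \<otimes> b"] by auto
  next
    case False
    have pw: "\<exists>m::nat. x = c [^] m" if x: "x \<in> centraliser G g" "x \<in> positive" for x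
    proof -
      have xc: "x \<in> carrier G"
        using x by (simp add: positive_def)
      obtain m :: nat where m: "c [^] m \<le>\<^sub>G x" "x <\<^sub>G c [^] Suc m"
        using centraliser_pow_bracket[OF g cC cpos x] by blast
      \<comment> \<open>Division with remainder: \<open>\<one> \<le>\<^sub>G e\<close> and
        \<open>e <\<^sub>G c\<close>, which leaves only \<open>\<one>\<close>.\<close>
      define e where "e = x \<otimes> inv (c [^] m)"
      have ec: "e \<in> carrier G"
        unfolding e_def using xc cc by simp
      have eC: "e \<in> centraliser G g"
        unfolding e_def using x cC cl(2,3,4) by blast
      have "e <\<^sub>G c"
        unfolding e_def using m xc cc nat_pow_Suc2[OF cc, of m]
          lt_mult_inv_iff[of x "c [^] m" c] by simp
      then have "\<not> \<one> <\<^sub>G e"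
        using False eC by blast
      moreover have "\<not> e <\<^sub>G \<one>"
      proof
        assume "e <\<^sub>G \<one>"
        then have "x <\<^sub>G c [^] m"
          unfolding e_def using xc cc lt_mult_inv_iff[of x "c [^] m" \<one>] by simp
        then show False
          using m(1) xc cc lt_irrefl[of x] lt_trans[of x "c [^] m" x] by auto
      qed
      ultimately have "e = \<one>"
        using lt_total[of e \<one>] ec by blast
      then have "e \<otimes> c [^] m = c [^] m"
        using cc by simp
      moreover have "e \<otimes> c [^] m = x"
        using cc xc by (simp add: e_def m_assoc)
      ultimately show ?thesis by auto
    qed
    obtain m n :: nat where "a = c [^] m" "b = c [^] n"
      using pw[OF a] pw[OF b] by blast
    then have "b \<otimes> a = a \<otimes> b"
      using cc by (simp add: nat_pow_mult add.commute)
    then show False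
      using lt ac bc lt_irrefl[of "a \<otimes> b"] by simp
  qed
qed

lemma centraliser_commute:
  assumes g: "g \<in> positive" and a: "a \<in> centraliser G g" and b: "b \<in> centraliser G g"
  shows "a \<otimes> b = b \<otimes> a"
proof -
  have gc: "g \<in> carrier G"
    using g by (simp add: positive_def)
  note cl = centraliser_closed[OF gc]
  have pos: "y \<in> centraliser G x"
    if "x \<in> centraliser G g" "x \<in> positive" "y \<in> centraliser G g" "y \<in> positive" for x y
    using that centraliser_commute_pos[OF g, of x y] centraliser_commute_pos[OF g, of y x]
      lt_total[of "x \<otimes> y" "y \<otimes> x"] by (auto simp: positive_def in_centraliser_iff)
  have right: "y \<in> centraliser G x"
    if x: "x \<in> centraliser G g" "x \<in> positive" and y: "y \<in> centraliser G g" for x y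
  proof -
    have c: "x \<in> carrier G" "y \<in> carrier G"
      using x y cl(1) by blast+
    consider "y = \<one>" | "y \<in> positive" | "inv y \<in> positive"
      using positive_or_inv_positive[of y] c by blast
    then show ?thesis
    proof cases
      case 1
      then show ?thesis using c by (simp add: in_centraliser_iff)
    next
      case 2
      then show ?thesis using pos x y by blast
    next
      case 3
      then have "inv y \<in> centraliser G x"
        using pos[OF x, of "inv y"] y cl(2) by blast
      then show ?thesis
        using centraliser_closed(2)[OF c(1), of "inv y"] c by simp
    qed
  qed
  have c: "a \<in> carrier G" "b \<in> carrier G"
    using a b cl(1) by blast+
  consider "a = \<one>" | "a \<in> positive" | "inv a \<in> positive"
    using positive_or_inv_positive[of a] c by blast
  then have "a \<in> centraliser G b"
  proof cases
    case 1
    then show ?thesis using c by (simp add: in_centraliser_iff)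
  next
    case 2
    then show ?thesis using right[OF a _ b] centraliser_sym c by blast
  next
    case 3
    then have "inv a \<in> centraliser G b"
      using right[of "inv a" b] a b cl(2) centraliser_sym[of "inv a" b] c by simp
    then show ?thesis
      using centraliser_closed(2)[OF c(2), of "inv a"] c by simp
  qed
  then show ?thesis
    by (simp add: in_centraliser_iff)
qed

lemma preceqD:
  assumes p: "preceq f s" and f: "f \<in> carrier G" and s: "s \<in> positive"
  shows "\<exists>n::nat. f \<le>\<^sub>G s [^] n"
proof (cases "f = \<one>")
  case True
  then show ?thesis
    by (intro exI[of _ 0]) simp
next
  case False
  have sc: "s \<in> carrier G"
    using s by (simp add: positive_def)
  from False p obtain g1 where g1: "g1 \<in> centraliser G s" "f \<le>\<^sub>G g1"
    unfolding preceq_def by blast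
  obtain n :: nat where n: "g1 \<le>\<^sub>G s [^] n"
    using centraliser_le_pow[OF s g1(1)] by blast
  have "f \<le>\<^sub>G s [^] n"
    using le_trans[OF f _ _ g1(2) n] g1(1) sc by (simp add: in_centraliser_iff)
  then show ?thesis ..
qed

lemma asymp_eqD:
  assumes f: "f \<in> carrier G" and s: "s \<in> positive" and "asymp_eq f s"
  shows "\<exists>n::nat. f \<le>\<^sub>G s [^] n" "\<exists>n::nat. inv f \<le>\<^sub>G s [^] n"
    "f \<in> positive \<Longrightarrow> \<exists>n::nat. s \<le>\<^sub>G f [^] n" "inv f \<in> positive \<Longrightarrow> \<exists>n::nat. s \<le>\<^sub>G inv f [^] n"
proof -
  have sc: "s \<in> carrier G"
    using s by (simp add: positive_def)
  have p: "preceq f s" "preceq s f" "preceq (inv f) s" "preceq s (inv f)"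
    using assms sc by (simp_all add: asymp_eq_def preceq_inv_left preceq_inv_right)
  show "\<exists>n::nat. f \<le>\<^sub>G s [^] n" "\<exists>n::nat. inv f \<le>\<^sub>G s [^] n"
    using preceqD[OF p(1) f s] preceqD[OF p(3) _ s] f by auto
  show "f \<in> positive \<Longrightarrow> \<exists>n::nat. s \<le>\<^sub>G f [^] n" "inv f \<in> positive \<Longrightarrow> \<exists>n::nat. s \<le>\<^sub>G inv f [^] n"
    using preceqD[OF p(2) sc] preceqD[OF p(4) sc] by auto
qed

lemma archimedean_centraliser:
  assumes g: "g \<in> carrier G" "g \<noteq> \<one>"
  shows "archimedean_ordered_group (G\<lparr>carrier := centraliser G g\<rparr>) (<\<^sub>G)"
proof -
  note sub = subgroup_centraliser[OF g(1)]
  interpret C: group "G\<lparr>carrier := centraliser G g\<rparr>"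
    by (rule subgroup.subgroup_is_group[OF sub]) (rule group_axioms)
  obtain p where p: "p \<in> positive" "centraliser G p = centraliser G g"
    using positive_or_inv_positive[OF g] centraliser_inv[OF g(1)] by blast
  have pc: "p \<in> carrier G"
    using p by (simp add: positive_def)
  have arch: "\<exists>n::int. b \<le>\<^sub>G a [^] n"
    if ab: "a \<in> centraliser G p" "b \<in> centraliser G p" "a \<noteq> \<one>" for a b
  proof (cases "a \<in> positive")
    case True
    then obtain n :: nat where "b \<le>\<^sub>G a [^] n"
      using centraliser_le_pow_pos[OF p(1) ab(1) _ ab(2)] by blast
    then show ?thesis
      by (intro exI[of _ "int n"]) (simp add: int_pow_int)
  next
    case False
    have ac: "a \<in> carrier G"
      using ab by (simp add: in_centraliser_iff)
    have "inv a \<in> positive"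
      using False ac ab(3) positive_or_inv_positive by blast
    then obtain n :: nat where "b \<le>\<^sub>G inv a [^] n"
      using centraliser_le_pow_pos[OF p(1) centraliser_closed(2)[OF pc ab(1)] _ ab(2)] by blast
    then show ?thesis
      using ac by (intro exI[of _ "- int n"]) (simp add: int_pow_neg_int nat_pow_inv)
  qed
  have sc: "x \<in> carrier G" if "x \<in> centraliser G g" for x
    using that by (simp add: in_centraliser_iff)
  show ?thesis
  proof
    fix a b
    assume ab: "a \<in> carrier (G\<lparr>carrier := centraliser G g\<rparr>)" "b \<in> carrier (G\<lparr>carrier := centraliser G g\<rparr>)"
      and a1: "a \<noteq> \<one>\<^bsub>G\<lparr>carrier := centraliser G g\<rparr>\<^esub>"
    have eq: "a [^]\<^bsub>G\<lparr>carrier := centraliser G g\<rparr>\<^esub> n = a [^] n" for n :: int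
      using ab int_pow_consistent[OF sub] by simp
    show "\<exists>n::int. b <\<^sub>G a [^]\<^bsub>G\<lparr>carrier := centraliser G g\<rparr>\<^esub> n \<or>
        b = a [^]\<^bsub>G\<lparr>carrier := centraliser G g\<rparr>\<^esub> n"
      unfolding eq using ab a1 p(2) by (intro arch) simp_all
  next
    fix x y z
    assume "x \<in> carrier (G\<lparr>carrier := centraliser G g\<rparr>)" "y \<in> carrier (G\<lparr>carrier := centraliser G g\<rparr>)"
      "z \<in> carrier (G\<lparr>carrier := centraliser G g\<rparr>)"
    then have "x \<in> carrier G" "y \<in> carrier G" "z \<in> carrier G"
      by (auto intro: sc)
    then show "x <\<^sub>G y \<Longrightarrow> y <\<^sub>G z \<Longrightarrow> x <\<^sub>G z"
      "z <\<^sub>G y \<Longrightarrow> x \<otimes>\<^bsub>G\<lparr>carrier := centraliser G g\<rparr>\<^esub> z <\<^sub>G x \<otimes>\<^bsub>G\<lparr>carrier := centraliser G g\<rparr>\<^esub> y"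
      "z <\<^sub>G y \<Longrightarrow> z \<otimes>\<^bsub>G\<lparr>carrier := centraliser G g\<rparr>\<^esub> x <\<^sub>G y \<otimes>\<^bsub>G\<lparr>carrier := centraliser G g\<rparr>\<^esub> x"
      using lt_trans[of x y z] lt_mult_left[of x y z] lt_mult_right[of x y z] by simp_all
  next
    fix x y
    assume "x \<in> carrier (G\<lparr>carrier := centraliser G g\<rparr>)" "y \<in> carrier (G\<lparr>carrier := centraliser G g\<rparr>)"
    then show "x <\<^sub>G y \<or> x = y \<or> y <\<^sub>G x"
      using lt_total[of x y] sc by simp
  next
    fix x
    assume "x \<in> carrier (G\<lparr>carrier := centraliser G g\<rparr>)"
    then show "\<not> x <\<^sub>G x"
      using lt_irrefl[of x] sc by simp
  qed
qed

text \<open>The centraliser is Abelian by \<open>centraliser_commute\<close>, so only the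
  approximants matter. The condition on powers makes \<open>g \<otimes> inv f\<close> infinitesimal
  relative to \<open>s\<close>, whereas a power of \<open>g\<close> or \<open>inv g\<close> reaches
  \<open>s\<close>; this gives \<open>sim g f\<close>. Comparability of \<open>f\<close> with
  \<open>s\<close> excludes \<open>g = \<one>\<close>.\<close>

lemma scalingI:
  assumes s: "s \<in> positive"
    and approx: "\<And>f. f \<in> carrier G \<Longrightarrow> asymp_eq f s \<Longrightarrow>
      \<exists>g\<in>centraliser G s. \<forall>n::nat. (g \<otimes> inv f) [^] n <\<^sub>G s \<and> inv (g \<otimes> inv f) [^] n <\<^sub>G s"
  shows "scaling s"
proof -
  have sc: "s \<in> carrier G"
    using s by (simp add: positive_def)
  have s1: "s \<noteq> \<one>"
    using s lt_irrefl by (auto simp: positive_def)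
  \<comment> \<open>A bound on \<open>y\<close> by powers of \<open>x\<close> or
    \<open>inv x\<close> would bound \<open>y [^] k\<close>, and hence \<open>s\<close>, by such a
    power.\<close>
  have small: "\<not> preceq y x"
    if x: "x \<in> carrier G" and xs: "\<And>n::nat. x [^] n <\<^sub>G s" "\<And>n::nat. inv x [^] n <\<^sub>G s"
      and y: "y \<in> positive" "s \<le>\<^sub>G y [^] (k::nat)" for x y k
  proof
    assume p: "preceq y x"
    have yc: "y \<in> carrier G"
      using y by (simp add: positive_def)
    have y1: "y \<noteq> \<one>"
      using y lt_irrefl by (auto simp: positive_def)
    then have "x \<noteq> \<one>"
      using p by (auto simp: preceq_def)
    then consider "x \<in> positive" | "inv x \<in> positive"
      using positive_or_inv_positive x by blast
    then obtain z where z: "z \<in> positive" "preceq y z" "\<And>n::nat. z [^] n <\<^sub>G s"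
    proof cases
      case 1
      then show ?thesis using that p xs by blast
    next
      case 2
      then show ?thesis using that[of "inv x"] p xs preceq_inv_right[OF x] by blast
    qed
    have zc: "z \<in> carrier G"
      using z by (simp add: positive_def)
    obtain n :: nat where n: "y \<le>\<^sub>G z [^] n"
      using preceqD[OF z(2) yc z(1)] by blast
    have "y [^] k \<le>\<^sub>G (z [^] n) [^] k"
      by (rule nat_pow_mono[OF yc _ n]) (use zc in simp)
    then have "s \<le>\<^sub>G z [^] (n * k)"
      using le_trans[of s "y [^] k" "(z [^] n) [^] k"] sc y(2) yc zc by (simp add: nat_pow_pow)
    then show False
      using z(3)[of "n * k"] sc zc not_lt_iff_le[of "z [^] (n * k)" s] by simp
  qed
  have "\<exists>g\<in>centraliser G s - {\<one>}. sim g f" if f: "f \<in> carrier G" "asymp_eq f s" for f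
  proof -
    obtain g where g: "g \<in> centraliser G s"
      and gs: "\<And>n::nat. (g \<otimes> inv f) [^] n <\<^sub>G s" "\<And>n::nat. inv (g \<otimes> inv f) [^] n <\<^sub>G s"
      using approx[OF f] by blast
    define x where "x = g \<otimes> inv f"
    note gs = gs[folded x_def]
    have gc: "g \<in> carrier G"
      using g by (simp add: in_centraliser_iff)
    have xc: "x \<in> carrier G"
      using gc f by (simp add: x_def)
    have f1: "f \<noteq> \<one>"
      using f(2) s1 by (auto simp: asymp_eq_def preceq_def)
    have g1: "g \<noteq> \<one>"
    proof
      assume "g = \<one>"
      then have "x = inv f"
        using f by (simp add: x_def)
      then have "preceq s x"
        using f preceq_inv_right by (simp add: asymp_eq_def)
      then show False
        using small[OF xc gs s, of 1] sc by simp
    qed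
    obtain h where h: "h \<in> positive" "h = g \<or> h = inv g"
      using positive_or_inv_positive[OF gc g1] by blast
    have hc: "h \<in> carrier G"
      using h by (simp add: positive_def)
    have hC: "h \<in> centraliser G s"
      using h(2) g centraliser_closed(2)[OF sc g] by blast
    obtain k :: nat where k: "s \<le>\<^sub>G h [^] k"
      using centraliser_le_pow[OF h(1) centraliser_sym[OF sc hC]] by blast
    have "\<not> preceq h x"
      using small[OF xc gs h(1) k] .
    then have 1: "\<not> preceq g x"
      using h(2) preceq_inv_left[OF gc xc] by blast
    have 2: "preceq x g"
    proof -
      have "x <\<^sub>G s" "inv x <\<^sub>G s"
        using gs(1)[of 1] gs(2)[of 1] xc by simp_all
      then have "x \<le>\<^sub>G h [^] k" "inv x \<le>\<^sub>G h [^] k"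
        using lt_le_trans[OF _ sc _ _ k] xc hc by simp_all
      then have "inv (h [^] k) \<le>\<^sub>G x" "x \<le>\<^sub>G h [^] k"
        using inv_le_swap[of x "h [^] k"] xc hc by simp_all
      moreover have "h \<in> centraliser G g"
        using h(2) self_in_centraliser[OF gc] centraliser_closed(2)[OF gc self_in_centraliser[OF gc]]
        by blast
      then have "h [^] k \<in> centraliser G g" "inv (h [^] k) \<in> centraliser G g"
        using centraliser_closed(2,3)[OF gc] by blast+
      ultimately show ?thesis
        using g1 unfolding preceq_def by blast
    qed
    have "sim g f"
      unfolding sim_def prec_def using g1 f1 1 2 by (simp add: x_def)
    then show ?thesis
      using g g1 by blast
  qed
  then show ?thesis
    unfolding scaling_def using s centraliser_commute[OF s] by blast
qed

section \<open>One-parameter subgroups and the scaling elements they provide\<close>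

definition flow :: "(real \<Rightarrow> 'a) \<Rightarrow> bool" where
  "flow \<sigma> \<longleftrightarrow> (\<forall>c. \<sigma> c \<in> carrier G) \<and> (\<forall>a b. \<sigma> (a + b) = \<sigma> a \<otimes> \<sigma> b) \<and> (\<forall>c>0. \<one> <\<^sub>G \<sigma> c)"

text \<open>For positive \<open>f\<close> this amounts to comparability with
  \<open>\<sigma> 1\<close>; bounds by powers are used because conjugation transports them
  directly.\<close>

definition flowable :: "'a \<Rightarrow> bool" where
  "flowable f \<longleftrightarrow> (\<exists>\<sigma>. flow \<sigma> \<and> (\<exists>n::nat. f \<le>\<^sub>G \<sigma> 1 [^] n) \<and> (\<exists>n::nat. \<sigma> 1 \<le>\<^sub>G f [^] n))"

context
  fixes \<sigma> :: "real \<Rightarrow> 'a"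
  assumes \<sigma>: "flow \<sigma>"
begin

lemma flow_closed [simp]: "\<sigma> c \<in> carrier G"
  using \<sigma> by (simp add: flow_def)

lemma flow_add: "\<sigma> (a + b) = \<sigma> a \<otimes> \<sigma> b"
  using \<sigma> by (simp add: flow_def)

lemma flow_zero [simp]: "\<sigma> 0 = \<one>"
  using flow_add[of 0 0] by simp

lemma flow_inv: "inv (\<sigma> c) = \<sigma> (- c)"
  using flow_add[of "- c" c] by (intro inv_equality) auto

lemma flow_pow: "\<sigma> c [^] (n::nat) = \<sigma> (real n * c)"
  by (induction n) (simp_all add: flow_add[symmetric] algebra_simps)

lemma flow_strict_mono:
  assumes "a < b"
  shows "\<sigma> a <\<^sub>G \<sigma> b"
proof -
  have "\<one> <\<^sub>G \<sigma> (b - a)"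
    using \<sigma> assms by (simp add: flow_def)
  then have "\<sigma> a \<otimes> \<one> <\<^sub>G \<sigma> a \<otimes> \<sigma> (b - a)"
    by (intro lt_mult_left) auto
  then show ?thesis
    by (simp flip: flow_add)
qed

lemma flow_mono: "a \<le> b \<Longrightarrow> \<sigma> a \<le>\<^sub>G \<sigma> b"
  using flow_strict_mono[of a b] by (cases "a = b") auto

text \<open>Completeness of the reals provides the supremum \<open>c\<close> of all reals with
  \<open>\<sigma> c \<le>\<^sub>G f\<close>. Then \<open>\<sigma> c \<otimes> inv f\<close> lies
  between \<open>\<sigma> (- d)\<close> and \<open>\<sigma> d\<close> for all
  \<open>d > 0\<close>.\<close>

lemma scaling_flow: "scaling (\<sigma> 1)"
proof (rule scalingI)
  show s: "\<sigma> 1 \<in> positive"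
    using \<sigma> by (simp add: flow_def positive_def)
  fix f assume f: "f \<in> carrier G" "asymp_eq f (\<sigma> 1)"
  obtain n :: nat where n: "f \<le>\<^sub>G \<sigma> n"
    using asymp_eqD(1)[OF f(1) s f(2)] flow_pow[of 1] by auto
  obtain m :: nat where m: "inv f \<le>\<^sub>G \<sigma> m"
    using asymp_eqD(2)[OF f(1) s f(2)] flow_pow[of 1] by auto
  then have m: "\<sigma> (- real m) \<le>\<^sub>G f"
    using inv_le_swap[of f "\<sigma> m"] f(1) by (simp add: flow_inv)
  define A where "A = {c. \<sigma> c \<le>\<^sub>G f}"
  have A_le: "c \<le> b" if "c \<in> A" "f \<le>\<^sub>G \<sigma> b" for b c
  proof (rule ccontr)
    assume "\<not> c \<le> b"
    then have "\<sigma> b <\<^sub>G \<sigma> c"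
      by (intro flow_strict_mono) simp
    moreover have "\<sigma> c \<le>\<^sub>G \<sigma> b"
      using that le_trans[of "\<sigma> c" f "\<sigma> b"] f by (simp add: A_def)
    ultimately show False
      using not_lt_iff_le[of "\<sigma> b" "\<sigma> c"] by simp
  qed
  have A: "A \<noteq> {}" "bdd_above A"
    using m A_le[OF _ n] by (auto simp: A_def bdd_above_def)
  define c where "c = Sup A"
  have lower: "\<sigma> (c - d) \<le>\<^sub>G f" if d: "d > 0" for d
  proof -
    obtain a where "a \<in> A" "c - d < a"
      using less_cSupD[OF A(1), of "c - d"] d unfolding c_def by auto
    then show ?thesis
      using flow_mono[of "c - d" a] le_trans[of "\<sigma> (c - d)" "\<sigma> a" f] f
      by (simp add: A_def)
  qed
  have upper: "f \<le>\<^sub>G \<sigma> (c + d)" if "d > 0" for d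
  proof -
    have "c + d \<notin> A"
      using cSup_upper[OF _ A(2), of "c + d"] that by (auto simp: c_def)
    then show ?thesis
      using f lt_total[of f "\<sigma> (c + d)"] by (auto simp: A_def)
  qed
  show "\<exists>g\<in>centraliser G (\<sigma> 1). \<forall>n::nat. (g \<otimes> inv f) [^] n <\<^sub>G \<sigma> 1 \<and> inv (g \<otimes> inv f) [^] n <\<^sub>G \<sigma> 1"
  proof (intro bexI allI)
    show "\<sigma> c \<in> centraliser G (\<sigma> 1)"
      by (simp add: in_centraliser_iff add.commute flip: flow_add)
    fix n :: nat
    \<comment> \<open>Any \<open>d > 0\<close> with \<open>n * d < 1\<close> makes the
      \<open>n\<close>-th power of \<open>\<sigma> d\<close> smaller than
      \<open>\<sigma> 1\<close>.\<close>
    define d where "d = 1 / (real n + 1)"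
    have d: "d > 0" "real n * d < 1"
      by (auto simp: d_def field_simps)
    define x where "x = \<sigma> c \<otimes> inv f"
    have x: "x \<in> carrier G"
      using f by (simp add: x_def)
    have "inv f \<le>\<^sub>G inv (\<sigma> (c - d))"
      using lower[OF d(1)] f inv_le_inv_iff[of f "\<sigma> (c - d)"] by simp
    then have "x \<le>\<^sub>G \<sigma> c \<otimes> \<sigma> (- (c - d))"
      unfolding x_def flow_inv using f by (intro le_mult_mono) simp_all
    then have x1: "x \<le>\<^sub>G \<sigma> d"
      by (simp flip: flow_add)
    have "inv (\<sigma> (c + d)) \<le>\<^sub>G inv f"
      using upper[OF d(1)] f inv_le_inv_iff[of "\<sigma> (c + d)" f] by simp
    then have "\<sigma> c \<otimes> \<sigma> (- (c + d)) \<le>\<^sub>G x"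
      unfolding x_def flow_inv using f by (intro le_mult_mono) simp_all
    then have "\<sigma> (- d) \<le>\<^sub>G x"
      by (simp flip: flow_add)
    then have x2: "inv x \<le>\<^sub>G \<sigma> d"
      using inv_le_swap[of x "\<sigma> d"] x by (simp add: flow_inv)
    have *: "y [^] n <\<^sub>G \<sigma> 1" if "y \<in> carrier G" "y \<le>\<^sub>G \<sigma> d" for y
      using le_lt_trans[OF _ _ _ nat_pow_mono[OF that(1) _ that(2), of n], of "\<sigma> 1"] that(1)
        flow_strict_mono[OF d(2)] by (simp add: flow_pow)
    show "(\<sigma> c \<otimes> inv f) [^] n <\<^sub>G \<sigma> 1 \<and> inv (\<sigma> c \<otimes> inv f) [^] n <\<^sub>G \<sigma> 1"
      using *[OF x x1] *[OF inv_closed[OF x] x2] unfolding x_def by blast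
  qed
qed

end

lemma flowable_imp_scaling:
  assumes f: "f \<in> positive" and fl: "flowable f"
  shows "\<exists>s. scaling s \<and> asymp_eq s f"
proof -
  obtain \<sigma> and m n :: nat where *: "flow \<sigma>" "f \<le>\<^sub>G \<sigma> 1 [^] n" "\<sigma> 1 \<le>\<^sub>G f [^] m"
    using fl unfolding flowable_def by blast
  then have s: "scaling (\<sigma> 1)"
    by (intro scaling_flow)
  then have "\<sigma> 1 \<in> positive"
    by (simp add: scaling_def)
  then have "asymp_eq (\<sigma> 1) f"
    using asymp_eqI[OF _ f *(3,2)] by blast
  with s show ?thesis by blast
qed

text \<open>Inner automorphisms preserve order and powers and carry flows to flows, so a germ may be
  linearised in any convenient coordinate.\<close>

lemma flowable_conj:
  assumes f: "f \<in> carrier G" and p: "p \<in> carrier G" and fl: "flowable (p \<otimes> f \<otimes> inv p)"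
  shows "flowable f"
proof -
  define k where "k x = inv p \<otimes> x \<otimes> p" for x
  have k_closed: "k x \<in> carrier G" if "x \<in> carrier G" for x
    using that p by (simp add: k_def)
  have k_mult: "k (x \<otimes> y) = k x \<otimes> k y" if xy: "x \<in> carrier G" "y \<in> carrier G" for x y
  proof -
    have "p \<otimes> (inv p \<otimes> (y \<otimes> p)) = (p \<otimes> inv p) \<otimes> (y \<otimes> p)"
      using xy p by (intro m_assoc[symmetric]) simp_all
    then show ?thesis
      using xy p by (simp add: k_def m_assoc)
  qed
  have k_one: "k \<one> = \<one>"
    using p by (simp add: k_def)
  have k_pow: "k (x [^] (n::nat)) = k x [^] n" if "x \<in> carrier G" for x n
    using that by (induction n) (simp_all add: k_one k_mult)
  have k_lt: "k x <\<^sub>G k y" if "x \<in> carrier G" "y \<in> carrier G" "x <\<^sub>G y" for x y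
    unfolding k_def using that p by (intro lt_mult_right lt_mult_left) auto
  have k_le: "k x \<le>\<^sub>G k y" if "x \<in> carrier G" "y \<in> carrier G" "x \<le>\<^sub>G y" for x y
    using that k_lt by blast
  have kf: "k (p \<otimes> f \<otimes> inv p) = f"
  proof -
    have "inv p \<otimes> (p \<otimes> f) = (inv p \<otimes> p) \<otimes> f"
      using f p by (intro m_assoc[symmetric]) simp_all
    then show ?thesis
      using f p by (simp add: k_def m_assoc)
  qed
  obtain \<sigma> and m n :: nat where s: "flow \<sigma>"
    "p \<otimes> f \<otimes> inv p \<le>\<^sub>G \<sigma> 1 [^] n" "\<sigma> 1 \<le>\<^sub>G (p \<otimes> f \<otimes> inv p) [^] m"
    using fl unfolding flowable_def by blast
  have sc: "\<sigma> c \<in> carrier G" for c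
    using s by (simp add: flow_def)
  have "\<one> <\<^sub>G k (\<sigma> c)" if "c > 0" for c
    using s(1) that k_lt[OF one_closed sc] by (simp add: k_one flow_def)
  then have "flow (\<lambda>c. k (\<sigma> c))"
    unfolding flow_def using flow_add[OF s(1)] sc by (simp add: k_closed k_mult)
  moreover have "f \<le>\<^sub>G k (\<sigma> 1) [^] n" "k (\<sigma> 1) \<le>\<^sub>G f [^] m"
    using k_le[OF _ _ s(2)] k_le[OF _ _ s(3)] f p sc by (simp_all add: k_pow kf)
  ultimately show ?thesis
    unfolding flowable_def by blast
qed

text \<open>For GOG1, \<open>g0\<close> is bounded by a power of \<open>g\<close>, hence by the same
  power of \<open>f\<close>. For GOG2, the powers of \<open>g\<close> lie in its centraliser. GOG3
  passes from \<open>inv f\<close> to \<open>f\<close> because comparability ignores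
  inverses.\<close>

lemma growth_order_groupI:
  assumes scal: "\<And>f. f \<in> positive \<Longrightarrow> \<exists>s. scaling s \<and> asymp_eq s f"
  shows "growth_order_group G (<\<^sub>G)"
proof
  fix f g g0 assume f: "f \<in> positive" and g: "g \<in> positive" and le: "g \<le>\<^sub>G f"
    and g0: "g0 \<in> centraliser G g"
  have c: "f \<in> carrier G" "g \<in> carrier G" "g0 \<in> carrier G"
    using f g g0 by (auto simp: positive_def in_centraliser_iff)
  obtain n :: nat where n: "g0 \<le>\<^sub>G g [^] n"
    using centraliser_le_pow[OF g g0] by blast
  have "g0 \<le>\<^sub>G f [^] n"
    using le_trans[OF _ _ _ n nat_pow_mono[OF c(2,1) le]] c by simp
  moreover have "f [^] n \<in> centraliser G f"
    using centraliser_closed(3)[OF c(1) self_in_centraliser[OF c(1)]] .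
  ultimately show "\<exists>f0\<in>centraliser G f. g0 \<le>\<^sub>G f0"
    by blast
next
  fix f g assume f: "f \<in> positive" and g: "g \<in> positive"
    and h: "\<And>h. h \<in> centraliser G g \<Longrightarrow> h <\<^sub>G f"
  have c: "g \<in> carrier G"
    using g by (simp add: positive_def)
  have "g [^] n <\<^sub>G f" for n :: nat
    using h centraliser_closed(3)[OF c self_in_centraliser[OF c]] by blast
  with f g show "g \<otimes> f <\<^sub>G f \<otimes> g"
    by (rule dominant)
next
  fix f assume f: "f \<in> carrier G" "f \<noteq> \<one>"
  show "\<exists>s. scaling s \<and> asymp_eq s f"
  proof (cases "f \<in> positive")
    case True
    then show ?thesis by (rule scal)
  next
    case False
    then have "inv f \<in> positive"
      using f positive_or_inv_positive by blast
    then obtain s where s: "scaling s" "asymp_eq s (inv f)"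
      using scal by blast
    then have "s \<in> carrier G"
      by (simp add: scaling_def positive_def)
    then show ?thesis
      using s f asymp_eq_inv_right by blast
  qed
qed

end

section \<open>Closure properties of definability\<close>

primrec ren_tm :: "(nat \<Rightarrow> nat) \<Rightarrow> 'f tm \<Rightarrow> 'f tm" where
  "ren_tm \<rho> (Var i) = Var (\<rho> i)"
| "ren_tm \<rho> (Add s t) = Add (ren_tm \<rho> s) (ren_tm \<rho> t)"
| "ren_tm \<rho> (Mul s t) = Mul (ren_tm \<rho> s) (ren_tm \<rho> t)"
| "ren_tm \<rho> (Fn f ts) = Fn f (map (ren_tm \<rho>) ts)"

primrec ren_fm :: "(nat \<Rightarrow> nat) \<Rightarrow> ('f, 'r) fm \<Rightarrow> ('f, 'r) fm" where
  "ren_fm \<rho> (Eq s t) = Eq (ren_tm \<rho> s) (ren_tm \<rho> t)"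
| "ren_fm \<rho> (Less s t) = Less (ren_tm \<rho> s) (ren_tm \<rho> t)"
| "ren_fm \<rho> (Rel r ts) = Rel r (map (ren_tm \<rho>) ts)"
| "ren_fm \<rho> (Neg p) = Neg (ren_fm \<rho> p)"
| "ren_fm \<rho> (Conj p q) = Conj (ren_fm \<rho> p) (ren_fm \<rho> q)"
| "ren_fm \<rho> (Ex i p) = Ex (\<rho> i) (ren_fm \<rho> p)"

lemma tm_val_ren: "tm_val R e (ren_tm \<rho> t) = tm_val R (\<lambda>n. e (\<rho> n)) t"
proof (induction t)
  case (Fn f ts)
  then have "map (tm_val R e \<circ> ren_tm \<rho>) ts = map (tm_val R (\<lambda>n. e (\<rho> n))) ts"
    by auto
  then show ?case by (simp only: ren_tm.simps tm_val.simps map_map)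
qed auto

lemma sat_ren:
  assumes "inj \<rho>"
  shows "sat R e (ren_fm \<rho> p) \<longleftrightarrow> sat R (\<lambda>n. e (\<rho> n)) p"
proof (induction p arbitrary: e)
  case (Rel r ts)
  have "map (tm_val R e \<circ> ren_tm \<rho>) ts = map (tm_val R (\<lambda>n. e (\<rho> n))) ts"
    by (auto simp: tm_val_ren)
  then show ?case by (simp only: ren_fm.simps sat.simps map_map)
next
  case (Ex i p)
  have "(\<lambda>n. (e(\<rho> i := x)) (\<rho> n)) = (\<lambda>n. e (\<rho> n))(i := x)" for x
    using assms by (auto simp: fun_eq_iff inj_eq)
  then show ?case
    using Ex by simp
qed (auto simp: tm_val_ren)

text \<open>The even variables of the formula carry the assignment \<open>v\<close>, the odd ones the parameters.\<close>

definition merge :: "(nat \<Rightarrow> real) \<Rightarrow> (nat \<Rightarrow> real) \<Rightarrow> nat \<Rightarrow> real" where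
  "merge v e n = (if even n then v (n div 2) else e (n div 2))"

lemma env_eqI:
  fixes f g :: "nat \<Rightarrow> real"
  assumes "\<And>k. f (2 * k) = g (2 * k)" "\<And>k. f (Suc (2 * k)) = g (Suc (2 * k))"
  shows "f = g"
proof
  fix n
  show "f n = g n"
    using assms by (cases "even n") (auto elim!: evenE oddE)
qed

text \<open>A shallow embedding of definability: closure rules for predicates on assignments replace
  explicit formulas. The parameters \<open>e\<close> are the same for all \<open>v\<close>.\<close>

definition dpred :: "('f, 'r) real_field_expansion \<Rightarrow> ((nat \<Rightarrow> real) \<Rightarrow> bool) \<Rightarrow> bool" where
  "dpred R Q \<longleftrightarrow> (\<exists>p e. \<forall>v. Q v \<longleftrightarrow> sat R (merge v e) p)"

lemma dpredI: "(\<And>v. Q v \<longleftrightarrow> sat R (merge v e) p) \<Longrightarrow> dpred R Q"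
  unfolding dpred_def by blast

lemma dpred_cong: "dpred R P \<Longrightarrow> (\<And>v. Q v \<longleftrightarrow> P v) \<Longrightarrow> dpred R Q"
  by (simp add: dpred_def)

lemma dpred_neg:
  assumes "dpred R Q"
  shows "dpred R (\<lambda>v. \<not> Q v)"
proof -
  from assms obtain p e where "\<And>v. Q v \<longleftrightarrow> sat R (merge v e) p"
    by (auto simp: dpred_def)
  then show ?thesis
    by (intro dpredI[of _ _ e "Neg p"]) simp
qed

text \<open>The two formulas carry separate parameters, which are interleaved into
  \<open>merge e d\<close>: \<open>\<rho>\<close> moves an odd variable 2k+1 to 4k+1 and
  \<open>\<pi>\<close> moves it to 4k+3, where \<open>e k\<close> and \<open>d k\<close> are
  stored.\<close>

lemma dpred_conj:
  assumes "dpred R P" "dpred R Q"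
  shows "dpred R (\<lambda>v. P v \<and> Q v)"
proof -
  from assms obtain p e q d where p: "\<And>v. P v \<longleftrightarrow> sat R (merge v e) p"
    and q: "\<And>v. Q v \<longleftrightarrow> sat R (merge v d) q"
    by (auto simp: dpred_def)
  define \<rho> where "\<rho> n = (if even n then n else 2 * n - 1)" for n :: nat
  define \<pi> where "\<pi> n = (if even n then n else 2 * n + 1)" for n :: nat
  have inj: "inj \<rho>" "inj \<pi>"
    unfolding \<rho>_def \<pi>_def by (intro injI; simp split: if_splits; presburger)+
  have r: "(\<lambda>n. merge v (merge e d) (\<rho> n)) = merge v e" for v
    by (rule env_eqI) (simp_all add: \<rho>_def merge_def)
  have s: "(\<lambda>n. merge v (merge e d) (\<pi> n)) = merge v d" for v
    by (rule env_eqI) (simp_all add: \<pi>_def merge_def)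
  show ?thesis
    by (rule dpredI[of _ _ "merge e d" "Conj (ren_fm \<rho> p) (ren_fm \<pi> q)"])
      (simp add: sat_ren inj r s p q)
qed

lemma merge_upd: "merge (v(i := x)) e = (merge v e)(2 * i := x)"
  by (auto simp: merge_def fun_eq_iff)

lemma dpred_ex:
  assumes "dpred R Q"
  shows "dpred R (\<lambda>v. \<exists>x. Q (v(i := x)))"
proof -
  from assms obtain p e where "\<And>v. Q v \<longleftrightarrow> sat R (merge v e) p"
    by (auto simp: dpred_def)
  then show ?thesis
    by (intro dpredI[of _ _ e "Ex (2 * i) p"]) (simp add: merge_upd)
qed

lemma dpred_disj: "dpred R P \<Longrightarrow> dpred R Q \<Longrightarrow> dpred R (\<lambda>v. P v \<or> Q v)"
  using dpred_neg[OF dpred_conj[OF dpred_neg dpred_neg]] by (rule dpred_cong) auto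

lemma dpred_imp: "dpred R P \<Longrightarrow> dpred R Q \<Longrightarrow> dpred R (\<lambda>v. P v \<longrightarrow> Q v)"
  using dpred_disj[OF dpred_neg] by (rule dpred_cong) auto

lemma dpred_all: "dpred R Q \<Longrightarrow> dpred R (\<lambda>v. \<forall>x. Q (v(i := x)))"
  using dpred_neg[OF dpred_ex[OF dpred_neg]] by (rule dpred_cong) auto

text \<open>The finite support provides the fresh variables needed to express compositions.\<close>

definition dterm :: "('f, 'r) real_field_expansion \<Rightarrow> ((nat \<Rightarrow> real) \<Rightarrow> real) \<Rightarrow> bool" where
  "dterm R T \<longleftrightarrow> (\<exists>N. (\<forall>v w. (\<forall>i<N. v i = w i) \<longrightarrow> T v = T w) \<and> (\<forall>j\<ge>N. dpred R (\<lambda>v. v j = T v)))"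

lemma dterm_freshE:
  assumes "dterm R T"
  obtains N where "\<And>v i x. i \<ge> N \<Longrightarrow> T (v(i := x)) = T v" "\<And>v w. (\<And>i. i < N \<Longrightarrow> v i = w i) \<Longrightarrow> T v = T w"
    "\<And>j. j \<ge> N \<Longrightarrow> dpred R (\<lambda>v. v j = T v)"
proof -
  obtain N where N: "\<And>v w. (\<And>i. i < N \<Longrightarrow> v i = w i) \<Longrightarrow> T v = T w"
    "\<And>j. j \<ge> N \<Longrightarrow> dpred R (\<lambda>v. v j = T v)"
    using assms unfolding dterm_def by blast
  show thesis
    by (rule that[OF _ N]) (auto intro!: N(1))
qed

text \<open>\<open>P v (T v)\<close> is read as: some \<open>x\<close> equals \<open>T v\<close> and
  satisfies \<open>P v x\<close>. This \<open>x\<close> is stored in a variable on which neither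
  \<open>P\<close> nor \<open>T\<close> depends, hence the bounds \<open>M\<close> and
  \<open>N\<close>.\<close>

lemma dpred_comp1:
  assumes T: "dterm R T" and P: "\<And>i. i \<ge> M \<Longrightarrow> dpred R (\<lambda>v. P v (v i))"
    and fresh: "\<And>v i x y. i \<ge> M \<Longrightarrow> P (v(i := x)) y = P v y"
  shows "dpred R (\<lambda>v. P v (T v))"
proof -
  obtain N where N: "\<And>v i x. i \<ge> N \<Longrightarrow> T (v(i := x)) = T v"
    "\<And>j. j \<ge> N \<Longrightarrow> dpred R (\<lambda>v. v j = T v)"
    using dterm_freshE[OF T] by metis
  define i where "i = max M N"
  have i: "i \<ge> M" "i \<ge> N"
    by (auto simp: i_def)
  have "dpred R (\<lambda>v. \<exists>x. (v(i := x)) i = T (v(i := x)) \<and> P (v(i := x)) ((v(i := x)) i))"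
    by (rule dpred_ex[OF dpred_conj[OF N(2)[OF i(2)] P[OF i(1)]]])
  then show ?thesis
    by (rule dpred_cong) (simp add: N(1) fresh i)
qed

lemma dpred_comp2:
  assumes "dterm R S" "dterm R T" and P: "\<And>i j. i \<noteq> j \<Longrightarrow> dpred R (\<lambda>v. P (v i) (v j))"
  shows "dpred R (\<lambda>v. P (S v) (T v))"
proof -
  obtain N where N: "\<And>v i x. i \<ge> N \<Longrightarrow> T (v(i := x)) = T v"
    "\<And>j. j \<ge> N \<Longrightarrow> dpred R (\<lambda>v. v j = T v)"
    using dterm_freshE[OF assms(2)] by metis
  have "dpred R (\<lambda>v. P (v i) (T v))" for i
    by (rule dpred_comp1[OF assms(2), where M = "Suc i"]) (auto intro!: P)
  then show ?thesis
    by (rule dpred_comp1[OF assms(1), where M = N and P = "\<lambda>v y. P y (T v)"]) (simp only: N(1))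
qed

lemma dterm_var: "dterm R (\<lambda>v. v i)"
  unfolding dterm_def
proof (intro exI[of _ "Suc i"] conjI allI impI)
  fix j assume "j \<ge> Suc i"
  show "dpred R (\<lambda>v. v j = v i)"
    by (rule dpredI[of _ _ "\<lambda>_. 0" "Eq (Var (2 * j)) (Var (2 * i))"]) (simp add: merge_def)
qed simp

lemma dterm_const: "dterm R (\<lambda>v. c)"
  unfolding dterm_def
proof (intro exI[of _ 0] conjI allI impI)
  fix j :: nat
  show "dpred R (\<lambda>v. v j = c)"
    by (rule dpredI[of _ _ "\<lambda>_. c" "Eq (Var (2 * j)) (Var 1)"]) (simp add: merge_def)
qed simp

lemma dterm_comp1:
  assumes T: "dterm R T" and f: "\<And>i j. i \<noteq> j \<Longrightarrow> dpred R (\<lambda>v. v j = f (v i))"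
  shows "dterm R (\<lambda>v. f (T v))"
proof -
  obtain N where N: "\<And>v w. (\<And>i. i < N \<Longrightarrow> v i = w i) \<Longrightarrow> T v = T w"
    using dterm_freshE[OF T] by metis
  have "dpred R (\<lambda>v. v j = f (T v))" for j
    by (rule dpred_comp1[OF T, where M = "Suc j"]) (auto intro!: f)
  moreover have "f (T v) = f (T w)" if "\<And>i. i < N \<Longrightarrow> v i = w i" for v w
    using N[OF that] by simp
  ultimately show ?thesis
    unfolding dterm_def by blast
qed

lemma dterm_comp2:
  assumes S: "dterm R S" and T: "dterm R T"
    and f: "\<And>i j k. i \<noteq> j \<Longrightarrow> i \<noteq> k \<Longrightarrow> j \<noteq> k \<Longrightarrow> dpred R (\<lambda>v. v k = f (v i) (v j))"
  shows "dterm R (\<lambda>v. f (S v) (T v))"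
proof -
  obtain M where M: "\<And>v w. (\<And>i. i < M \<Longrightarrow> v i = w i) \<Longrightarrow> S v = S w"
    using dterm_freshE[OF S] by metis
  obtain N where N: "\<And>v w. (\<And>i. i < N \<Longrightarrow> v i = w i) \<Longrightarrow> T v = T w"
    "\<And>v i x. i \<ge> N \<Longrightarrow> T (v(i := x)) = T v"
    using dterm_freshE[OF T] by metis
  have 1: "dpred R (\<lambda>v. v k = f (v i) (T v))" if "i \<noteq> k" for i k
  proof (rule dpred_comp1[OF T, where M = "Suc (max i k)"])
    fix j assume "j \<ge> Suc (max i k)"
    then show "dpred R (\<lambda>v. v k = f (v i) (v j))"
      by (intro f that) simp_all
  qed auto
  have "dpred R (\<lambda>v. v k = f (S v) (T v))" for k
  proof (rule dpred_comp1[OF S, where M = "Suc (max N k)"])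
    fix i assume "i \<ge> Suc (max N k)"
    then show "dpred R (\<lambda>v. v k = f (v i) (T v))"
      by (intro 1) simp
  next
    fix v i x y assume "i \<ge> Suc (max N k)"
    then have "(v(i := x)) k = v k" "T (v(i := x)) = T v"
      by (auto intro!: N(2))
    then show "((v(i := x)) k = f y (T (v(i := x)))) = (v k = f y (T v))"
      by (simp only:)
  qed
  moreover have "f (S v) (T v) = f (S w) (T w)" if "\<And>i. i < max M N \<Longrightarrow> v i = w i" for v w
    using M[of v w] N(1)[of v w] that by simp
  ultimately show ?thesis
    unfolding dterm_def by blast
qed

lemma dpred_less: "dterm R S \<Longrightarrow> dterm R T \<Longrightarrow> dpred R (\<lambda>v. S v < T v)"
proof (erule dpred_comp2, assumption)
  fix i j :: nat
  show "dpred R (\<lambda>v. v i < v j)"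
    by (rule dpredI[of _ _ "\<lambda>_. 0" "Less (Var (2 * i)) (Var (2 * j))"]) (simp add: merge_def)
qed

lemma dpred_eq: "dterm R S \<Longrightarrow> dterm R T \<Longrightarrow> dpred R (\<lambda>v. S v = T v)"
proof (erule dpred_comp2, assumption)
  fix i j :: nat
  show "dpred R (\<lambda>v. v i = v j)"
    by (rule dpredI[of _ _ "\<lambda>_. 0" "Eq (Var (2 * i)) (Var (2 * j))"]) (simp add: merge_def)
qed

lemma dpred_le: "dterm R S \<Longrightarrow> dterm R T \<Longrightarrow> dpred R (\<lambda>v. S v \<le> T v)"
  using dpred_neg[OF dpred_less[of R T S]] by (simp add: not_less)

lemma dterm_add: "dterm R S \<Longrightarrow> dterm R T \<Longrightarrow> dterm R (\<lambda>v. S v + T v)"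
proof (erule dterm_comp2, assumption)
  fix i j k :: nat
  show "dpred R (\<lambda>v. v k = v i + v j)"
    by (rule dpredI[of _ _ "\<lambda>_. 0" "Eq (Var (2 * k)) (Add (Var (2 * i)) (Var (2 * j)))"])
      (simp add: merge_def)
qed

lemma dterm_mult: "dterm R S \<Longrightarrow> dterm R T \<Longrightarrow> dterm R (\<lambda>v. S v * T v)"
proof (erule dterm_comp2, assumption)
  fix i j k :: nat
  show "dpred R (\<lambda>v. v k = v i * v j)"
    by (rule dpredI[of _ _ "\<lambda>_. 0" "Eq (Var (2 * k)) (Mul (Var (2 * i)) (Var (2 * j)))"])
      (simp add: merge_def)
qed

lemma dterm_diff: "dterm R S \<Longrightarrow> dterm R T \<Longrightarrow> dterm R (\<lambda>v. S v - T v)"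
  using dterm_add[of R S "\<lambda>v. - 1 * T v"] dterm_mult[OF dterm_const[of R "- 1"], of T] by simp

lemma dterm_power: "dterm R T \<Longrightarrow> dterm R (\<lambda>v. T v ^ n)"
  by (induction n) (simp_all add: dterm_const dterm_mult)

lemma dterm_inverse:
  assumes "dterm R T"
  shows "dterm R (\<lambda>v. inverse (T v))"
proof (rule dterm_comp1[OF assms])
  fix i j :: nat
  \<comment> \<open>The second disjunct encodes the convention \<open>inverse 0 = 0\<close>.\<close>
  have "dpred R (\<lambda>v. v i * v j = 1 \<or> v i = 0 \<and> v j = 0)"
    by (intro dpred_disj dpred_conj dpred_eq dterm_mult dterm_var dterm_const)
  then show "dpred R (\<lambda>v. v j = inverse (v i))"
    by (rule dpred_cong) (auto simp: inverse_eq_divide eq_divide_eq mult.commute)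
qed

lemma dterm_divide: "dterm R S \<Longrightarrow> dterm R T \<Longrightarrow> dterm R (\<lambda>v. S v / T v)"
  unfolding divide_inverse by (intro dterm_mult dterm_inverse)

lemma dterm_abs:
  assumes "dterm R T"
  shows "dterm R (\<lambda>v. \<bar>T v\<bar>)"
proof (rule dterm_comp1[OF assms])
  fix i j :: nat
  have "dpred R (\<lambda>v. v j * v j = v i * v i \<and> 0 \<le> v j)"
    by (intro dpred_le dpred_conj dpred_eq dterm_mult dterm_var dterm_const)
  then show "dpred R (\<lambda>v. v j = \<bar>v i\<bar>)"
    by (rule dpred_cong) (auto simp: abs_if square_eq_iff)
qed

text \<open>The two variable conventions differ by a renaming: under \<open>merge\<close> the
  arguments 0 and 1 sit at the even places 0 and 2, and every other variable becomes an odd one,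
  that is, a parameter. Conversely, exchanging the variables 1 and 2 suffices.\<close>

lemma definable_fun_iff: "definable_fun R f \<longleftrightarrow> dpred R (\<lambda>v. v 1 = f (v 0))"
proof
  assume "definable_fun R f"
  then obtain p e where p: "\<And>x y. sat R (e(0 := x, 1 := y)) p \<longleftrightarrow> y = f x"
    unfolding definable_fun_def by blast
  define \<rho> where "\<rho> n = (if n = 0 then 0 else if n = 1 then 2 else 2 * n + 1)" for n :: nat
  have "inj \<rho>"
    unfolding \<rho>_def by (intro injI; simp split: if_splits; presburger)
  moreover have "(\<lambda>n. merge v e (\<rho> n)) = e(0 := v 0, 1 := v 1)" for v
    by (auto simp: fun_eq_iff merge_def \<rho>_def)
  ultimately show "dpred R (\<lambda>v. v 1 = f (v 0))"
    by (intro dpredI[of _ _ e "ren_fm \<rho> p"]) (simp add: sat_ren p del: One_nat_def)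
next
  assume "dpred R (\<lambda>v. v 1 = f (v 0))"
  then obtain p e where p: "\<And>v. v 1 = f (v 0) \<longleftrightarrow> sat R (merge v e) p"
    by (auto simp: dpred_def)
  define \<rho> where "\<rho> n = (if n = 2 then 1 else if n = 1 then 2 else n)" for n :: nat
  define d where "d n = merge (\<lambda>_. 0) e (\<rho> n)" for n
  have "inj \<rho>"
    by (rule inj_on_inverseI[where g = \<rho>]) (simp add: \<rho>_def)
  moreover have "(\<lambda>n. (d(0 := x, 1 := y)) (\<rho> n)) = merge ((\<lambda>_. 0)(0 := x, 1 := y)) e" for x y
    by (auto simp: fun_eq_iff merge_def \<rho>_def d_def)
  ultimately have "sat R (d(0 := x, 1 := y)) (ren_fm \<rho> p) \<longleftrightarrow> y = f x" for x y
    using p[of "(\<lambda>_. 0)(0 := x, 1 := y)"] by (simp add: sat_ren)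
  then show "definable_fun R f"
    unfolding definable_fun_def by blast
qed

lemma dterm_fun:
  assumes f: "definable_fun R f" and T: "dterm R T"
  shows "dterm R (\<lambda>v. f (T v))"
proof (rule dterm_comp1[OF T])
  fix i j :: nat assume ij: "i \<noteq> j"
  obtain p e where p: "\<And>x y. sat R (e(0 := x, 1 := y)) p \<longleftrightarrow> y = f x"
    using f unfolding definable_fun_def by blast
  define \<rho> where "\<rho> n = (if n = 0 then 2 * i else if n = 1 then 2 * j else 2 * n + 1)" for n :: nat
  have "inj \<rho>"
    unfolding \<rho>_def by (intro injI; use ij in \<open>simp split: if_splits\<close>; presburger)
  moreover have "(\<lambda>n. merge v e (\<rho> n)) = e(0 := v i, 1 := v j)" for v
    by (auto simp: fun_eq_iff merge_def \<rho>_def)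
  ultimately show "dpred R (\<lambda>v. v j = f (v i))"
    by (intro dpredI[of _ _ e "ren_fm \<rho> p"]) (simp add: sat_ren p del: One_nat_def)
qed

lemma definable_funI:
  assumes "dterm R (\<lambda>v. f (v 0))"
  shows "definable_fun R f"
  unfolding definable_fun_iff by (rule dpred_eq[OF dterm_var assms])

lemma definable_setI:
  assumes "dpred R (\<lambda>v. v 0 \<in> A)"
  shows "definable_set R A"
proof -
  obtain p e where p: "\<And>v. v 0 \<in> A \<longleftrightarrow> sat R (merge v e) p"
    using assms by (auto simp: dpred_def)
  have "merge (\<lambda>_. x) e = (merge (\<lambda>_. x) e)(0 := x)" for x
    by (auto simp: fun_eq_iff merge_def)
  moreover have "(merge (\<lambda>_. 0) e)(0 := x) = merge ((\<lambda>_. 0)(0 := x)) e" for x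
    by (auto simp: fun_eq_iff merge_def)
  ultimately have "A = {x. sat R ((merge (\<lambda>_. 0) e)(0 := x)) p}"
    using p[of "(\<lambda>_. 0)(0 := x)" for x] by auto
  then show ?thesis
    unfolding definable_set_def by blast
qed

lemmas dterm_intros = dterm_var dterm_const dterm_add dterm_mult dterm_diff dterm_power
  dterm_divide dterm_inverse dterm_abs

lemmas dpred_intros = dpred_neg dpred_conj dpred_disj dpred_imp dpred_less dpred_le dpred_eq

lemma definable_const: "definable_fun R (\<lambda>x. c)"
  and definable_ident: "definable_fun R (\<lambda>x. x)"
  by (intro definable_funI dterm_intros)+

lemma
  assumes "definable_fun R f" "definable_fun R g"
  shows definable_comp: "definable_fun R (\<lambda>x. f (g x))"
    and definable_add: "definable_fun R (\<lambda>x. f x + g x)"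
    and definable_diff: "definable_fun R (\<lambda>x. f x - g x)"
    and definable_mult: "definable_fun R (\<lambda>x. f x * g x)"
    and definable_divide: "definable_fun R (\<lambda>x. f x / g x)"
  by (intro definable_funI dterm_intros dterm_fun[OF assms(1)] dterm_fun[OF assms(2)])+

lemma definable_inverse:
  assumes "definable_fun R f"
  shows "definable_fun R (\<lambda>x. inverse (f x))"
  by (intro definable_funI dterm_intros dterm_fun[OF assms])

section \<open>Definable functions at infinity\<close>

lemma eventually_Union_decided:
  assumes "finite \<A>" "\<And>A. A \<in> \<A> \<Longrightarrow> eventually (\<lambda>x. x \<in> A) F \<or> eventually (\<lambda>x. x \<notin> A) F"
  shows "eventually (\<lambda>x. x \<in> \<Union>\<A>) F \<or> eventually (\<lambda>x. x \<notin> \<Union>\<A>) F"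
  using assms
proof (induction \<A>)
  case (insert A \<A>)
  then have "eventually (\<lambda>x. x \<in> \<Union>\<A>) F \<or> eventually (\<lambda>x. x \<notin> \<Union>\<A>) F"
    "eventually (\<lambda>x. x \<in> A) F \<or> eventually (\<lambda>x. x \<notin> A) F"
    by auto
  then show ?case
  proof (elim disjE)
    assume "eventually (\<lambda>x. x \<notin> \<Union>\<A>) F" "eventually (\<lambda>x. x \<notin> A) F"
    then show ?thesis by (intro disjI2) (auto elim: eventually_elim2)
  qed (rule disjI1, erule eventually_mono, simp)+
qed simp

locale o_minimal_expansion =
  fixes R :: "('f, 'r) real_field_expansion"
  assumes o_minimal: "o_minimal R"
begin

text \<open>Stated for any filter that decides all open rays, so as to cover both
  \<open>at_top\<close> and left neighbourhoods. Cells are points or intersections of two rays, and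
  a finite union of decided sets is decided.\<close>

lemma definable_set_decided:
  assumes "definable_set R A"
    and above: "\<And>a. eventually (\<lambda>x. a < x) F \<or> eventually (\<lambda>x. \<not> a < x) F"
    and below: "\<And>a. eventually (\<lambda>x. x < a) F \<or> eventually (\<lambda>x. \<not> x < a) F"
  shows "eventually (\<lambda>x. x \<in> A) F \<or> eventually (\<lambda>x. x \<notin> A) F"
proof -
  obtain \<A> where \<A>: "finite \<A>" "A = \<Union>\<A>"
    and "\<forall>I\<in>\<A>. (\<exists>a. I = {a}) \<or> (\<exists>a b :: ereal. I = {x. a < ereal x \<and> ereal x < b})"
    using o_minimal[unfolded o_minimal_def, THEN spec, THEN mp, OF assms(1)] by (elim exE conjE)
  note cell = bspec[OF this(3)]
  have conj: "eventually (\<lambda>x. P x \<and> Q x) F \<or> eventually (\<lambda>x. \<not> (P x \<and> Q x)) F"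
    if "eventually P F \<or> eventually (\<lambda>x. \<not> P x) F" "eventually Q F \<or> eventually (\<lambda>x. \<not> Q x) F"
    for P Q
    using that
  proof (elim disjE)
    assume "eventually P F" "eventually Q F"
    then show ?thesis by (simp add: eventually_conj)
  qed (rule disjI2, erule eventually_mono, simp)+
  show ?thesis
    unfolding \<A>(2)
  proof (rule eventually_Union_decided[OF \<A>(1)])
    fix I assume "I \<in> \<A>"
    from cell[OF this] show "eventually (\<lambda>x. x \<in> I) F \<or> eventually (\<lambda>x. x \<notin> I) F"
    proof (elim disjE exE)
      fix a assume "I = {a}"
      moreover have "x = a \<longleftrightarrow> \<not> a < x \<and> \<not> x < a" for x
        by auto
      ultimately show ?thesis
        using conj[of "\<lambda>x. \<not> a < x" "\<lambda>x. \<not> x < a"] above[of a] below[of a] by auto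
    next
      fix a b :: ereal assume I: "I = {x. a < ereal x \<and> ereal x < b}"
      have "eventually (\<lambda>x. a < ereal x) F \<or> eventually (\<lambda>x. \<not> a < ereal x) F"
        using above by (cases a) auto
      moreover have "eventually (\<lambda>x. ereal x < b) F \<or> eventually (\<lambda>x. \<not> ereal x < b) F"
        using below by (cases b) auto
      ultimately show ?thesis
        unfolding I mem_Collect_eq by (rule conj)
    qed
  qed
qed

lemma definable_set_at_top:
  assumes "definable_set R A"
  shows "eventually (\<lambda>x. x \<in> A) at_top \<or> eventually (\<lambda>x. x \<notin> A) at_top"
proof (rule definable_set_decided[OF assms])
  fix a :: real
  show "eventually (\<lambda>x. a < x) at_top \<or> eventually (\<lambda>x. \<not> a < x) at_top"
    using eventually_gt_at_top[of a] by blast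
  show "eventually (\<lambda>x. x < a) at_top \<or> eventually (\<lambda>x. \<not> x < a) at_top"
    using eventually_ge_at_top[of a] by (auto simp: not_less)
qed

lemma definable_set_at_left:
  assumes "definable_set R A"
  shows "eventually (\<lambda>x. x \<in> A) (at_left b) \<or> eventually (\<lambda>x. x \<notin> A) (at_left b)"
proof (rule definable_set_decided[OF assms])
  fix a :: real
  show "eventually (\<lambda>x. a < x) (at_left b) \<or> eventually (\<lambda>x. \<not> a < x) (at_left b)"
  proof (cases "a < b")
    case True
    then show ?thesis by (auto simp: eventually_at_left_field)
  next
    case False
    then show ?thesis
      by (intro disjI2) (auto simp: eventually_at_left_field intro!: exI[of _ "b - 1"])
  qed
  show "eventually (\<lambda>x. x < a) (at_left b) \<or> eventually (\<lambda>x. \<not> x < a) (at_left b)"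
  proof (cases "a < b")
    case True
    then show ?thesis by (auto simp: eventually_at_left_field)
  next
    case False
    then show ?thesis
      by (intro disjI1) (auto simp: eventually_at_left_field intro!: exI[of _ "b - 1"])
  qed
qed

lemma infinite_definable_set_interval:
  assumes "definable_set R A" "infinite A"
  shows "\<exists>p q. p < q \<and> {p<..<q} \<subseteq> A"
proof -
  obtain \<A> where \<A>: "finite \<A>" "A = \<Union>\<A>"
    and "\<forall>I\<in>\<A>. (\<exists>a. I = {a}) \<or> (\<exists>a b :: ereal. I = {x. a < ereal x \<and> ereal x < b})"
    using o_minimal[unfolded o_minimal_def, THEN spec, THEN mp, OF assms(1)] by (elim exE conjE)
  note cell = bspec[OF this(3)]
  from assms(2) obtain I where I: "I \<in> \<A>" "infinite I"
    using \<A> by blast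
  then obtain a b :: ereal where ab: "I = {x. a < ereal x \<and> ereal x < b}"
    using cell[OF I(1)] by auto
  obtain p where p: "p \<in> I"
    using I(2) by (metis finite.emptyI ex_in_conv)
  obtain q where q: "q \<in> I" "q \<noteq> p"
    using I(2) by (metis finite.emptyI finite_insert insert_iff subsetI finite_subset)
  have "{min p q<..<max p q} \<subseteq> I"
  proof
    fix x assume "x \<in> {min p q<..<max p q}"
    then consider "p < x" "x < q" | "q < x" "x < p"
      by fastforce
    then show "x \<in> I"
      using p q(1) unfolding ab mem_Collect_eq
      by cases (metis less_trans ereal_less(1) less_ereal.simps(1))+
  qed
  moreover have "min p q < max p q"
    using q(2) by auto
  ultimately show ?thesis
    using I(1) \<A>(2) by blast
qed

lemmas eventually_pos = eventually_gt_at_top[of "0 :: real"]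

lemma eventually_or_not:
  assumes "dpred R (\<lambda>v. P (v 0))"
  shows "eventually P at_top \<or> eventually (\<lambda>x. \<not> P x) at_top"
  using definable_set_at_top[OF definable_setI[of R "Collect P"]] assms by simp

lemma definable_less_or_ge:
  assumes "definable_fun R f" "definable_fun R g"
  shows "eventually (\<lambda>x. f x < g x) at_top \<or> eventually (\<lambda>x. g x \<le> f x) at_top"
proof -
  have "dpred R (\<lambda>v. f (v 0) < g (v 0))"
    by (intro dpred_less dterm_fun[OF assms(1)] dterm_fun[OF assms(2)] dterm_var)
  from eventually_or_not[OF this] show ?thesis
    by (simp add: not_less)
qed

text \<open>If \<open>f\<close> were not increasing near infinity, then every large \<open>b\<close> would have a left
  neighbourhood on which \<open>f\<close> stays below its values on \<open>[b, \<infinity>)\<close>. By uncountability these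
  neighbourhoods have a uniform length on some interval, near whose right end \<open>f\<close> then stays
  below all its later values.\<close>

lemma definable_strict_mono:
  assumes f: "definable_fun R f" and lim: "filterlim f at_top at_top"
  shows "\<exists>T. \<forall>x\<ge>T. \<forall>y>x. f x < f y"
proof -
  note df = dterm_fun[OF f dterm_var]
  define A where "A = {x. \<forall>y. x < y \<longrightarrow> f x < f y}"
  have "dpred R (\<lambda>v. v 0 < v 1 \<longrightarrow> f (v 0) < f (v 1))"
    by (intro dpred_imp dpred_less df dterm_var)
  then have "dpred R (\<lambda>v. v 0 \<in> A)"
    by (rule dpred_cong[OF dpred_all[where i = 1]]) (auto simp: A_def)
  from definable_set_at_top[OF definable_setI[OF this]]
  have "eventually (\<lambda>x. x \<in> A) at_top"
  proof
    assume "eventually (\<lambda>x. x \<notin> A) at_top"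
    then obtain M where M: "\<And>x. x \<ge> M \<Longrightarrow> \<exists>y>x. f y \<le> f x"
      unfolding eventually_at_top_linorder A_def by (auto simp: not_less)
    define B where "B = {b. \<exists>c. c < b \<and> (\<forall>y. \<forall>z. c < y \<and> y < b \<and> b \<le> z \<longrightarrow> f y < f z)}"
    have "dpred R (\<lambda>v. v 1 < v 2 \<and> v 2 < v 0 \<and> v 0 \<le> v 3 \<longrightarrow> f (v 2) < f (v 3))"
      by (intro dpred_imp dpred_less dpred_le dpred_conj df dterm_var)
    then have "dpred R (\<lambda>v. \<forall>z. v 1 < v 2 \<and> v 2 < v 0 \<and> v 0 \<le> z \<longrightarrow> f (v 2) < f z)"
      by (rule dpred_cong[OF dpred_all[where i = 3]]) simp
    then have "dpred R (\<lambda>v. \<forall>y. \<forall>z. v 1 < y \<and> y < v 0 \<and> v 0 \<le> z \<longrightarrow> f y < f z)"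
      by (rule dpred_cong[OF dpred_all[where i = 2]]) simp
    then have "dpred R (\<lambda>v. v 1 < v 0 \<and> (\<forall>y. \<forall>z. v 1 < y \<and> y < v 0 \<and> v 0 \<le> z \<longrightarrow> f y < f z))"
      by (intro dpred_conj dpred_less dterm_var)
    then have "dpred R (\<lambda>v. v 0 \<in> B)"
      by (rule dpred_cong[OF dpred_ex[where i = 1]]) (simp add: B_def)
    from definable_set_at_top[OF definable_setI[OF this]]
    have "eventually (\<lambda>x. x \<in> B) at_top"
    proof
      assume "eventually (\<lambda>x. x \<notin> B) at_top"
      then obtain x where x: "x \<ge> M" "\<And>b. b \<ge> x \<Longrightarrow> b \<notin> B"
        unfolding eventually_at_top_linorder by (metis max.cobounded1 max.cobounded2 order_trans)
      \<comment> \<open>\<open>S\<close> is bounded as \<open>f\<close> tends to infinity, and its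
        supremum \<open>b\<close> is not in \<open>S\<close>: a later point with value at most
        \<open>f b\<close> would lie in \<open>S\<close> again. So \<open>f\<close> exceeds
        \<open>f x\<close> from \<open>b\<close> on, while definability puts a left neighbourhood of
        \<open>b\<close> into \<open>S\<close>; hence \<open>b \<in> B\<close>.\<close>
      define S where "S = {y. x < y \<and> f y \<le> f x}"
      obtain L where L: "\<And>y. y \<ge> L \<Longrightarrow> f x < f y"
        using filterlim_at_top_dense[THEN iffD1, OF lim] unfolding eventually_at_top_linorder by blast
      have S_ne: "S \<noteq> {}"
        using M[OF x(1)] by (auto simp: S_def)
      have S_bdd: "bdd_above S"
        using L by (auto simp: S_def bdd_above_def not_le[symmetric] intro!: exI[of _ L])
          (metis linear not_le)
      define b where "b = Sup S"
      have le_b: "y \<le> b" if "y \<in> S" for y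
        using cSup_upper[OF that S_bdd] by (simp add: b_def)
      have xb: "x < b"
        using S_ne le_b by (force simp: S_def)
      have bS: "b \<notin> S"
      proof
        assume "b \<in> S"
        obtain y where "y > b" "f y \<le> f b"
          using M[of b] xb x(1) by auto
        then have "y \<in> S"
          using \<open>b \<in> S\<close> by (auto simp: S_def)
        then show False
          using le_b \<open>y > b\<close> by force
      qed
      have "dpred R (\<lambda>v. v 0 \<in> S)"
        unfolding S_def mem_Collect_eq by (intro dpred_conj dpred_less dpred_le df dterm_var dterm_const)
      from definable_set_at_left[OF definable_setI[OF this], of b]
      have "eventually (\<lambda>y. y \<in> S) (at_left b)"
      proof
        assume "eventually (\<lambda>y. y \<notin> S) (at_left b)"
        then obtain c where c: "c < b" "\<And>y. c < y \<Longrightarrow> y < b \<Longrightarrow> y \<notin> S"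
          by (auto simp: eventually_at_left_field)
        obtain y where "y \<in> S" "c < y"
          using less_cSupD[OF S_ne, of c] c(1) unfolding b_def by auto
        then show ?thesis
          using c(2)[of y] le_b[of y] bS by (cases "y = b") auto
      qed
      then obtain c where c: "c < b" "\<And>y. c < y \<Longrightarrow> y < b \<Longrightarrow> y \<in> S"
        by (auto simp: eventually_at_left_field)
      have "f y < f z" if "c < y" "y < b" "b \<le> z" for y z
      proof -
        have "z \<notin> S"
          using le_b[of z] bS \<open>b \<le> z\<close> by (cases "z = b") auto
        then have "f x < f z"
          using xb \<open>b \<le> z\<close> by (auto simp: S_def)
        with c(2)[OF that(1,2)] show ?thesis
          by (simp add: S_def)
      qed
      with c(1) have "b \<in> B"
        unfolding B_def by blast
      then show ?thesis
        using x(2)[of b] xb by simp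
    qed
    then obtain K where K: "\<And>b. b \<ge> K \<Longrightarrow> b \<in> B" "K \<ge> M"
      unfolding eventually_at_top_linorder by (metis max.cobounded1 max.cobounded2 order_trans)
    define C where "C n = {b. K \<le> b \<and> (\<forall>y. \<forall>z. b - inverse (real (Suc n)) < y \<and> y < b \<and> b \<le> z \<longrightarrow> f y < f z)}" for n
    have "{K..} \<subseteq> (\<Union>n. C n)"
    proof
      fix b assume b: "b \<in> {K..}"
      then obtain c where c: "c < b" "\<And>y z. c < y \<Longrightarrow> y < b \<Longrightarrow> b \<le> z \<Longrightarrow> f y < f z"
        using K(1)[of b] unfolding B_def by auto
      obtain n where "inverse (real (Suc n)) < b - c"
        using reals_Archimedean[of "b - c"] c(1) by auto
      then have "b \<in> C n"
        using b c(2) by (auto simp: C_def)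
      then show "b \<in> (\<Union>n. C n)"
        by blast
    qed
    moreover have "uncountable {K..}"
    proof
      assume "countable {K..}"
      then have "countable {K<..<K + 1}"
        by (rule countable_subset[rotated]) auto
      then show False
        using uncountable_open_interval[of K "K + 1"] by simp
    qed
    ultimately have "uncountable (\<Union>n. C n)"
      using countable_subset by blast
    then have "\<exists>n. infinite (C n)"
      by (rule contrapos_np) (simp add: countable_finite)
    then obtain n where n: "infinite (C n)" ..
    have "dpred R (\<lambda>v. v 0 - inverse (real (Suc n)) < v 1 \<and> v 1 < v 0 \<and> v 0 \<le> v 2 \<longrightarrow> f (v 1) < f (v 2))"
      by (intro dpred_imp dpred_less dpred_le dpred_conj df dterm_var dterm_diff dterm_const)
    then have "dpred R (\<lambda>v. \<forall>z. v 0 - inverse (real (Suc n)) < v 1 \<and> v 1 < v 0 \<and> v 0 \<le> z \<longrightarrow> f (v 1) < f z)"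
      by (rule dpred_cong[OF dpred_all[where i = 2]]) simp
    then have "dpred R (\<lambda>v. \<forall>y. \<forall>z. v 0 - inverse (real (Suc n)) < y \<and> y < v 0 \<and> v 0 \<le> z \<longrightarrow> f y < f z)"
      by (rule dpred_cong[OF dpred_all[where i = 1]]) simp
    then have "dpred R (\<lambda>v. v 0 \<in> C n)"
      unfolding C_def mem_Collect_eq by (intro dpred_conj dpred_le dterm_var dterm_const)
    from infinite_definable_set_interval[OF definable_setI[OF this] n]
    obtain p q where pq: "p < q" "{p<..<q} \<subseteq> C n"
      by blast
    \<comment> \<open>\<open>y\<close> is within \<open>inverse (real (Suc n))\<close> of
      \<open>q\<close>, so every \<open>b\<close> between \<open>y\<close> and \<open>q\<close> has
      \<open>y\<close> in its left neighbourhood. For \<open>z > y\<close>, such a \<open>b\<close>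
      below \<open>z\<close> gives \<open>f y < f z\<close>, against the choice of
      \<open>M\<close>.\<close>
    define y where "y = (max p (q - inverse (real (Suc n))) + q) / 2"
    have y: "p < y" "q - inverse (real (Suc n)) < y" "y < q"
      using pq(1) by (auto simp: y_def max_def)
    have "f y < f z" if "z > y" for z
    proof -
      define b where "b = (y + min q z) / 2"
      have "y < b" "b < z" "b < q"
        using that y(3) by (auto simp: b_def min_def)
      moreover from this have "b \<in> C n"
        using pq(2) y(1) by auto
      ultimately show ?thesis
        using y by (auto simp: C_def)
    qed
    moreover have "y \<ge> M"
      using pq(2) y K(2) by (force simp: C_def)
    ultimately show ?thesis
      using M[of y] by fastforce
  qed
  then show ?thesis
    by (auto simp: eventually_at_top_linorder A_def)
qed

end

section \<open>The ordered group of germs\<close>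

context o_minimal_expansion
begin

section \<open>Compositional inverses and orbits of definable functions\<close>

definition unb :: "(real \<Rightarrow> real) \<Rightarrow> bool" where
  "unb f \<longleftrightarrow> definable_fun R f \<and> filterlim f at_top at_top"

lemma unbD:
  assumes "unb f"
  shows "definable_fun R f" "filterlim f at_top at_top"
  using assms by (auto simp: unb_def)

lemma unb_eventually:
  assumes "unb f" "eventually P at_top"
  shows "eventually (\<lambda>t. P (f t)) at_top"
  using assms filterlim_iff unb_def by blast

lemma unb_ident: "unb (\<lambda>t. t)"
  unfolding unb_def by (intro conjI definable_ident filterlim_ident)

lemma unb_comp:
  assumes "unb f" "unb g"
  shows "unb (\<lambda>t. f (g t))"
  using definable_comp[OF unbD(1)[OF assms(1)] unbD(1)[OF assms(2)]]
    filterlim_compose[OF unbD(2)[OF assms(1)] unbD(2)[OF assms(2)]]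
  unfolding unb_def by blast

lemma unb_funpow: "unb f \<Longrightarrow> unb (f ^^ n)"
proof (induction n)
  case 0
  then show ?case using unb_ident by (simp add: id_def)
next
  case (Suc n)
  then show ?case using unb_comp[of f "f ^^ n"] by (simp add: comp_def)
qed

text \<open>Surjectivity near infinity comes from o-minimality rather than continuity: the image of
  \<open>{T..}\<close> is definable and contains \<open>f x\<close> for all large \<open>x\<close>,
  so it is not eventually avoided and contains all large reals. Outside the image the inverse is set
  to 0, which keeps its graph definable.\<close>

lemma unb_inverse_exists:
  assumes "unb f"
  shows "\<exists>g T Y. unb g \<and> (\<forall>x\<ge>T. g (f x) = x) \<and> (\<forall>y\<ge>Y. g y \<ge> T \<and> f (g y) = y)
    \<and> (\<forall>x\<ge>T. \<forall>y>x. f x < f y)"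
proof -
  note f = unbD[OF assms]
  obtain T where T: "\<And>x y. T \<le> x \<Longrightarrow> x < y \<Longrightarrow> f x < f y"
    using definable_strict_mono[OF f] by blast
  have inj: "x = y" if "T \<le> x" "T \<le> y" "f x = f y" for x y
    using T[of x y] T[of y x] that by (cases x y rule: linorder_cases) auto
  define g where "g y = (if \<exists>x. T \<le> x \<and> f x = y then THE x. T \<le> x \<and> f x = y else 0)" for y
  have gf: "g (f x) = x" if "T \<le> x" for x
    using that inj unfolding g_def by (auto intro!: the_equality)
  have "dpred R (\<lambda>v. T \<le> v 1 \<and> f (v 1) = v 0)"
    by (intro dpred_conj dpred_le dpred_eq dterm_fun[OF f(1)] dterm_var dterm_const)
  then have ex: "dpred R (\<lambda>v. \<exists>x. T \<le> x \<and> f x = v 0)"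
    by (rule dpred_cong[OF dpred_ex[where i = 1]]) simp
  have "dpred R (\<lambda>v. (T \<le> v 1 \<and> f (v 1) = v 0) \<or> v 1 = 0 \<and> \<not> (\<exists>x. T \<le> x \<and> f x = v 0))"
    by (intro dpred_disj dpred_conj dpred_neg ex dpred_le dpred_eq dterm_fun[OF f(1)] dterm_var dterm_const)
  then have "dpred R (\<lambda>v. v 1 = g (v 0))"
  proof (rule dpred_cong)
    fix v :: "nat \<Rightarrow> real"
    show "v 1 = g (v 0) \<longleftrightarrow> (T \<le> v 1 \<and> f (v 1) = v 0) \<or> v 1 = 0 \<and> \<not> (\<exists>x. T \<le> x \<and> f x = v 0)"
    proof (cases "\<exists>x. T \<le> x \<and> f x = v 0")
      case True
      then obtain x where x: "T \<le> x" "f x = v 0" by blast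
      then have "g (v 0) = x" using gf[of x] by simp
      then show ?thesis using x inj by auto
    next
      case False
      then show ?thesis by (auto simp: g_def)
    qed
  qed
  then have dg: "definable_fun R g"
    by (simp add: definable_fun_iff)
  have "eventually (\<lambda>y. \<exists>x. T \<le> x \<and> f x = y) at_top"
    using eventually_or_not[OF ex]
  proof
    assume "eventually (\<lambda>y. \<not> (\<exists>x. T \<le> x \<and> f x = y)) at_top"
    from unb_eventually[OF assms this] eventually_ge_at_top[of T]
    have "eventually (\<lambda>x :: real. False) at_top"
      by eventually_elim auto
    then show ?thesis by simp
  qed
  then obtain Y where "\<And>y. y \<ge> Y \<Longrightarrow> \<exists>x. T \<le> x \<and> f x = y"
    unfolding eventually_at_top_linorder by blast
  then have Y: "g y \<ge> T \<and> f (g y) = y" if "y \<ge> Y" for y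
    using that gf by metis
  have "filterlim g at_top at_top"
    unfolding filterlim_at_top
  proof
    fix Z
    show "eventually (\<lambda>y. Z \<le> g y) at_top"
      using eventually_ge_at_top[of Y] eventually_gt_at_top[of "f (max Z T)"]
    proof eventually_elim
      case (elim y)
      have "\<not> g y < max Z T"
        using T[of "g y" "max Z T"] Y[OF elim(1)] elim(2) by auto
      then show ?case by simp
    qed
  qed
  with dg have "unb g"
    by (simp add: unb_def)
  with gf Y T show ?thesis by blast
qed

lemma unb_inverse:
  assumes "unb f"
  obtains g where "unb g" "eventually (\<lambda>x. g (f x) = x) at_top" "eventually (\<lambda>x. f (g x) = x) at_top"
proof -
  obtain g T Y where "unb g" "\<forall>x\<ge>T. g (f x) = x" "\<forall>y\<ge>Y. g y \<ge> T \<and> f (g y) = y"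
    using unb_inverse_exists[OF assms] by blast
  then show thesis
    by (intro that) (auto simp: eventually_at_top_linorder)
qed

lemma unb_mono:
  assumes "unb f"
  obtains T where "\<And>x y. T \<le> x \<Longrightarrow> x < y \<Longrightarrow> f x < f y" "\<And>x y. T \<le> x \<Longrightarrow> x \<le> y \<Longrightarrow> f x \<le> f y"
proof -
  obtain T where "\<forall>x\<ge>T. \<forall>y>x. f x < f y"
    using definable_strict_mono[OF unbD[OF assms]] by blast
  then show thesis
    by (intro that[of T]) (auto simp: le_less)
qed

text \<open>A bounded orbit would have a supremum \<open>p\<close>. The preimage \<open>h p\<close>
  is smaller than \<open>p\<close>, so the orbit passes \<open>h p\<close> and the next iterate
  passes \<open>p\<close>. The preimage takes the place of continuity of \<open>g\<close>.\<close>

lemma unb_orbit_unbounded: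
  assumes g: "unb g" and gt: "eventually (\<lambda>t. t < g t) at_top"
  shows "\<exists>T. \<forall>t\<ge>T. \<forall>c. \<exists>n. c < (g ^^ n) t"
proof -
  obtain h T Y where h: "\<And>y. y \<ge> Y \<Longrightarrow> h y \<ge> T \<and> g (h y) = y" and mono: "\<And>x y. T \<le> x \<Longrightarrow> x < y \<Longrightarrow> g x < g y"
    using unb_inverse_exists[OF g] by metis
  obtain S where S: "\<And>t. t \<ge> S \<Longrightarrow> t < g t"
    using gt unfolding eventually_at_top_linorder by blast
  have "eventually (\<lambda>y. h y \<ge> S) at_top"
  proof -
    have "h y \<ge> S" if "y \<ge> Y" "y > g (max S T)" for y
      using mono[of "h y" "max S T"] h[OF that(1)] that(2) by force
    note * = this
    show ?thesis
      using eventually_ge_at_top[of Y] eventually_gt_at_top[of "g (max S T)"]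
      by eventually_elim (rule *)
  qed
  then obtain Y' where Y': "\<And>y. y \<ge> Y' \<Longrightarrow> h y \<ge> S"
    unfolding eventually_at_top_linorder by blast
  define T' where "T' = Max {T, S, Y, Y'}"
  have T': "T \<le> T'" "S \<le> T'" "Y \<le> T'" "Y' \<le> T'"
    by (auto simp: T'_def)
  have "\<exists>n. c < (g ^^ n) t" if t: "t \<ge> T'" for t c
  proof (rule ccontr)
    assume "\<nexists>n. c < (g ^^ n) t"
    then have bdd: "bdd_above (range (\<lambda>n. (g ^^ n) t))"
      by (auto simp: bdd_above_def not_less intro!: exI[of _ c])
    define p where "p = Sup (range (\<lambda>n. (g ^^ n) t))"
    have le: "(g ^^ n) t \<le> p" for n
      unfolding p_def using bdd by (intro cSup_upper) auto
    have pt: "p \<ge> T'"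
      using le[of 0] t by simp
    define x where "x = h p"
    have x: "x \<ge> T" "g x = p" "x < p"
      using h[of p] Y'[of p] S[of "h p"] pt T' by (auto simp: x_def)
    obtain n where "x < (g ^^ n) t"
      using less_cSupD[of "range (\<lambda>n. (g ^^ n) t)" x] x(3) unfolding p_def by auto
    then have "p < (g ^^ Suc n) t"
      using mono[OF x(1), of "(g ^^ n) t"] x(2) by simp
    then show False
      using le[of "Suc n"] by simp
  qed
  then show ?thesis by blast
qed

text \<open>Let \<open>g\<^sup>m(t) > f(t)\<close>. If \<open>f g \<le> g f\<close>, then
  \<open>f(g\<^sup>j(t)) \<le> g\<^sup>j(f(t)) < g\<^sup>m(g\<^sup>j(t))\<close> along the whole orbit of \<open>t\<close>, whereas \<open>f > g\<^sup>m\<close>.\<close>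

lemma unb_dominant:
  assumes f: "unb f" and g: "unb g" and gt: "eventually (\<lambda>t. t < g t) at_top"
    and dom: "\<And>n. eventually (\<lambda>t. (g ^^ n) t < f t) at_top"
  shows "\<not> eventually (\<lambda>t. f (g t) \<le> g (f t)) at_top"
proof
  assume "eventually (\<lambda>t. f (g t) \<le> g (f t)) at_top"
  then obtain T1 where T1: "\<And>t. t \<ge> T1 \<Longrightarrow> f (g t) \<le> g (f t)"
    unfolding eventually_at_top_linorder by blast
  obtain T2 where T2: "\<And>t. t \<ge> T2 \<Longrightarrow> t < g t"
    using gt unfolding eventually_at_top_linorder by blast
  obtain T3 where T3: "\<And>x y. T3 \<le> x \<Longrightarrow> x < y \<Longrightarrow> g x < g y" "\<And>x y. T3 \<le> x \<Longrightarrow> x \<le> y \<Longrightarrow> g x \<le> g y"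
    using unb_mono[OF g] by metis
  obtain T4 where T4: "\<And>t c. t \<ge> T4 \<Longrightarrow> \<exists>n. c < (g ^^ n) t"
    using unb_orbit_unbounded[OF g gt] by blast
  obtain T5 where T5: "\<And>t. t \<ge> T5 \<Longrightarrow> t < f t"
    using dom[of 0] unfolding eventually_at_top_linorder by auto
  define t where "t = Max {T1, T2, T3, T4, T5}"
  have t: "T1 \<le> t" "T2 \<le> t" "T3 \<le> t" "T4 \<le> t" "T5 \<le> t"
    by (auto simp: t_def)
  have orbit: "(g ^^ j) s \<ge> s" if "s \<ge> t" for j s
  proof (induction j)
    case (Suc j)
    then show ?case
      using T2[of "(g ^^ j) s"] that t by simp
  qed simp
  have upper: "f ((g ^^ j) t) \<le> (g ^^ j) (f t)" for j
  proof (induction j)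
    case (Suc j)
    have u: "(g ^^ j) t \<ge> t"
      by (rule orbit) simp
    then have "f ((g ^^ j) t) \<ge> t"
      using T5[of "(g ^^ j) t"] t by simp
    then have "g (f ((g ^^ j) t)) \<le> g ((g ^^ j) (f t))"
      using T3(2)[OF _ Suc] t by simp
    then show ?case
      using T1[of "(g ^^ j) t"] u t by simp
  qed simp
  obtain m where m: "f t < (g ^^ m) t"
    using T4[of t "f t"] t by blast
  have strict: "(g ^^ j) (f t) < (g ^^ j) ((g ^^ m) t)" for j
  proof (induction j)
    case (Suc j)
    have "(g ^^ j) (f t) \<ge> t"
      using orbit[of "f t" j] T5[of t] t by simp
    then show ?case
      using T3(1)[OF _ Suc] t by simp
  qed (simp add: m)
  obtain T6 where T6: "\<And>t. t \<ge> T6 \<Longrightarrow> (g ^^ m) t < f t"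
    using dom[of m] unfolding eventually_at_top_linorder by blast
  obtain j where j: "T6 < (g ^^ j) t"
    using T4[of t T6] t by blast
  have "f ((g ^^ j) t) < (g ^^ m) ((g ^^ j) t)"
    using order.strict_trans1[OF upper[of j] strict[of j]]
    by (simp flip: funpow_add[unfolded comp_def fun_eq_iff, rule_format] add: add.commute)
  then show False
    using T6[of "(g ^^ j) t"] j by simp
qed

section \<open>From definable functions to the ordered group of their germs\<close>

abbreviation GR :: "germ monoid" where
  "GR \<equiv> germ_group R"

abbreviation gmult :: "germ \<Rightarrow> germ \<Rightarrow> germ" (infixl \<open>\<odot>\<close> 70) where
  "x \<odot> y \<equiv> x \<otimes>\<^bsub>GR\<^esub> y"

abbreviation ginv :: "germ \<Rightarrow> germ" (\<open>ginv _\<close> [81] 80) where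
  "ginv x \<equiv> inv\<^bsub>GR\<^esub> x"

abbreviation gpow :: "germ \<Rightarrow> nat \<Rightarrow> germ" (infixr \<open>\<up>\<close> 75) where
  "x \<up> n \<equiv> x [^]\<^bsub>GR\<^esub> n"

abbreviation gid :: germ where
  "gid \<equiv> \<one>\<^bsub>GR\<^esub>"

lemma abs_germ_eq_iff:
  assumes "unb f" "unb g"
  shows "abs_germ f = abs_germ g \<longleftrightarrow> eventually (\<lambda>t. f t = g t) at_top"
  using Quotient_rel[OF Quotient_germ, of f g] assms by (auto simp: unb_def)

lemma germ_less_abs:
  assumes "unb f" "unb g"
  shows "germ_less (abs_germ f) (abs_germ g) \<longleftrightarrow> eventually (\<lambda>t. f t < g t) at_top"
  using germ_less.abs_eq[of f g] assms by (auto simp: unb_def)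

lemma mult_abs:
  assumes "unb f" "unb g"
  shows "abs_germ f \<odot> abs_germ g = abs_germ (\<lambda>t. f (g t))"
  using germ_comp.abs_eq[of f g] assms by (auto simp: unb_def germ_group_def comp_def)

lemma one_abs: "gid = abs_germ (\<lambda>t. t)"
  by (simp add: germ_group_def germ_id.abs_eq)

lemma carrier_iff: "x \<in> carrier GR \<longleftrightarrow> (\<exists>f. unb f \<and> x = abs_germ f)"
  by (auto simp: germ_group_def unb_def)

lemma abs_in_carrier: "unb f \<Longrightarrow> abs_germ f \<in> carrier GR"
  by (auto simp: carrier_iff)

lemma group_germ_group: "group GR"
proof (rule groupI)
  fix x y assume "x \<in> carrier GR" "y \<in> carrier GR"
  then show "x \<odot> y \<in> carrier GR"
    by (auto simp: carrier_iff mult_abs intro!: unb_comp)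
next
  show "gid \<in> carrier GR"
    using unb_ident by (auto simp: carrier_iff one_abs)
next
  fix x y z assume "x \<in> carrier GR" "y \<in> carrier GR" "z \<in> carrier GR"
  then show "x \<odot> y \<odot> z = x \<odot> (y \<odot> z)"
    by (auto simp: carrier_iff mult_abs unb_comp)
next
  fix x assume "x \<in> carrier GR"
  then obtain f where f: "unb f" "x = abs_germ f"
    by (auto simp: carrier_iff)
  then show "gid \<odot> x = x"
    using unb_ident by (simp add: one_abs mult_abs)
  obtain g where "unb g" "eventually (\<lambda>x. g (f x) = x) at_top"
    using unb_inverse[OF f(1)] by blast
  then show "\<exists>y\<in>carrier GR. y \<odot> x = gid"
    using f by (intro bexI[of _ "abs_germ g"])
      (simp_all add: mult_abs one_abs abs_germ_eq_iff unb_comp unb_ident abs_in_carrier)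
qed

lemma ordered_group_germ_group: "ordered_group GR germ_less"
proof -
  interpret group GR
    by (rule group_germ_group)
  show ?thesis
  proof
    fix x assume "x \<in> carrier GR"
    then show "\<not> germ_less x x"
      by (auto simp: carrier_iff germ_less_abs)
  next
    fix x y z assume "x \<in> carrier GR" "y \<in> carrier GR" "z \<in> carrier GR"
    then obtain f g h where
      fgh: "unb f" "unb g" "unb h" and [simp]: "x = abs_germ f" "y = abs_germ g" "z = abs_germ h"
      by (auto simp: carrier_iff)
    show "germ_less x z" if "germ_less x y" "germ_less y z"
      using that fgh by (auto simp: germ_less_abs elim: eventually_elim2)
    show "germ_less (x \<odot> z) (x \<odot> y)" if "germ_less z y"
    proof -
      obtain T where T: "\<And>a b. T \<le> a \<Longrightarrow> a < b \<Longrightarrow> f a < f b"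
        using unb_mono[OF fgh(1)] by metis
      have "eventually (\<lambda>t. h t < g t) at_top"
        using that fgh by (simp add: germ_less_abs)
      moreover have "eventually (\<lambda>t. T \<le> h t) at_top"
        using unb_eventually[OF fgh(3)] eventually_ge_at_top by blast
      ultimately have "eventually (\<lambda>t. f (h t) < f (g t)) at_top"
        by eventually_elim (rule T)
      then show ?thesis
        using fgh by (simp add: germ_less_abs mult_abs unb_comp)
    qed
    show "germ_less (z \<odot> x) (y \<odot> x)" if "germ_less z y"
    proof -
      have "eventually (\<lambda>t. h t < g t) at_top"
        using that fgh by (simp add: germ_less_abs)
      then have "eventually (\<lambda>t. h (f t) < g (f t)) at_top"
        by (rule unb_eventually[OF fgh(1)])
      then show ?thesis
        using fgh by (simp add: germ_less_abs mult_abs unb_comp)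
    qed
  next
    fix x y assume "x \<in> carrier GR" "y \<in> carrier GR"
    then obtain f g where fg: "unb f" "unb g" and [simp]: "x = abs_germ f" "y = abs_germ g"
      by (auto simp: carrier_iff)
    have "eventually (\<lambda>t. f t < g t) at_top \<or> eventually (\<lambda>t. g t < f t) at_top
      \<or> eventually (\<lambda>t. f t = g t) at_top"
      using definable_less_or_ge[OF unbD(1)[OF fg(1)] unbD(1)[OF fg(2)]]
    proof
      assume ge: "eventually (\<lambda>t. g t \<le> f t) at_top"
      from definable_less_or_ge[OF unbD(1)[OF fg(2)] unbD(1)[OF fg(1)]] show ?thesis
      proof
        assume "eventually (\<lambda>t. f t \<le> g t) at_top"
        with ge have "eventually (\<lambda>t. f t = g t) at_top"
          by eventually_elim simp
        then show ?thesis by blast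
      qed blast
    qed blast
    then show "germ_less x y \<or> x = y \<or> germ_less y x"
      using fg by (auto simp: germ_less_abs abs_germ_eq_iff)
  qed
qed

end

sublocale o_minimal_expansion \<subseteq> G: ordered_group "germ_group R" germ_less
  by (rule ordered_group_germ_group)

context o_minimal_expansion
begin

lemma pow_abs: "unb f \<Longrightarrow> abs_germ f \<up> n = abs_germ (f ^^ n)"
proof (induction n)
  case 0
  then show ?case by (simp add: one_abs id_def)
next
  case (Suc n)
  then show ?case
    using mult_abs[OF unb_funpow[OF Suc.prems, of n] Suc.prems]
    by (simp add: funpow_swap1 comp_def)
qed

lemma inv_abs:
  assumes "unb f" "unb g" "eventually (\<lambda>x. g (f x) = x) at_top"
  shows "ginv abs_germ f = abs_germ g"
  using assms by (intro G.inv_equality)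
    (auto simp: mult_abs one_abs abs_germ_eq_iff unb_comp unb_ident abs_in_carrier)

lemma positive_abs: "unb f \<Longrightarrow> abs_germ f \<in> G.positive \<longleftrightarrow> eventually (\<lambda>t. t < f t) at_top"
  using germ_less_abs[OF unb_ident, of f]
  by (auto simp: G.positive_def one_abs abs_in_carrier)

lemma dominant_germ_group: "dominant_ordered_group GR germ_less"
proof
  fix x y assume x: "x \<in> G.positive" and y: "y \<in> G.positive"
    and dom: "\<And>n. germ_less (y \<up> n) x"
  from x y obtain f g where fg: "unb f" "unb g" and [simp]: "x = abs_germ f" "y = abs_germ g"
    by (auto simp: G.positive_def carrier_iff)
  have "eventually (\<lambda>t. (g ^^ n) t < f t) at_top" for n
    using dom[of n] fg by (simp add: pow_abs germ_less_abs unb_funpow)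
  from unb_dominant[OF fg _ this]
  have "\<not> eventually (\<lambda>t. f (g t) \<le> g (f t)) at_top"
    using y fg by (simp add: positive_abs)
  then have "eventually (\<lambda>t. g (f t) < f (g t)) at_top"
    using definable_less_or_ge[OF unbD(1)[OF unb_comp[OF fg(2,1)]] unbD(1)[OF unb_comp[OF fg]]]
    by blast
  then show "germ_less (y \<odot> x) (x \<odot> y)"
    using fg by (simp add: mult_abs germ_less_abs unb_comp)
qed

end

sublocale o_minimal_expansion \<subseteq> G: dominant_ordered_group "germ_group R" germ_less
  by (rule dominant_germ_group)

section \<open>Linearisation of germs close to the identity\<close>

context dominant_ordered_group
begin

lemma flowableI:
  assumes \<sigma>: "flow \<sigma>" and f: "f \<in> carrier G" and d: "d > 0" "\<sigma> d \<le>\<^sub>G f" and e: "f \<le>\<^sub>G \<sigma> e"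
  shows "flowable f"
  unfolding flowable_def
proof (intro exI[of _ \<sigma>] conjI)
  note [simp] = flow_closed[OF \<sigma>]
  show "flow \<sigma>" by fact
  obtain n :: nat where "e \<le> n"
    using real_arch_simple by blast
  then have "f \<le>\<^sub>G \<sigma> n"
    using le_trans[OF f _ _ e flow_mono[OF \<sigma>]] by simp
  then have "f \<le>\<^sub>G \<sigma> 1 [^] n"
    by (simp add: flow_pow[OF \<sigma>])
  then show "\<exists>n::nat. f \<le>\<^sub>G \<sigma> 1 [^] n" ..
  obtain m :: nat where m: "1 < m * d"
    using reals_Archimedean3[OF d(1)] by blast
  have "\<sigma> 1 \<le>\<^sub>G \<sigma> d [^] m"
    using flow_mono[OF \<sigma>, of 1 "m * d"] m by (simp add: flow_pow[OF \<sigma>])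
  moreover have "\<sigma> d [^] m \<le>\<^sub>G f [^] m"
    using f d by (intro nat_pow_mono) simp_all
  ultimately have "\<sigma> 1 \<le>\<^sub>G f [^] m"
    using le_trans[of "\<sigma> 1" "\<sigma> d [^] m" "f [^] m"] f by simp
  then show "\<exists>n::nat. \<sigma> 1 \<le>\<^sub>G f [^] n" ..
qed

end

context o_minimal_expansion
begin

lemma germ_le_abs:
  assumes "unb f" "unb g" "eventually (\<lambda>t. f t \<le> g t) at_top"
  shows "G.le (abs_germ f) (abs_germ g)"
proof -
  have "\<not> germ_less (abs_germ g) (abs_germ f)"
  proof
    assume "germ_less (abs_germ g) (abs_germ f)"
    then have "eventually (\<lambda>t. g t < f t) at_top"
      using assms by (simp add: germ_less_abs)
    with assms(3) have "eventually (\<lambda>t :: real. False) at_top"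
      by eventually_elim simp
    then show False by simp
  qed
  then show ?thesis
    using G.lt_total assms abs_in_carrier by blast
qed

lemma flowable_absI:
  assumes f: "unb f" and \<sigma>: "\<And>c :: real. unb (\<sigma> c)"
    and add: "\<And>a b. eventually (\<lambda>t. \<sigma> (a + b) t = \<sigma> a (\<sigma> b t)) at_top"
    and pos: "\<And>c. c > 0 \<Longrightarrow> eventually (\<lambda>t. t < \<sigma> c t) at_top"
    and d: "d > 0" "eventually (\<lambda>t. \<sigma> d t \<le> f t) at_top"
    and e: "eventually (\<lambda>t. f t \<le> \<sigma> e t) at_top"
  shows "G.flowable (abs_germ f)"
proof (rule G.flowableI[where \<sigma> = "\<lambda>c. abs_germ (\<sigma> c)"])
  show "G.flow (\<lambda>c. abs_germ (\<sigma> c))"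
    unfolding G.flow_def
    using add pos \<sigma> unb_ident by (auto simp: abs_in_carrier mult_abs abs_germ_eq_iff unb_comp one_abs germ_less_abs)
qed (use germ_le_abs assms abs_in_carrier in auto)

lemma unb_mult_const:
  assumes "c > 0"
  shows "unb (\<lambda>t. c * t)"
  unfolding unb_def using assms
  by (auto intro!: definable_mult definable_const definable_ident
      filterlim_tendsto_pos_mult_at_top[OF tendsto_const _ filterlim_ident])

lemma unb_shift: "unb (\<lambda>t. t + c)"
  unfolding unb_def
  by (intro conjI definable_add definable_const definable_ident
      filterlim_tendsto_add_at_top[OF tendsto_const filterlim_ident, of c, unfolded add.commute[of c]])

lemma flowable_if_near_translation:
  assumes f: "unb f" and d: "d > 0" "eventually (\<lambda>t. t + d \<le> f t) at_top"
    and e: "eventually (\<lambda>t. f t \<le> t + e) at_top"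
  shows "G.flowable (abs_germ f)"
proof (rule flowable_absI[OF f, where \<sigma> = "\<lambda>c t. t + c"])
  show "unb (\<lambda>t. t + c)" for c
    by (rule unb_shift)
qed (use d e in \<open>auto simp: algebra_simps\<close>)

lemma flowable_if_near_dilation:
  assumes f: "unb f" and a: "a > 1" "eventually (\<lambda>t. a * t \<le> f t) at_top"
    and b: "b > 0" "eventually (\<lambda>t. f t \<le> b * t) at_top"
  shows "G.flowable (abs_germ f)"
proof (rule flowable_absI[OF f, where \<sigma> = "\<lambda>c t. 2 powr c * t" and d = "log 2 a" and e = "log 2 b"])
  fix c :: real
  show "unb (\<lambda>t. 2 powr c * t)"
    by (rule unb_mult_const) simp
next
  fix c :: real assume "c > 0"
  then have "1 < (2::real) powr c"
    by simp
  then show "eventually (\<lambda>t. t < 2 powr c * t) at_top"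
    by (intro eventually_mono[OF eventually_pos]) simp
qed (use a b in \<open>auto simp: powr_add\<close>)

lemma flowable_conj_abs:
  assumes f: "unb f" and p: "unb p" and q: "unb q" "eventually (\<lambda>x. q (p x) = x) at_top"
    and fl: "G.flowable (abs_germ (\<lambda>t. p (f (q t))))"
  shows "G.flowable (abs_germ f)"
proof (rule G.flowable_conj[of _ "abs_germ p"])
  show "G.flowable (abs_germ p \<odot> abs_germ f \<odot> ginv abs_germ p)"
    using fl assms by (simp add: inv_abs mult_abs unb_comp)
qed (use assms abs_in_carrier in auto)

text \<open>Set to 0 off the positive reals, so that for rational \<open>q\<close> the graph is
  given by a polynomial condition on one side and a constant on the other.\<close>

definition pw :: "real \<Rightarrow> real \<Rightarrow> real" where
  "pw q x = (if 0 < x then x powr q else 0)"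

lemma definable_pw:
  assumes "q \<in> \<rat>"
  shows "definable_fun R (pw q)"
proof -
  obtain i :: int and n :: nat where n: "n > 0" and q: "q = real_of_int i / real n"
    using Rats_eq_int_div_nat assms by blast
  have pow_iff: "y ^ n = x powr i \<longleftrightarrow> y = x powr q" if "x > 0" "y > 0" for x y :: real
  proof
    assume "y ^ n = x powr i"
    then have "(y powr n) powr (1 / n) = (x powr i) powr (1 / n)"
      using that by (simp add: powr_realpow)
    then show "y = x powr q"
      using that n by (simp add: powr_powr q)
  next
    assume "y = x powr q"
    then have "y ^ n = (x powr q) powr n"
      using that by (simp add: powr_realpow)
    then show "y ^ n = x powr i"
      using n by (simp add: powr_powr q)
  qed
  \<comment> \<open>The equation \<open>y ^ n = x powr i\<close> with negative exponents cleared: at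
    most one of \<open>nat i\<close> and \<open>nat (- i)\<close> is non-zero.\<close>
  have "dpred R (\<lambda>v. v 1 ^ n * v 0 ^ nat (- i) = v 0 ^ nat i \<and> 0 < v 0 \<and> 0 < v 1 \<or> \<not> 0 < v 0 \<and> v 1 = 0)"
    by (intro dpred_intros dterm_intros)
  then have "dpred R (\<lambda>v. v 1 = pw q (v 0))"
  proof (rule dpred_cong)
    fix v :: "nat \<Rightarrow> real"
    have "v 1 ^ n * v 0 ^ nat (- i) = v 0 ^ nat i \<longleftrightarrow> v 1 ^ n = v 0 powr i" if "0 < v 0"
    proof (cases "i \<ge> 0")
      case True
      then show ?thesis
        using that by (simp add: powr_realpow[symmetric])
    next
      case False
      then have "v 0 powr i * v 0 ^ nat (- i) = 1"
        using that by (simp add: powr_realpow[symmetric] powr_minus)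
      then have "v 1 ^ n = v 0 powr i \<longleftrightarrow> v 1 ^ n * v 0 ^ nat (- i) = 1"
        using that mult_right_cancel[of "v 0 ^ nat (- i)" "v 1 ^ n" "v 0 powr i"] by simp
      then show ?thesis
        using False by simp
    qed
    then show "v 1 = pw q (v 0) \<longleftrightarrow>
        v 1 ^ n * v 0 ^ nat (- i) = v 0 ^ nat i \<and> 0 < v 0 \<and> 0 < v 1 \<or> \<not> 0 < v 0 \<and> v 1 = 0"
      using pow_iff[of "v 0" "v 1"] by (auto simp: pw_def)
  qed
  then show ?thesis
    by (simp add: definable_fun_iff)
qed

lemma pw_half: "x > 0 \<Longrightarrow> pw (1/2) x = sqrt x"
  by (simp add: pw_def powr_half_sqrt)

lemma unb_gt: "unb f \<Longrightarrow> eventually (\<lambda>t. c < f t) at_top"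
  using filterlim_at_top_dense unb_def by blast

text \<open>By o-minimality a definable function is eventually below \<open>C\<close> or eventually
  at least \<open>C\<close>, so excluding every upper bound already yields the limit.\<close>

lemma unbI_not_bounded:
  assumes f: "definable_fun R f" and "\<And>C. C > 0 \<Longrightarrow> \<not> eventually (\<lambda>t. f t < C) at_top"
  shows "unb f"
  unfolding unb_def filterlim_at_top
proof (intro conjI f allI)
  fix Z :: real
  have "\<not> eventually (\<lambda>t. f t < max Z 1) at_top"
    by (rule assms) simp
  then have "eventually (\<lambda>t. max Z 1 \<le> f t) at_top"
    using definable_less_or_ge[OF f definable_const[of R "max Z 1"]] by blast
  then show "eventually (\<lambda>t. Z \<le> f t) at_top"
    by (rule eventually_mono) simp
qed

lemma unb_mult:
  assumes "unb f" "unb g"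
  shows "unb (\<lambda>t. f t * g t)"
  using assms filterlim_at_top_mult_at_top[of f at_top g] definable_mult
  unfolding unb_def by blast

lemma unb_ge:
  assumes "unb f" "definable_fun R g" "eventually (\<lambda>t. f t \<le> g t) at_top"
  shows "unb g"
  using assms filterlim_at_top_mono unfolding unb_def by blast

end

text \<open>With \<open>a = sqrt (P t)\<close> this is the inequality
  \<open>\<Phi> (f t) \<le> \<Phi> t\<close> behind \<open>drift_little_o_sqrt\<close>. For
  \<open>K = 2 / c\<close>, clearing denominators leaves \<open>a + c + K \<le> (K * c) * a\<close>;
  as \<open>K * c = 2\<close>, this is the hypothesis on \<open>a\<close>.\<close>

lemma drift_step:
  fixes a c :: real
  assumes "c > 0" "a \<ge> c + 2 / c"
  shows "(1 + 1 / a\<^sup>2) * (1 + (2 / c) / (a + c)) \<le> 1 + (2 / c) / a"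
proof -
  have a: "a > 0"
    using assms by (smt (verit) divide_pos_pos)
  define K where "K = 2 / c"
  have Kc: "K * c = 2"
    using assms by (simp add: K_def)
  have "(1 + 1 / a\<^sup>2) * (1 + K / (a + c)) = (a\<^sup>2 + 1) * (a + c + K) / (a\<^sup>2 * (a + c))"
    using a assms(1) by (simp add: add_divide_distrib[symmetric] add_nonneg_eq_0_iff divide_simps)
  also have "\<dots> \<le> (a + K) * (a * (a + c)) / (a\<^sup>2 * (a + c))"
  proof (rule divide_right_mono)
    have "(a + K) * (a * (a + c)) - (a\<^sup>2 + 1) * (a + c + K) = (K * c) * a - (a + c + K)"
      by (simp add: algebra_simps power2_eq_square)
    also have "\<dots> \<ge> 0"
      using assms(2) unfolding Kc by (simp add: K_def)
    finally show "(a\<^sup>2 + 1) * (a + c + K) \<le> (a + K) * (a * (a + c))"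
      by simp
  qed (use a assms(1) in simp)
  also have "\<dots> = 1 + K / a"
    using a assms(1) by (simp add: add_nonneg_eq_0_iff divide_simps power2_eq_square)
  finally show ?thesis
    by (simp add: K_def)
qed

context o_minimal_expansion
begin

text \<open>With \<open>h = 1/\<epsilon>\<close>, \<open>P(t) = t h(t)\<close> and \<open>P f P\<^sup>-\<^sup>1 = t + \<epsilon>\<^sub>1\<close>, one has \<open>\<epsilon>\<^sub>1 = o(\<surd>t)\<close>: otherwise
  the function \<open>\<Phi> = t (1 + K / \<surd>P)\<close>, which is unbounded and hence increasing, satisfies
  \<open>\<Phi> \<circ> f \<le> \<Phi>\<close> for a suitable constant \<open>K\<close>.\<close>

lemma drift_little_o_sqrt:
  assumes f: "unb f" and gt: "eventually (\<lambda>t. t < f t) at_top"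
    and h: "unb h" and hf: "eventually (\<lambda>t. (f t - t) * h t = 1) at_top"
    and P: "unb P" and Pdef: "\<And>t. P t = t * h t"
    and c: "c > 0" and drift: "eventually (\<lambda>t. P t + 3 * c * sqrt (P t) \<le> P (f t)) at_top"
  shows False
proof -
  define K where "K = 2 / c"
  define \<Phi> where "\<Phi> t = t * (1 + K / pw (1/2) (P t))" for t
  have dpwP: "definable_fun R (\<lambda>t. pw (1/2) (P t))"
    by (rule definable_comp[OF definable_pw unbD(1)[OF P]]) (simp add: Rats_divide)
  have d\<Phi>: "definable_fun R \<Phi>"
    unfolding \<Phi>_def[abs_def]
    by (intro definable_mult definable_ident definable_add definable_const
        definable_divide dpwP)
  have "unb \<Phi>"
  proof (rule unb_ge[OF unb_ident d\<Phi>])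
    show "eventually (\<lambda>t. t \<le> \<Phi> t) at_top"
      using eventually_pos
    proof eventually_elim
      case (elim t)
      have "K / pw (1/2) (P t) \<ge> 0"
        using c by (simp add: K_def pw_def)
      then have "t * 1 \<le> t * (1 + K / pw (1/2) (P t))"
        using elim by (intro mult_left_mono) auto
      then show ?case by (simp add: \<Phi>_def)
    qed
  qed
  then obtain T where T: "\<And>x y. T \<le> x \<Longrightarrow> x < y \<Longrightarrow> \<Phi> x < \<Phi> y"
    using unb_mono by metis
  have "eventually (\<lambda>t :: real. False) at_top"
    using eventually_ge_at_top[of T] eventually_pos gt hf drift
      unb_gt[OF P, of 0] unb_gt[OF P, of "(c + 2 / c)\<^sup>2"]
  proof eventually_elim
    case (elim t)
    define a where "a = sqrt (P t)"
    have a2: "a\<^sup>2 = P t" and apos: "a > 0"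
      using elim by (simp_all add: a_def)
    have "c + 2 / c = sqrt ((c + 2 / c)\<^sup>2)"
      using c by simp
    also have "\<dots> \<le> a"
      unfolding a_def using elim by (intro real_sqrt_le_mono) simp
    finally have ac: "c + 2 / c \<le> a" .
    moreover have "2 / c > 0"
      using c by simp
    ultimately have "c \<le> a"
      by linarith
    then have "c * c \<le> c * a"
      using c by (intro mult_left_mono) auto
    \<comment> \<open>The origin of the 3 in the drift bound: expanding gives
      \<open>2 * c * a + c * c\<close>, and \<open>c \<le> a\<close> absorbs the square. Hence the
      root of \<open>P\<close> grows by at least \<open>c\<close> in each step.\<close>
    then have "(a + c)\<^sup>2 \<le> P t + 3 * c * a"
      by (simp add: power2_eq_square algebra_simps a2[symmetric])
    also have "\<dots> \<le> P (f t)"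
      using elim by (simp add: a_def)
    finally have a': "a + c \<le> sqrt (P (f t))"
      by (rule real_le_rsqrt)
    have "h t \<noteq> 0"
      using elim by auto
    have "f t = t + 1 / h t"
      using elim \<open>h t \<noteq> 0\<close> by (simp add: field_simps)
    also have "\<dots> = t * (1 + 1 / a\<^sup>2)"
      using elim \<open>h t \<noteq> 0\<close> unfolding a2 Pdef by (simp add: field_simps)
    finally have ft: "f t = t * (1 + 1 / a\<^sup>2)" .
    have Pf: "P (f t) > 0"
      using a' apos c by (smt (verit) real_sqrt_gt_0_iff)
    have "\<Phi> (f t) = t * ((1 + 1 / a\<^sup>2) * (1 + K / sqrt (P (f t))))"
      using Pf by (simp add: \<Phi>_def ft pw_half)
    also have "\<dots> \<le> t * ((1 + 1 / a\<^sup>2) * (1 + K / (a + c)))"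
      using a' apos c elim
      by (intro mult_left_mono add_left_mono divide_left_mono) (auto simp: K_def Pf)
    also have "\<dots> \<le> t * (1 + K / a)"
      using elim drift_step[OF c ac] by (intro mult_left_mono) (auto simp: K_def)
    also have "\<dots> = \<Phi> t"
      using elim by (simp add: \<Phi>_def pw_half a_def)
    finally show False
      using T[of t "f t"] elim by simp
  qed
  then show False by simp
qed

text \<open>If \<open>\<epsilon> \<ge> 1\<close> and \<open>\<epsilon> = o(\<surd>t)\<close>, then \<open>V(t) = t/\<epsilon>(t)\<close> linearises \<open>t + \<epsilon>\<close> up to bounded
  errors: the increments of \<open>V\<close> are controlled because \<open>\<surd>t/\<epsilon>\<close> and \<open>t \<epsilon>\<close> are increasing.\<close>

lemma flowable_if_slow_displacement:
  assumes f: "unb f" and ge: "eventually (\<lambda>t. t + 1 \<le> f t) at_top"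
    and slow: "unb (\<lambda>t. pw (1/2) t / (f t - t))"
  shows "G.flowable (abs_germ f)"
proof -
  define \<epsilon> where "\<epsilon> t = f t - t" for t
  define V where "V t = t / \<epsilon> t" for t
  define S where "S t = pw (1/2) t / \<epsilon> t" for t
  define W where "W t = t * \<epsilon> t" for t
  have d\<epsilon>: "definable_fun R \<epsilon>"
    unfolding \<epsilon>_def[abs_def] by (intro definable_diff unbD(1)[OF f] definable_ident)
  have \<epsilon>1: "eventually (\<lambda>t. \<epsilon> t \<ge> 1) at_top"
    using ge by eventually_elim (simp add: \<epsilon>_def)
  have S: "unb S"
    using slow unfolding S_def[abs_def] \<epsilon>_def .
  have W: "unb W"
  proof (rule unb_ge[OF unb_ident])
    show "definable_fun R W"
      unfolding W_def[abs_def] by (intro definable_mult definable_ident d\<epsilon>)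
    show "eventually (\<lambda>t. t \<le> W t) at_top"
      using \<epsilon>1 eventually_pos
    proof eventually_elim
      case (elim t)
      then have "t * 1 \<le> t * \<epsilon> t"
        by (intro mult_left_mono) auto
      then show ?case by (simp add: W_def)
    qed
  qed
  have V: "unb V"
  proof (rule unb_ge[OF S])
    show "definable_fun R V"
      unfolding V_def[abs_def] by (intro definable_divide definable_ident d\<epsilon>)
    show "eventually (\<lambda>t. S t \<le> V t) at_top"
      using \<epsilon>1 eventually_ge_at_top[of 1]
    proof eventually_elim
      case (elim t)
      have "sqrt t * 1 \<le> sqrt t * sqrt t"
        using elim by (intro mult_left_mono) auto
      then show ?case
        using elim by (simp add: S_def V_def pw_half divide_right_mono)
    qed
  qed
  obtain TS where TS: "\<And>x y. TS \<le> x \<Longrightarrow> x < y \<Longrightarrow> S x < S y"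
    using unb_mono[OF S] by metis
  obtain TW where TW: "\<And>x y. TW \<le> x \<Longrightarrow> x < y \<Longrightarrow> W x < W y"
    using unb_mono[OF W] by metis
  have step: "eventually (\<lambda>t. V t + 1 / 3 \<le> V (f t) \<and> V (f t) \<le> V t + 3) at_top"
    using \<epsilon>1 eventually_ge_at_top[of TS] eventually_ge_at_top[of TW] eventually_ge_at_top[of 1]
      unb_eventually[OF f \<epsilon>1] unb_gt[OF V, of 1]
  proof eventually_elim
    case (elim t)
    define e where "e = \<epsilon> t"
    have e: "e \<ge> 1" and ft: "f t = t + e" and t: "t > 0"
      using elim by (simp_all add: e_def \<epsilon>_def)
    \<comment> \<open>This is \<open>V t > 1\<close>, which holds eventually as \<open>V\<close> is
      unbounded.\<close>
    have et: "e \<le> t"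
      using elim e by (simp add: V_def e_def[symmetric] field_simps)
    have e': "\<epsilon> (f t) > 0"
      using elim by simp
    have ft0: "f t > 0" "t < f t"
      using t e ft by auto
    \<comment> \<open>Lower bound: since \<open>V t = sqrt t * S t\<close> and \<open>S\<close>
      increases, it reduces to \<open>(t + e / 3)^2 \<le> t * (t + e)\<close>. By
      \<open>e \<le> t\<close>, the left side exceeds \<open>t * t\<close> by at most 7/9 of
      \<open>e * t\<close>, so 1/3 is admissible.\<close>
    have "V t + 1 / 3 = (t + e / 3) / e"
      using e by (simp add: V_def e_def[symmetric] field_simps)
    also have "\<dots> \<le> (sqrt (f t) * sqrt t) / e"
    proof (rule divide_right_mono)
      have "(t + e / 3)\<^sup>2 \<le> f t * t"
      proof -
        have "(t + e / 3)\<^sup>2 = t * t + 2 / 3 * (e * t) + (e * e) / 9" "f t * t = t * t + e * t"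
          unfolding ft by (simp_all add: power2_eq_square algebra_simps)
        moreover have "e * e \<le> e * t" "0 < e * t"
          using et e t by (simp_all add: mult_left_mono)
        ultimately show ?thesis
          by linarith
      qed
      then have "t + e / 3 \<le> sqrt (f t * t)"
        by (rule real_le_rsqrt)
      then show "t + e / 3 \<le> sqrt (f t) * sqrt t"
        by (simp add: real_sqrt_mult)
    qed (use e in simp)
    also have "\<dots> = sqrt (f t) * S t"
      using t by (simp add: S_def pw_half e_def)
    also have "\<dots> \<le> sqrt (f t) * S (f t)"
      using TS[of t "f t"] elim ft0 by (intro mult_left_mono) auto
    also have "\<dots> = V (f t)"
      using ft0 e' by (simp add: S_def V_def pw_half)
    finally have 1: "V t + 1 / 3 \<le> V (f t)" .
    \<comment> \<open>Upper bound: \<open>W\<close> increases, and replacing \<open>W (f t)\<close>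
      by \<open>W t\<close> gives \<open>(t + e)^2 / (t * e) = V t + 2 + e / t\<close>; then
      \<open>e \<le> t\<close> yields the constant 3.\<close>
    have "V (f t) = (f t)\<^sup>2 / W (f t)"
      using ft0 e' by (simp add: V_def W_def power2_eq_square)
    also have "\<dots> \<le> (f t)\<^sup>2 / W t"
      using TW[of t "f t"] elim ft0 e' t e
      by (intro divide_left_mono mult_pos_pos) (auto simp: W_def)
    also have "\<dots> = V t + 2 + e / t"
      using t e by (simp add: W_def V_def e_def[symmetric] ft power2_eq_square field_simps)
    also have "\<dots> \<le> V t + 3"
      using et t by simp
    finally show ?case
      using 1 by simp
  qed
  obtain Q where Q: "unb Q" "eventually (\<lambda>x. Q (V x) = x) at_top" "eventually (\<lambda>x. V (Q x) = x) at_top"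
    using unb_inverse[OF V] by blast
  have "G.flowable (abs_germ (\<lambda>t. V (f (Q t))))"
  proof (rule flowable_if_near_translation)
    show "unb (\<lambda>t. V (f (Q t)))"
      by (intro unb_comp[OF V] unb_comp[OF f] Q(1))
    show "eventually (\<lambda>t. t + 1 / 3 \<le> V (f (Q t))) at_top"
      using unb_eventually[OF Q(1) step] Q(3) by eventually_elim simp
    show "eventually (\<lambda>t. V (f (Q t)) \<le> t + 3) at_top"
      using unb_eventually[OF Q(1) step] Q(3) by eventually_elim simp
  qed simp
  then show ?thesis
    using flowable_conj_abs[OF f V Q(1,2)] by blast
qed

text \<open>Two conjugations. As \<open>h = 1 / (f t - t)\<close> increases,
  \<open>P (f t) \<ge> f t * h t = P t + 1\<close>, so conjugation by \<open>P\<close> raises the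
  displacement to at least 1, and \<open>drift_little_o_sqrt\<close> keeps it below every positive
  multiple of \<open>sqrt t\<close>. The second conjugation is that of
  \<open>flowable_if_slow_displacement\<close>.\<close>

lemma flowable_if_small_displacement:
  assumes f: "unb f" and gt: "eventually (\<lambda>t. t < f t) at_top"
    and small: "((\<lambda>t. f t - t) \<longlongrightarrow> 0) at_top"
  shows "G.flowable (abs_germ f)"
proof -
  define h where "h t = inverse (f t - t)" for t
  define P where "P t = t * h t" for t
  have h: "unb h"
    unfolding unb_def h_def[abs_def]
    using gt by (intro conjI definable_inverse definable_diff definable_ident unbD(1)[OF f]
        filterlim_inverse_at_top[OF small]) (auto elim: eventually_mono)
  have P: "unb P"
    unfolding P_def[abs_def] by (rule unb_mult[OF unb_ident h])
  have hf: "eventually (\<lambda>t. (f t - t) * h t = 1) at_top"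
    using gt by eventually_elim (simp add: h_def)
  obtain T where T: "\<And>x y. T \<le> x \<Longrightarrow> x < y \<Longrightarrow> h x < h y"
    using unb_mono[OF h] by metis
  have step: "eventually (\<lambda>t. P t + 1 \<le> P (f t)) at_top"
    using gt hf eventually_ge_at_top[of T] eventually_pos
  proof eventually_elim
    case (elim t)
    have "P t + 1 = f t * h t"
      using elim by (simp add: P_def algebra_simps)
    also have "\<dots> \<le> f t * h (f t)"
      using T[of t "f t"] elim by (intro mult_left_mono) auto
    finally show ?case by (simp add: P_def)
  qed
  obtain Q where Q: "unb Q" "eventually (\<lambda>x. Q (P x) = x) at_top" "eventually (\<lambda>x. P (Q x) = x) at_top"
    using unb_inverse[OF P] by blast
  define g where "g t = P (f (Q t))" for t
  have g: "unb g"
    unfolding g_def[abs_def] by (intro unb_comp[OF P] unb_comp[OF f] Q(1))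
  have g1: "eventually (\<lambda>t. t + 1 \<le> g t) at_top"
    unfolding g_def using unb_eventually[OF Q(1) step] Q(3) by eventually_elim simp
  have "unb (\<lambda>t. pw (1/2) t / (g t - t))"
  proof (rule unbI_not_bounded)
    show "definable_fun R (\<lambda>t. pw (1/2) t / (g t - t))"
      by (intro definable_divide definable_diff definable_ident unbD(1)[OF g] definable_pw
          Rats_divide) simp_all
    fix C :: real assume C: "C > 0"
    show "\<not> eventually (\<lambda>t. pw (1/2) t / (g t - t) < C) at_top"
    proof
      assume bounded: "eventually (\<lambda>t. pw (1/2) t / (g t - t) < C) at_top"
      \<comment> \<open>Chosen so that \<open>sqrt t \<le> C * (g t - t)\<close> becomes
        \<open>3 * c * sqrt t \<le> g t - t\<close>, the drift excluded by
        \<open>drift_little_o_sqrt\<close>.\<close>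
      define c where "c = 1 / (3 * C)"
      have c: "c > 0"
        using C by (simp add: c_def)
      have *: "eventually (\<lambda>t. t + 3 * c * sqrt t \<le> g t) at_top"
        using bounded g1 eventually_pos
      proof eventually_elim
        case (elim t)
        then have "sqrt t \<le> C * (g t - t)"
          by (simp add: pw_half field_simps)
        then have "3 * c * sqrt t \<le> g t - t"
          using C by (simp add: c_def field_simps)
        then show ?case by simp
      qed
      have "eventually (\<lambda>t. P t + 3 * c * sqrt (P t) \<le> P (f t)) at_top"
        using unb_eventually[OF P *] Q(2) by eventually_elim (simp add: g_def)
      from drift_little_o_sqrt[OF f gt h hf P P_def c this] show False .
    qed
  qed
  from flowable_if_slow_displacement[OF g g1 this]
  show ?thesis
    unfolding g_def[abs_def] using flowable_conj_abs[OF f P Q(1,2)] by blast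
qed

end

section \<open>Regular variation and Miller's dichotomy\<close>

text \<open>The epsilon definition of a limit is first-order: the fresh variables \<open>k\<close>,
  \<open>Suc k\<close> and \<open>Suc (Suc k)\<close> hold the tolerance, the threshold and the
  point.\<close>

lemma dpred_tendsto:
  assumes F: "\<And>i j. dterm R (\<lambda>v. F (v i) (v j))" and S: "dterm R S" and T: "dterm R T"
  shows "dpred R (\<lambda>v. ((\<lambda>t. F (S v) t) \<longlongrightarrow> T v) at_top)"
proof (rule dpred_comp2[OF S T])
  fix i j :: nat
  define k where "k = Suc (max i j)"
  have k: "i \<noteq> k" "j \<noteq> k" "i \<noteq> Suc k" "j \<noteq> Suc k" "i \<noteq> Suc (Suc k)" "j \<noteq> Suc (Suc k)"
    by (auto simp: k_def)
  have "dpred R (\<lambda>v. v (Suc k) < v (Suc (Suc k)) \<longrightarrow> \<bar>F (v i) (v (Suc (Suc k))) - v j\<bar> < v k)"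
    by (intro dpred_intros dterm_intros F)
  from dpred_all[OF this, where i = "Suc (Suc k)"]
  have "dpred R (\<lambda>v. \<forall>t. v (Suc k) < t \<longrightarrow> \<bar>F (v i) t - v j\<bar> < v k)"
    by (rule dpred_cong) (simp add: k)
  from dpred_ex[OF this, where i = "Suc k"]
  have "dpred R (\<lambda>v. \<exists>N. \<forall>t. N < t \<longrightarrow> \<bar>F (v i) t - v j\<bar> < v k)"
    by (rule dpred_cong) (simp add: k)
  then have "dpred R (\<lambda>v. 0 < v k \<longrightarrow> (\<exists>N. \<forall>t. N < t \<longrightarrow> \<bar>F (v i) t - v j\<bar> < v k))"
    by (intro dpred_intros dterm_intros)
  from dpred_all[OF this, where i = k]
  show "dpred R (\<lambda>v. ((\<lambda>t. F (v i) t) \<longlongrightarrow> v j) at_top)"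
    by (rule dpred_cong) (simp add: k tendsto_iff eventually_at_top_dense dist_real_def)
qed

lemma Rats_dense_left_right:
  fixes f :: "real \<Rightarrow> real"
  assumes "isCont f r"
  shows "l < f r \<Longrightarrow> \<exists>p\<in>\<rat>. p < r \<and> l < f p" "l < f r \<Longrightarrow> \<exists>q\<in>\<rat>. r < q \<and> l < f q"
    "f r < u \<Longrightarrow> \<exists>p\<in>\<rat>. p < r \<and> f p < u" "f r < u \<Longrightarrow> \<exists>q\<in>\<rat>. r < q \<and> f q < u"
proof -
  have left: "\<exists>p\<in>\<rat>. p < r \<and> P p" and right: "\<exists>q\<in>\<rat>. r < q \<and> P q" if P: "eventually P (nhds r)" for P
  proof -
    obtain d where d: "d > 0" "\<And>y. dist y r < d \<Longrightarrow> P y"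
      using P unfolding eventually_nhds_metric by blast
    obtain p where "p \<in> \<rat>" "r - d < p" "p < r"
      using Rats_dense_in_real[of "r - d" r] d(1) by auto
    then show "\<exists>p\<in>\<rat>. p < r \<and> P p"
      using d(2)[of p] by (auto simp: dist_real_def)
    obtain q where "q \<in> \<rat>" "r < q" "q < r + d"
      using Rats_dense_in_real[of r "r + d"] d(1) by auto
    then show "\<exists>q\<in>\<rat>. r < q \<and> P q"
      using d(2)[of q] by (auto simp: dist_real_def)
  qed
  have lim: "(f \<longlongrightarrow> f r) (nhds r)"
    using assms by (simp add: isCont_def tendsto_at_iff_tendsto_nhds)
  have lower: "eventually (\<lambda>x. l < f x) (nhds r)" if "l < f r"
    using order_tendstoD(1)[OF lim that] .
  have upper: "eventually (\<lambda>x. f x < u) (nhds r)" if "f r < u"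
    using order_tendstoD(2)[OF lim that] .
  show "l < f r \<Longrightarrow> \<exists>p\<in>\<rat>. p < r \<and> l < f p" "l < f r \<Longrightarrow> \<exists>q\<in>\<rat>. r < q \<and> l < f q"
    "f r < u \<Longrightarrow> \<exists>p\<in>\<rat>. p < r \<and> f p < u" "f r < u \<Longrightarrow> \<exists>q\<in>\<rat>. r < q \<and> f q < u"
    using left[OF lower] right[OF lower] left[OF upper] right[OF upper] by blast+
qed

context o_minimal_expansion
begin

lemma unb_pwI:
  assumes "definable_fun R (pw q)" "q > 0"
  shows "unb (pw q)"
  unfolding unb_def
proof (intro conjI assms(1))
  show "filterlim (pw q) at_top at_top"
    unfolding filterlim_at_top
  proof
    fix Z :: real
    show "eventually (\<lambda>x. Z \<le> pw q x) at_top"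
      using eventually_ge_at_top[of "(max 1 Z) powr (1 / q)"]
    proof eventually_elim
      case (elim x)
      have "0 < max 1 Z powr (1 / q)"
        by simp
      then have x: "x > 0"
        using elim by linarith
      have "Z \<le> (max 1 Z powr (1 / q)) powr q"
        using assms(2) by (simp add: powr_powr)
      also have "\<dots> \<le> x powr q"
        using elim assms(2) by (intro powr_mono2) auto
      finally show ?case
        using x by (simp add: pw_def)
    qed
  qed
qed

lemma unb_pw: "q \<in> \<rat> \<Longrightarrow> q > 0 \<Longrightarrow> unb (pw q)"
  by (rule unb_pwI[OF definable_pw])

lemma pw_mult: "t > 0 \<Longrightarrow> pw p t * pw q t = pw (p + q) t"
  by (simp add: pw_def powr_add)

lemma pw_pos: "t > 0 \<Longrightarrow> 0 < pw p t"
  by (simp add: pw_def)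

lemma pw_minus: "pw (- p) t = inverse (pw p t)"
  by (simp add: pw_def powr_minus)

text \<open>\<open>index g r\<close> says that \<open>g(t) = t\<^bsup>r + o(1)\<^esup>\<close>; such a definable \<open>g\<close> is regularly varying.\<close>

definition index :: "(real \<Rightarrow> real) \<Rightarrow> real \<Rightarrow> bool" where
  "index g r \<longleftrightarrow> definable_fun R g \<and> eventually (\<lambda>t. 0 < g t) at_top \<and>
     (\<forall>p\<in>\<rat>. p < r \<longrightarrow> unb (\<lambda>t. g t * pw (- p) t)) \<and>
     (\<forall>q\<in>\<rat>. r < q \<longrightarrow> unb (\<lambda>t. pw q t / g t))"

lemma indexD:
  assumes "index g r"
  shows "definable_fun R g" "eventually (\<lambda>t. 0 < g t) at_top"
    "\<And>p. p \<in> \<rat> \<Longrightarrow> p < r \<Longrightarrow> unb (\<lambda>t. g t * pw (- p) t)"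
    "\<And>q. q \<in> \<rat> \<Longrightarrow> r < q \<Longrightarrow> unb (\<lambda>t. pw q t / g t)"
  using assms unfolding index_def by blast+

lemma index_lower:
  assumes "index g r" "p \<in> \<rat>" "p < r"
  shows "eventually (\<lambda>t. C * t powr p \<le> g t) at_top"
  using unb_gt[OF indexD(3)[OF assms], of C] eventually_pos
proof eventually_elim
  case (elim t)
  then have "C * pw p t < g t"
    using pw_pos[of t p] by (simp add: pw_minus field_simps)
  then show ?case
    using elim by (simp add: pw_def)
qed

lemma index_upper:
  assumes "index g r" "q \<in> \<rat>" "r < q"
  shows "eventually (\<lambda>t. C * g t \<le> t powr q) at_top"
  using unb_gt[OF indexD(4)[OF assms], of C] eventually_pos indexD(2)[OF assms(1)]
proof eventually_elim
  case (elim t)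
  then have "C * g t < pw q t"
    by (simp add: field_simps)
  then show ?case
    using elim by (simp add: pw_def)
qed

text \<open>For rational \<open>p < r < q\<close> the functions \<open>g t * t powr (- p)\<close>
  and \<open>t powr q / g t\<close> increase, which squeezes the ratio between
  \<open>a powr p\<close> and \<open>a powr q\<close>; then \<open>p\<close> and \<open>q\<close>
  approach \<open>r\<close>.\<close>

lemma index_ratio_ge_one:
  assumes g: "index g r" and a: "a \<ge> 1"
  shows "((\<lambda>t. g (a * t) / g t) \<longlongrightarrow> a powr r) at_top"
proof (rule order_tendstoI)
  have cont: "isCont (\<lambda>x. a powr x) r"
    using a by (intro continuous_intros) auto
  have pos: "eventually (\<lambda>t. 0 < g (a * t)) at_top"
    using unb_eventually[OF unb_mult_const indexD(2)[OF g]] a by auto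
  {
    fix l assume "l < a powr r"
    then obtain p where p: "p \<in> \<rat>" "p < r" "l < a powr p"
      using Rats_dense_left_right(1)[OF cont] by blast
    obtain T where T: "\<And>x y. T \<le> x \<Longrightarrow> x \<le> y \<Longrightarrow> g x * pw (- p) x \<le> g y * pw (- p) y"
      using unb_mono[OF indexD(3)[OF g p(1,2)]] by metis
    show "eventually (\<lambda>t. l < g (a * t) / g t) at_top"
      using eventually_ge_at_top[of T] eventually_pos indexD(2)[OF g]
    proof eventually_elim
      case (elim t)
      have at: "t \<le> a * t" "a * t > 0"
        using elim a by (simp_all add: mult_le_cancel_right1)
      then have "g t * t powr (- p) \<le> g (a * t) * (a powr (- p) * t powr (- p))"
        using T[of t "a * t"] elim a by (simp add: pw_def powr_mult)
      then have "g t \<le> g (a * t) * a powr (- p)"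
        using elim by (simp add: mult.assoc[symmetric])
      then have "a powr p \<le> g (a * t) / g t"
        using elim a by (simp add: powr_minus field_simps)
      then show ?case
        using p by simp
    qed
  next
    fix u assume "a powr r < u"
    then obtain q where q: "q \<in> \<rat>" "r < q" "a powr q < u"
      using Rats_dense_left_right(4)[OF cont] by blast
    obtain T where T: "\<And>x y. T \<le> x \<Longrightarrow> x \<le> y \<Longrightarrow> pw q x / g x \<le> pw q y / g y"
      using unb_mono[OF indexD(4)[OF g q(1,2)]] by metis
    show "eventually (\<lambda>t. g (a * t) / g t < u) at_top"
      using eventually_ge_at_top[of T] eventually_pos indexD(2)[OF g] pos
    proof eventually_elim
      case (elim t)
      have at: "t \<le> a * t" "a * t > 0"
        using elim a by (simp_all add: mult_le_cancel_right1)
      then have "t powr q / g t \<le> (a powr q * t powr q) / g (a * t)"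
        using T[of t "a * t"] elim a by (simp add: pw_def powr_mult)
      then have "t powr q * g (a * t) \<le> t powr q * (a powr q * g t)"
        using elim by (simp add: field_simps)
      then have "g (a * t) \<le> a powr q * g t"
        using elim by simp
      then have "g (a * t) / g t \<le> a powr q"
        using elim by (simp add: field_simps)
      then show ?case
        using q by simp
    qed
  }
qed

text \<open>For \<open>a < 1\<close> the ratio at \<open>t\<close> is the inverse of the ratio for
  \<open>1 / a\<close> at \<open>a * t\<close>.\<close>

lemma index_ratio:
  assumes g: "index g r" and a: "a > 0"
  shows "((\<lambda>t. g (a * t) / g t) \<longlongrightarrow> a powr r) at_top"
proof (cases "a \<ge> 1")
  case True
  then show ?thesis by (rule index_ratio_ge_one[OF g])
next
  case False
  then have "1 / a \<ge> 1"
    using a by simp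
  from index_ratio_ge_one[OF g this]
  have "((\<lambda>t. g (1 / a * t) / g t) \<longlongrightarrow> (1 / a) powr r) at_top" .
  then have "((\<lambda>t. g (1 / a * (a * t)) / g (a * t)) \<longlongrightarrow> (1 / a) powr r) at_top"
    by (rule filterlim_compose[OF _ unbD(2)[OF unb_mult_const[OF a]]])
  then have "((\<lambda>t. inverse (g t / g (a * t))) \<longlongrightarrow> inverse ((1 / a) powr r)) at_top"
    using a by (intro tendsto_inverse) simp_all
  then show ?thesis
    using a by (simp add: powr_divide)
qed

lemma index_mult_pw:
  assumes g: "index g r" and s: "s \<in> \<rat>"
  shows "index (\<lambda>t. g t * pw s t) (r + s)"
  unfolding index_def
proof (intro conjI ballI impI)
  show dg: "definable_fun R (\<lambda>t. g t * pw s t)"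
    by (intro definable_mult indexD(1)[OF g] definable_pw s)
  show "eventually (\<lambda>t. 0 < g t * pw s t) at_top"
    using indexD(2)[OF g] eventually_pos by eventually_elim (simp add: pw_pos)
  fix p :: real assume p: "p \<in> \<rat>"
  {
    assume "p < r + s"
    then have "unb (\<lambda>t. g t * pw (- (p - s)) t)"
      using p s by (intro indexD(3)[OF g]) auto
    then show "unb (\<lambda>t. g t * pw s t * pw (- p) t)"
    proof (rule unb_ge)
      show "definable_fun R (\<lambda>t. g t * pw s t * pw (- p) t)"
        by (rule definable_mult[OF dg definable_pw]) (use p in simp)
      show "eventually (\<lambda>t. g t * pw (- (p - s)) t \<le> g t * pw s t * pw (- p) t) at_top"
        using eventually_pos by eventually_elim (simp add: mult.assoc pw_mult)
    qed
  next
    assume "r + s < p"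
    then have "unb (\<lambda>t. pw (p - s) t / g t)"
      using p s by (intro indexD(4)[OF g]) auto
    then show "unb (\<lambda>t. pw p t / (g t * pw s t))"
    proof (rule unb_ge)
      show "definable_fun R (\<lambda>t. pw p t / (g t * pw s t))"
        by (intro definable_divide dg definable_pw p)
      show "eventually (\<lambda>t. pw (p - s) t / g t \<le> pw p t / (g t * pw s t)) at_top"
        using eventually_pos by eventually_elim (simp add: pw_def powr_diff mult.commute)
    qed
  }
qed

text \<open>The increment \<open>D\<close> is eventually at most \<open>w\<close>, since
  \<open>w (b * t) / w t\<close> tends to 1. If \<open>D t < C * t powr p\<close> held with
  \<open>p < 0\<close>, adding \<open>K * t powr p\<close> to \<open>w\<close> would offset the
  growth: the sum is unbounded but does not increase from \<open>t\<close> to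
  \<open>b * t\<close>.\<close>

lemma index_increment:
  assumes w: "unb w" "index w 0" and b: "b > 1"
  shows "index (\<lambda>t. w (b * t) - w t) 0"
proof -
  define D where "D t = w (b * t) - w t" for t
  have ub: "unb (\<lambda>t. b * t)"
    using b by (intro unb_mult_const) simp
  have dD: "definable_fun R D"
    unfolding D_def[abs_def]
    by (intro definable_diff definable_comp[OF unbD(1)[OF w(1)] unbD(1)[OF ub]] unbD(1)[OF w(1)])
  obtain T where T: "\<And>x y. T \<le> x \<Longrightarrow> x < y \<Longrightarrow> w x < w y"
    using unb_mono[OF w(1)] by metis
  have Dpos: "eventually (\<lambda>t. 0 < D t) at_top"
    using eventually_ge_at_top[of T] eventually_pos
  proof eventually_elim
    case (elim t)
    then show ?case
      using T[of t "b * t"] b by (simp add: D_def)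
  qed
  have "index D 0"
    unfolding index_def
  proof (intro conjI ballI impI dD Dpos)
    fix q :: real assume q: "q \<in> \<rat>" "0 < q"
    have "((\<lambda>t. w (b * t) / w t) \<longlongrightarrow> 1) at_top"
      using index_ratio[OF w(2), of b] b by simp
    then have "eventually (\<lambda>t. w (b * t) / w t < 2) at_top"
      by (rule order_tendstoD) simp
    then have "eventually (\<lambda>t. D t \<le> w t) at_top"
      using indexD(2)[OF w(2)] by eventually_elim (simp add: D_def field_simps)
    then have *: "eventually (\<lambda>t. pw q t / w t \<le> pw q t / D t) at_top"
      using Dpos indexD(2)[OF w(2)] eventually_pos
    proof eventually_elim
      case (elim t)
      then show ?case
        using pw_pos[of t q] by (intro divide_left_mono) auto
    qed
    show "unb (\<lambda>t. pw q t / D t)"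
      by (rule unb_ge[OF indexD(4)[OF w(2) q] definable_divide[OF definable_pw[OF q(1)] dD] *])
  next
    fix p :: real assume p: "p \<in> \<rat>" "p < 0"
    show "unb (\<lambda>t. D t * pw (- p) t)"
    proof (rule unbI_not_bounded)
      show "definable_fun R (\<lambda>t. D t * pw (- p) t)"
        using p by (intro definable_mult dD definable_pw) simp
      fix C :: real assume C: "C > 0"
      show "\<not> eventually (\<lambda>t. D t * pw (- p) t < C) at_top"
      proof
        assume small: "eventually (\<lambda>t. D t * pw (- p) t < C) at_top"
        have b1: "b powr p < 1"
          using b p(2) by (simp add: powr_less_one)
        \<comment> \<open>The solution of \<open>C + K * b powr p = K\<close>, which is what
          \<open>\<Phi> (b * t) \<le> \<Phi> t\<close> requires; positive because
          \<open>p < 0\<close> and \<open>b > 1\<close>.\<close>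
        define K where "K = C / (1 - b powr p)"
        have K: "K > 0" "C + K * b powr p = K"
          using C b1 by (simp_all add: K_def field_simps)
        define \<Phi> where "\<Phi> t = w t + K * pw p t" for t
        have "unb \<Phi>"
        proof (rule unb_ge[OF w(1)])
          show "definable_fun R \<Phi>"
            unfolding \<Phi>_def[abs_def]
            by (intro definable_add definable_mult definable_const definable_pw p unbD(1)[OF w(1)])
          show "eventually (\<lambda>t. w t \<le> \<Phi> t) at_top"
            using K by (simp add: \<Phi>_def pw_def)
        qed
        then obtain S where S: "\<And>x y. S \<le> x \<Longrightarrow> x < y \<Longrightarrow> \<Phi> x < \<Phi> y"
          using unb_mono by metis
        have "eventually (\<lambda>t :: real. False) at_top"
          using small eventually_ge_at_top[of S] eventually_pos
        proof eventually_elim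
          case (elim t)
          have "\<Phi> (b * t) = w t + D t + K * (b powr p * t powr p)"
            using elim b by (simp add: \<Phi>_def D_def pw_def powr_mult)
          also have "D t \<le> C * t powr p"
            using elim by (simp add: pw_def powr_minus field_simps)
          also have "w t + C * t powr p + K * (b powr p * t powr p) = w t + (C + K * b powr p) * t powr p"
            by (simp add: algebra_simps)
          also have "\<dots> = \<Phi> t"
            using elim by (simp add: \<Phi>_def pw_def K)
          finally have "\<Phi> (b * t) \<le> \<Phi> t" by simp
          moreover have "\<Phi> t < \<Phi> (b * t)"
            using S[of t "b * t"] elim b by simp
          ultimately show False by simp
        qed
        then show False by simp
      qed
    qed
  qed
  then show ?thesis
    by (simp add: D_def[abs_def])
qed

text \<open>Telescoping: with \<open>D t = w (b * t) - w t\<close>, passing from \<open>k\<close> to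
  \<open>Suc k\<close> adds \<open>D (b ^ k * t) / D t\<close>, which tends to 1 because
  \<open>D\<close> again has index 0.\<close>

lemma increment_ratio_power:
  assumes w: "unb w" "index w 0" and b: "b > 1"
  shows "((\<lambda>t. (w (b ^ k * t) - w t) / (w (b * t) - w t)) \<longlongrightarrow> real k) at_top"
proof (induction k)
  case (Suc k)
  define D where "D t = w (b * t) - w t" for t
  have "((\<lambda>t. D (b ^ k * t) / D t) \<longlongrightarrow> 1) at_top"
    using index_ratio[OF index_increment[OF assms], of "b ^ k"] b by (simp add: D_def)
  from tendsto_add[OF this Suc.IH]
  have "((\<lambda>t. D (b ^ k * t) / D t + (w (b ^ k * t) - w t) / (w (b * t) - w t)) \<longlongrightarrow> real (Suc k)) at_top"
    by (simp add: add.commute)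
  then show ?case
    by (simp add: D_def mult.assoc add_divide_distrib[symmetric])
qed simp

text \<open>With \<open>b = 2 powr (1 / m)\<close>, the limit for \<open>b ^ k\<close> is divided by
  the one for \<open>b ^ m = 2\<close>.\<close>

lemma increment_ratio_root:
  assumes w: "unb w" "index w 0" and m: "m > 0"
  shows "((\<lambda>t. (w (2 powr (real k / real m) * t) - w t) / (w (2 * t) - w t)) \<longlongrightarrow> real k / real m) at_top"
proof -
  define b :: real where "b = 2 powr (1 / m)"
  have b: "b > 1"
    using m by (simp add: b_def)
  have bk: "b ^ k = 2 powr (real k / real m)" for k
    using m by (simp add: b_def powr_powr flip: powr_realpow)
  have bm: "b ^ m = 2"
    using m by (simp add: bk)
  have "((\<lambda>t. ((w (b ^ k * t) - w t) / (w (b * t) - w t)) / ((w (b ^ m * t) - w t) / (w (b * t) - w t)))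
    \<longlongrightarrow> real k / real m) at_top"
    using m by (intro tendsto_divide increment_ratio_power[OF w b]) simp
  then show ?thesis
  proof (rule Lim_transform_eventually)
    show "eventually (\<lambda>t. ((w (b ^ k * t) - w t) / (w (b * t) - w t)) / ((w (b ^ m * t) - w t) / (w (b * t) - w t))
      = (w (2 powr (real k / real m) * t) - w t) / (w (2 * t) - w t)) at_top"
      using indexD(2)[OF index_increment[OF w b]] by eventually_elim (simp add: bm bk)
  qed
qed

text \<open>As \<open>w\<close> increases, the ratio is monotone in \<open>a\<close> and is squeezed
  between its values at rational powers of 2.\<close>

lemma increment_ratio_log:
  assumes w: "unb w" "index w 0" and a: "a > 1"
  shows "((\<lambda>t. (w (a * t) - w t) / (w (2 * t) - w t)) \<longlongrightarrow> log 2 a) at_top"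
proof (rule order_tendstoI)
  obtain T where T: "\<And>x y. T \<le> x \<Longrightarrow> x \<le> y \<Longrightarrow> w x \<le> w y"
    using unb_mono[OF w(1)] by metis
  have D2: "eventually (\<lambda>t. 0 < w (2 * t) - w t) at_top"
    using indexD(2)[OF index_increment[OF w, of 2]] by simp
  have mono: "eventually (\<lambda>t. (w (c * t) - w t) / (w (2 * t) - w t) \<le> (w (d * t) - w t) / (w (2 * t) - w t)) at_top"
    if "1 \<le> c" "c \<le> d" for c d
    using D2 eventually_ge_at_top[of T] eventually_pos
  proof eventually_elim
    case (elim t)
    have "t \<le> c * t" "c * t \<le> d * t"
      using elim that by (simp_all add: mult_le_cancel_right1 mult_right_mono)
    then have "w (c * t) \<le> w (d * t)"
      using elim(2) by (intro T) linarith+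
    then show ?case
      using elim by (intro divide_right_mono) auto
  qed
  have log_a: "0 < log 2 a"
    using a by simp
  have frac: "\<exists>k m :: nat. m > 0 \<and> r = real k / real m" if "r \<in> \<rat>" "r \<ge> 0" for r :: real
    using Rats_abs_nat_div_natE[OF that(1)] that(2) by (metis abs_of_nonneg neq0_conv)
  {
    fix l assume "l < log 2 a"
    then obtain r where r: "r \<in> \<rat>" "max l 0 < r" "r < log 2 a"
      using Rats_dense_in_real[of "max l 0" "log 2 a"] log_a by auto
    then obtain k m :: nat where km: "m > 0" "r = real k / real m"
      using frac[of r] by auto
    have "2 powr r \<le> 2 powr (log 2 a)"
      using r by (intro powr_mono) auto
    then have ra: "2 powr r \<le> a"
      using a by simp
    have "(1::real) \<le> 2 powr r"
      using r by (simp add: ge_one_powr_ge_zero)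
    from mono[OF this ra] order_tendstoD(1)[OF increment_ratio_root[OF w km(1), of k], of l]
    show "eventually (\<lambda>t. l < (w (a * t) - w t) / (w (2 * t) - w t)) at_top"
      using r by (auto simp: km(2) elim: eventually_elim2)
  next
    fix u assume "log 2 a < u"
    then obtain r where r: "r \<in> \<rat>" "log 2 a < r" "r < u"
      using Rats_dense_in_real[of "log 2 a" u] by auto
    then obtain k m :: nat where km: "m > 0" "r = real k / real m"
      using frac[of r] log_a by auto
    have "2 powr (log 2 a) \<le> 2 powr r"
      using r by (intro powr_mono) auto
    then have ra: "a \<le> 2 powr r"
      using a by simp
    have "1 \<le> a"
      using a by simp
    from mono[OF this ra] order_tendstoD(2)[OF increment_ratio_root[OF w km(1), of k], of u]
    show "eventually (\<lambda>t. (w (a * t) - w t) / (w (2 * t) - w t) < u) at_top"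
      using r by (auto simp: km(2) elim: eventually_elim2)
  }
qed

text \<open>Miller's dichotomy: a slowly varying definable function tending to infinity makes the
  logarithm definable, as the pointwise limit of \<open>(w(a t) - w(t)) / (w(2t) - w(t))\<close>.\<close>

lemma definable_exp_if_slow:
  assumes w: "unb w" "index w 0"
  shows "definable_fun R exp"
proof -
  define F where "F a t = (w (a * t) - w t) / (w (2 * t) - w t)" for a t
  have dF: "dterm R (\<lambda>v. F (v i) (v j))" for i j
    unfolding F_def by (intro dterm_intros dterm_fun[OF unbD(1)[OF w(1)]])
  define L where "L a y \<longleftrightarrow> ((\<lambda>t. F a t) \<longlongrightarrow> y) at_top" for a y
  have L: "L a y \<longleftrightarrow> y = log 2 a" if "a > 1" for a y
    using increment_ratio_log[OF w that] tendsto_unique[OF trivial_limit_at_top_linorder]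
    by (auto simp: L_def F_def)
  have dL: "dpred R (\<lambda>v. L (S v) (T v))" if "dterm R S" "dterm R T" for S T
    unfolding L_def by (rule dpred_tendsto[where F = F, OF dF that])
  \<comment> \<open>\<open>L\<close> is known to be the graph of \<open>log 2\<close> only above 1.
    Hence the cases \<open>y > 1\<close>, \<open>y = 1\<close> and \<open>0 < y < 1\<close>, the
    last through \<open>inverse y\<close>; dividing by \<open>ln 2\<close> changes the base.\<close>
  have "dpred R (\<lambda>v. 1 < v 1 \<and> L (v 1) (v 0 / ln 2) \<or> v 1 = 1 \<and> v 0 = 0
      \<or> 0 < v 1 \<and> v 1 < 1 \<and> L (inverse (v 1)) (- 1 * (v 0 / ln 2)))"
    by (intro dpred_intros dterm_intros dL)
  then have "dpred R (\<lambda>v. v 1 = exp (v 0))"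
  proof (rule dpred_cong)
    fix v :: "nat \<Rightarrow> real"
    have gt: "L y (x / ln 2) \<longleftrightarrow> y = exp x" if "y > 1" for x y
    proof -
      have "L y (x / ln 2) \<longleftrightarrow> x = ln y"
        using that by (simp add: L log_def)
      also have "\<dots> \<longleftrightarrow> y = exp x"
        using that by auto
      finally show ?thesis .
    qed
    consider "1 < v 1" | "v 1 = 1" | "0 < v 1" "v 1 < 1" | "v 1 \<le> 0"
      by linarith
    then show "v 1 = exp (v 0) \<longleftrightarrow> (1 < v 1 \<and> L (v 1) (v 0 / ln 2) \<or> v 1 = 1 \<and> v 0 = 0
      \<or> 0 < v 1 \<and> v 1 < 1 \<and> L (inverse (v 1)) (- 1 * (v 0 / ln 2)))"
    proof cases
      case 1
      then show ?thesis using gt[of "v 1" "v 0"] by auto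
    next
      case 2
      then show ?thesis by auto
    next
      case 3
      then have "L (inverse (v 1)) (- 1 * (v 0 / ln 2)) \<longleftrightarrow> inverse (v 1) = exp (- v 0)"
        using gt[of "inverse (v 1)" "- v 0"] by (simp add: one_less_inverse)
      also have "\<dots> \<longleftrightarrow> v 1 = exp (v 0)"
        by (simp add: exp_minus)
      finally show ?thesis
        using 3 by auto
    next
      case 4
      then have "v 1 \<noteq> exp (v 0)"
        using exp_gt_zero[of "v 0"] by linarith
      then show ?thesis
        using 4 by auto
    qed
  qed
  then show ?thesis
    by (simp add: definable_fun_iff)
qed

lemma pw_pw: "t > 0 \<Longrightarrow> pw p (pw q t) = pw (q * p) t"
  by (simp add: pw_def powr_powr)

lemma index_mult_zero: "index g r \<Longrightarrow> r \<in> \<rat> \<Longrightarrow> index (\<lambda>t. g t * pw (- r) t) 0"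
  using index_mult_pw[of g r "- r"] by simp

text \<open>The pointwise limit of \<open>g (a * t) / g t\<close> is \<open>a powr r\<close>, so
  even an irrational power is definable once its exponent occurs as an index. This supplies the
  approximants in \<open>scaling_square\<close>.\<close>

lemma definable_pw_index:
  assumes "index g r"
  shows "definable_fun R (pw r)"
proof -
  define F where "F a t = g (a * t) / g t" for a t
  have dF: "dterm R (\<lambda>v. F (v i) (v j))" for i j
    unfolding F_def by (intro dterm_intros dterm_fun[OF indexD(1)[OF assms]])
  define L where "L a y \<longleftrightarrow> ((\<lambda>t. F a t) \<longlongrightarrow> y) at_top" for a y
  have L: "L a y \<longleftrightarrow> y = a powr r" if "a > 0" for a y
    using index_ratio[OF assms that] tendsto_unique[OF trivial_limit_at_top_linorder]
    by (auto simp: L_def F_def)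
  have dL: "dpred R (\<lambda>v. L (S v) (T v))" if "dterm R S" "dterm R T" for S T
    unfolding L_def by (rule dpred_tendsto[where F = F, OF dF that])
  have "dpred R (\<lambda>v. 0 < v 0 \<and> L (v 0) (v 1) \<or> \<not> 0 < v 0 \<and> v 1 = 0)"
    by (intro dpred_intros dterm_intros dL)
  then have "dpred R (\<lambda>v. v 1 = pw r (v 0))"
    by (rule dpred_cong) (auto simp: L pw_def)
  then show ?thesis
    by (simp add: definable_fun_iff)
qed

lemma pow_pw:
  assumes "c \<in> \<rat>" "c > 0"
  shows "abs_germ (pw c) \<up> n = abs_germ (pw (c ^ n))"
proof (induction n)
  case 0
  have "eventually (\<lambda>t. t = pw 1 t) at_top"
    using eventually_pos by eventually_elim (simp add: pw_def)
  then show ?case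
    by (simp add: one_abs abs_germ_eq_iff unb_ident unb_pw)
next
  case (Suc n)
  have u: "unb (pw (c ^ n))" "unb (pw c)" "unb (pw (c ^ Suc n))"
    using assms by (auto intro!: unb_pw)
  have "eventually (\<lambda>t. pw (c ^ n) (pw c t) = pw (c ^ Suc n) t) at_top"
    using eventually_pos by eventually_elim (simp add: pw_pw)
  then show ?case
    using Suc u by (simp add: mult_abs abs_germ_eq_iff unb_comp)
qed

section \<open>Growth exponents and scaling elements when \<open>exp\<close> is not
  definable\<close>

context
  assumes not_exp: "\<not> definable_fun R exp"
begin

text \<open>If \<open>f\<close> exceeded all powers, its inverse would tend to infinity more slowly
  than every positive power, so it would have index 0 and make \<open>exp\<close> definable.\<close>

lemma polynomially_bounded:
  assumes f: "unb f"
  shows "\<exists>n. (0::nat) < n \<and> eventually (\<lambda>t. f t \<le> t powr n) at_top"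
proof (rule ccontr)
  assume contr: "\<not> ?thesis"
  have big: "eventually (\<lambda>t. t powr n \<le> f t) at_top" if "n > 0" for n :: nat
  proof -
    have "\<not> eventually (\<lambda>t. f t < pw n t) at_top"
    proof
      assume "eventually (\<lambda>t. f t < pw n t) at_top"
      then have "eventually (\<lambda>t. f t \<le> t powr n) at_top"
        using eventually_pos by eventually_elim (simp add: pw_def)
      then show False
        using contr that by blast
    qed
    then have "eventually (\<lambda>t. pw n t \<le> f t) at_top"
      using definable_less_or_ge[OF unbD(1)[OF f] definable_pw[of n]] by auto
    then show ?thesis
      using eventually_pos by eventually_elim (simp add: pw_def)
  qed
  obtain g where g: "unb g" "eventually (\<lambda>x. f (g x) = x) at_top"
    using unb_inverse[OF f] by blast
  have gpos: "eventually (\<lambda>t. 0 < g t) at_top"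
    by (rule unb_gt[OF g(1)])
  have "index g 0"
    unfolding index_def
  proof (intro conjI ballI impI gpos unbD(1)[OF g(1)])
    fix p :: real assume "p \<in> \<rat>" "p < 0"
    then show "unb (\<lambda>t. g t * pw (- p) t)"
      by (intro unb_mult g(1) unb_pw) auto
  next
    fix q :: real assume q: "q \<in> \<rat>" "0 < q"
    obtain n :: nat where n: "n > 0" "1 / real n < q"
      using reals_Archimedean[OF q(2)] by (metis inverse_eq_divide zero_less_Suc)
    show "unb (\<lambda>t. pw q t / g t)"
    proof (rule unb_ge[OF unb_pw[of "q - 1 / n"]])
      show "definable_fun R (\<lambda>t. pw q t / g t)"
        by (intro definable_divide definable_pw q unbD(1)[OF g(1)])
      show "eventually (\<lambda>t. pw (q - 1 / n) t \<le> pw q t / g t) at_top"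
        using unb_eventually[OF g(1) big[OF n(1)]] g(2) gpos eventually_pos
      proof eventually_elim
        case (elim t)
        have "g t = (g t powr n) powr (1 / n)"
          using n elim by (simp add: powr_powr)
        also have "\<dots> \<le> t powr (1 / n)"
          using elim n by (intro powr_mono2) auto
        finally have "t powr q / t powr (1 / n) \<le> t powr q / g t"
          using elim by (intro divide_left_mono) auto
        then show ?case
          using elim by (simp add: pw_def powr_diff)
      qed
    qed (use n q in auto)
  qed
  then show False
    using definable_exp_if_slow[OF g(1)] not_exp by blast
qed

text \<open>\<open>r\<close> is the supremum of the rational \<open>q\<close> with
  \<open>t powr q \<le> g t\<close> eventually. Polynomial bounds on \<open>g\<close> and
  \<open>inverse g\<close> make this set bounded above and non-empty.\<close>

lemma index_exists:
  assumes g: "definable_fun R g" "eventually (\<lambda>t. 0 < g t) at_top"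
  shows "\<exists>r. index g r"
proof -
  \<comment> \<open>Adding \<open>t\<close> produces functions that tend to infinity, to which
    \<open>polynomially_bounded\<close> applies.\<close>
  have "unb (\<lambda>t. g t + t)" "unb (\<lambda>t. inverse (g t) + t)"
    using g by (auto intro!: unb_ge[OF unb_ident] definable_add definable_inverse definable_ident
        elim!: eventually_mono)
  then obtain m n :: nat where "eventually (\<lambda>t. g t + t \<le> t powr m) at_top"
    "eventually (\<lambda>t. inverse (g t) + t \<le> t powr n) at_top"
    using polynomially_bounded by blast
  then have bounds: "eventually (\<lambda>t. g t \<le> t powr m \<and> t powr (- real n) \<le> g t) at_top"
    using g(2) eventually_pos
  proof eventually_elim
    case (elim t)
    then have "inverse (g t) \<le> t powr n"
      by linarith
    then have "inverse (t powr n) \<le> inverse (inverse (g t))"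
      using elim by (intro le_imp_inverse_le) auto
    then show ?case
      using elim by (simp add: powr_minus)
  qed
  define A where "A = {q\<in>\<rat>. eventually (\<lambda>t. t powr q \<le> g t) at_top}"
  have A_le: "p \<le> q" if "p \<in> A" "eventually (\<lambda>t. g t \<le> t powr q) at_top" for p q
  proof (rule ccontr)
    assume "\<not> p \<le> q"
    have "eventually (\<lambda>t. t powr p \<le> g t) at_top"
      using that by (simp add: A_def)
    with that(2) have "eventually (\<lambda>t :: real. False) at_top"
      using eventually_gt_at_top[of 1]
    proof eventually_elim
      case (elim t)
      have "t powr q < t powr p"
        using elim \<open>\<not> p \<le> q\<close> by (intro powr_less_mono) auto
      then show False
        using elim by linarith
    qed
    then show False by simp
  qed
  have "- real n \<in> A"
    using bounds by (auto simp: A_def elim: eventually_mono)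
  then have A_ne: "A \<noteq> {}" by blast
  have "eventually (\<lambda>t. g t \<le> t powr m) at_top"
    using bounds by (rule eventually_mono) simp
  then have A_bdd: "bdd_above A"
    using A_le by (auto simp: bdd_above_def)
  define r where "r = Sup A"
  have "index g r"
    unfolding index_def
  proof (intro conjI ballI impI g)
    fix p :: real assume p: "p \<in> \<rat>" "p < r"
    obtain q where q: "q \<in> A" "p < q"
      using less_cSupD[OF A_ne] p(2) unfolding r_def by blast
    show "unb (\<lambda>t. g t * pw (- p) t)"
    proof (rule unb_ge[OF unb_pw[of "q - p"]])
      show "definable_fun R (\<lambda>t. g t * pw (- p) t)"
        by (intro definable_mult g definable_pw) (use p in simp)
      have "eventually (\<lambda>t. t powr q \<le> g t) at_top"
        using q by (simp add: A_def)
      then show "eventually (\<lambda>t. pw (q - p) t \<le> g t * pw (- p) t) at_top"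
        using eventually_pos
        by eventually_elim (simp add: pw_def powr_diff powr_minus divide_simps)
    qed (use p q in \<open>auto simp: A_def\<close>)
  next
    fix q :: real assume q: "q \<in> \<rat>" "r < q"
    \<comment> \<open>An exponent in between leaves room: \<open>g t < t powr p\<close> eventually,
      so \<open>t powr q / g t\<close> dominates \<open>t powr (q - p)\<close>.\<close>
    obtain p where p: "p \<in> \<rat>" "r < p" "p < q"
      using Rats_dense_in_real[OF q(2)] by blast
    have "p \<notin> A"
      using cSup_upper[OF _ A_bdd, of p] p by (auto simp: r_def)
    moreover have "p \<in> A" if "eventually (\<lambda>t. pw p t \<le> g t) at_top"
    proof -
      have "eventually (\<lambda>t. t powr p \<le> g t) at_top"
        using that eventually_pos by eventually_elim (simp add: pw_def)
      then show ?thesis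
        using p by (simp add: A_def)
    qed
    ultimately have less: "eventually (\<lambda>t. g t < pw p t) at_top"
      using definable_less_or_ge[OF g(1) definable_pw[OF p(1)]] by blast
    show "unb (\<lambda>t. pw q t / g t)"
    proof (rule unb_ge[OF unb_pw[of "q - p"]])
      show "definable_fun R (\<lambda>t. pw q t / g t)"
        by (intro definable_divide g definable_pw q)
      show "eventually (\<lambda>t. pw (q - p) t \<le> pw q t / g t) at_top"
        using eventually_pos less g(2)
      proof eventually_elim
        case (elim t)
        then have "t powr q / t powr p \<le> t powr q / g t"
          by (intro divide_left_mono) (auto simp: pw_def)
        then show ?case
          using elim by (simp add: pw_def powr_diff)
      qed
    qed (use p q in auto)
  qed
  then show ?thesis ..
qed

text \<open>If no bound held, \<open>g\<close> would tend to infinity and, having index 0, make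
  \<open>exp\<close> definable.\<close>

lemma index_zero_bounded:
  assumes g: "index g 0"
  shows "\<exists>C>0. eventually (\<lambda>t. g t < C) at_top"
  using unbI_not_bounded[OF indexD(1)[OF g]] definable_exp_if_slow[OF _ g] not_exp by blast

lemma index_zero_bounded_below:
  assumes g: "index g 0"
  shows "\<exists>C>0. eventually (\<lambda>t. C < g t) at_top"
proof -
  have "index (\<lambda>t. inverse (g t)) 0"
    unfolding index_def
  proof (intro conjI ballI impI)
    show "definable_fun R (\<lambda>t. inverse (g t))"
      by (intro definable_inverse indexD(1)[OF g])
    show "eventually (\<lambda>t. 0 < inverse (g t)) at_top"
      using indexD(2)[OF g] by eventually_elim simp
    fix p :: real assume p: "p \<in> \<rat>"
    show "unb (\<lambda>t. inverse (g t) * pw (- p) t)" if "p < 0"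
      using indexD(4)[OF g, of "- p"] p that by (simp add: divide_inverse mult.commute)
    show "unb (\<lambda>t. pw p t / inverse (g t))" if "0 < p"
      using indexD(3)[OF g, of "- p"] p that by (simp add: divide_inverse mult.commute)
  qed
  from index_zero_bounded[OF this] obtain C where C: "C > 0" "eventually (\<lambda>t. inverse (g t) < C) at_top"
    by blast
  have "eventually (\<lambda>t. inverse C < g t) at_top"
    using C(2) indexD(2)[OF g]
  proof eventually_elim
    case (elim t)
    then show ?case
      using C(1) less_imp_inverse_less[of "inverse (g t)" C] by simp
  qed
  then show ?thesis
    using C(1) by (intro exI[of _ "inverse C"]) simp
qed

text \<open>A germ \<open>h\<close> of index \<open>r\<close> is approximated by
  \<open>pw r\<close>, which commutes with \<open>pw 2\<close>. Since \<open>h\<close> grows like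
  \<open>t\<close> to the power \<open>r + o(1)\<close>, \<open>pw r\<close> composed with the
  inverse of \<open>h\<close> lies between \<open>pw (1 / c)\<close> and \<open>pw c\<close> for
  every rational \<open>c > 1\<close>.\<close>

lemma scaling_square: "G.scaling (abs_germ (pw 2))"
proof (rule G.scalingI)
  have u2: "unb (pw 2)"
    by (rule unb_pw) auto
  show "abs_germ (pw 2) \<in> G.positive"
  proof -
    have "eventually (\<lambda>t. t < pw 2 t) at_top"
      using eventually_gt_at_top[of 1] by eventually_elim (auto simp: pw_def power2_eq_square)
    then show ?thesis
      by (simp add: positive_abs u2)
  qed
  fix F assume "F \<in> carrier GR"
  then obtain h where h: "unb h" and F: "F = abs_germ h"
    by (auto simp: carrier_iff)
  obtain r where r: "index h r"
    using index_exists[OF unbD(1)[OF h] unb_gt[OF h]] by blast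
  obtain k where k: "unb k" "eventually (\<lambda>x. k (h x) = x) at_top" "eventually (\<lambda>x. h (k x) = x) at_top"
    using unb_inverse[OF h] by blast
  \<comment> \<open>The inverse \<open>k\<close> is bounded by some \<open>t powr n\<close>, whereas
    \<open>r \<le> 0\<close> would give \<open>h t \<le> t powr (1 / (2 * n))\<close>; together
    \<open>t = k (h t) \<le> t powr (1 / 2)\<close>.\<close>
  have r0: "r > 0"
  proof (rule ccontr)
    assume "\<not> r > 0"
    obtain n :: nat where n: "n > 0" "eventually (\<lambda>t. k t \<le> t powr n) at_top"
      using polynomially_bounded[OF k(1)] by blast
    have "0 < 1 / (2 * real n)"
      using n by simp
    then have "r < 1 / (2 * real n)"
      using \<open>\<not> r > 0\<close> by linarith
    then have "eventually (\<lambda>t. 1 * h t \<le> t powr (1 / (2 * real n))) at_top"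
      by (intro index_upper[OF r]) simp_all
    with unb_eventually[OF h n(2)] k(2) indexD(2)[OF r] eventually_gt_at_top[of 1]
    have "eventually (\<lambda>t :: real. False) at_top"
    proof eventually_elim
      case (elim t)
      have "t \<le> h t powr n"
        using elim by simp
      also have "\<dots> \<le> (t powr (1 / (2 * real n))) powr n"
        using elim by (intro powr_mono2) auto
      also have "\<dots> = t powr (1 / 2)"
        using n by (simp add: powr_powr)
      also have "\<dots> < t powr 1"
        using elim by (intro powr_less_mono) auto
      finally show False
        using elim by simp
    qed
    then show False by simp
  qed
  have ur: "unb (pw r)"
    by (rule unb_pwI[OF definable_pw_index[OF r] r0])
  define x where "x t = pw r (k t)" for t
  have ux: "unb x"
    unfolding x_def[abs_def] by (rule unb_comp[OF ur k(1)])
  have prod: "abs_germ (pw r) \<odot> ginv F = abs_germ x"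
    by (simp add: F inv_abs[OF h k(1,2)] mult_abs ur k(1) x_def[abs_def])
  have kpos: "eventually (\<lambda>t. 0 < k t) at_top"
    by (rule unb_gt[OF k(1)])
  have small: "germ_less (X \<up> n) (abs_germ (pw 2))"
    if X: "X = abs_germ x \<or> X = ginv abs_germ x" for X and n :: nat
  proof -
    \<comment> \<open>The \<open>n\<close>-fold iterate of \<open>pw c\<close> is
      \<open>pw (c ^ n)\<close>, so \<open>c ^ n < 2\<close> keeps it below
      \<open>pw 2\<close>.\<close>
    have "isCont (\<lambda>c :: real. c ^ n) 1"
      by (intro continuous_intros)
    then obtain c :: real where c: "c \<in> \<rat>" "1 < c" "c ^ n < 2"
      using Rats_dense_left_right(4)[of 1 "\<lambda>c. c ^ n" 2] by auto
    have uc: "unb (pw c)" "unb (pw (1 / c))"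
      using c by (auto intro!: unb_pw)
    have "r / c < r"
      using r0 c by (simp add: divide_less_eq)
    then obtain p where p: "p \<in> \<rat>" "r / c < p" "p < r"
      using Rats_dense_in_real by blast
    have "0 < r / c"
      using r0 c by simp
    then have "p > 0"
      using p by linarith
    then have p0: "p > 0" "r / p \<le> c"
      using c p by (auto simp: field_simps)
    have "r < r * c"
      using r0 c by simp
    then obtain q where q: "q \<in> \<rat>" "r < q" "q < r * c"
      using Rats_dense_in_real by blast
    have q0: "q > 0" "1 / c \<le> r / q"
      using r0 c q by (auto simp: field_simps)
    have "eventually (\<lambda>t. x t \<le> pw c t) at_top"
      using unb_eventually[OF k(1) index_lower[OF r p(1,3), of 1]] k(3) kpos eventually_gt_at_top[of 1]
    proof eventually_elim
      case (elim t)
      have "x t = (k t powr p) powr (r / p)"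
        using elim p0 by (simp add: x_def pw_def powr_powr)
      also have "\<dots> \<le> t powr (r / p)"
        using elim r0 p0 by (intro powr_mono2) auto
      also have "\<dots> \<le> t powr c"
        using elim p0 by (intro powr_mono) auto
      finally show ?case
        using elim by (simp add: pw_def)
    qed
    then have xc: "G.le (abs_germ x) (abs_germ (pw c))"
      by (rule germ_le_abs[OF ux uc(1)])
    have "eventually (\<lambda>t. pw (1 / c) t \<le> x t) at_top"
      using unb_eventually[OF k(1) index_upper[OF r q(1,2), of 1]] k(3) kpos eventually_gt_at_top[of 1]
    proof eventually_elim
      case (elim t)
      have "t powr (1 / c) \<le> t powr (r / q)"
        using elim q0 by (intro powr_mono) auto
      also have "\<dots> \<le> (k t powr q) powr (r / q)"
        using elim r0 q0 by (intro powr_mono2) auto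
      also have "\<dots> = x t"
        using elim q0 by (simp add: x_def pw_def powr_powr)
      finally show ?case
        using elim by (simp add: pw_def)
    qed
    then have "G.le (abs_germ (pw (1 / c))) (abs_germ x)"
      by (rule germ_le_abs[OF uc(2) ux])
    moreover have "ginv abs_germ (pw c) = abs_germ (pw (1 / c))"
    proof (rule inv_abs[OF uc])
      show "eventually (\<lambda>t. pw (1 / c) (pw c t) = t) at_top"
        using eventually_pos by eventually_elim (use c in \<open>auto simp: pw_def powr_powr\<close>)
    qed
    ultimately have "G.le (ginv abs_germ x) (abs_germ (pw c))"
      using G.inv_le_swap[of "abs_germ (pw c)" "abs_germ x"] ux uc abs_in_carrier by simp
    with xc X have Xc: "G.le X (abs_germ (pw c))"
      by blast
    have XG: "X \<in> carrier GR"
      using X ux abs_in_carrier by auto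
    have "G.le (X \<up> n) (abs_germ (pw c) \<up> n)"
      by (rule G.nat_pow_mono[OF XG _ Xc]) (simp add: abs_in_carrier uc)
    moreover have "germ_less (abs_germ (pw c) \<up> n) (abs_germ (pw 2))"
    proof -
      have "eventually (\<lambda>t. pw (c ^ n) t < pw 2 t) at_top"
        using eventually_gt_at_top[of 1]
      proof eventually_elim
        case (elim t)
        have "t powr (c ^ n) < t powr 2"
          using elim c by (intro powr_less_mono) auto
        then show ?case
          using elim by (simp add: pw_def)
      qed
      moreover have "unb (pw (c ^ n))"
        using c by (intro unb_pw) auto
      ultimately show ?thesis
        using c u2 by (simp add: pow_pw germ_less_abs)
    qed
    ultimately show ?thesis
      using G.le_lt_trans[of "X \<up> n" "abs_germ (pw c) \<up> n" "abs_germ (pw 2)"]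
        XG uc u2 abs_in_carrier by simp
  qed
  show "\<exists>g\<in>centraliser GR (abs_germ (pw 2)). \<forall>n::nat.
      germ_less ((g \<odot> ginv F) \<up> n) (abs_germ (pw 2)) \<and>
      germ_less (ginv (g \<odot> ginv F) \<up> n) (abs_germ (pw 2))"
  proof (intro bexI[of _ "abs_germ (pw r)"] allI conjI)
    have "eventually (\<lambda>t. pw r (pw 2 t) = pw 2 (pw r t)) at_top"
      using eventually_pos by eventually_elim (simp add: pw_pw mult.commute)
    then show "abs_germ (pw r) \<in> centraliser GR (abs_germ (pw 2))"
      using ur u2 by (simp add: G.in_centraliser_iff abs_in_carrier mult_abs abs_germ_eq_iff unb_comp)
  qed (simp_all only: prod small simp_thms)
qed

lemma exists_scaling_if_not_exp:
  assumes f: "unb f" and gt: "eventually (\<lambda>t. t < f t) at_top"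
  shows "\<exists>s. G.scaling s \<and> G.asymp_eq s (abs_germ f)"
proof -
  define \<epsilon> where "\<epsilon> t = f t - t" for t
  have F: "abs_germ f \<in> G.positive"
    using f gt by (simp add: positive_abs)
  have "definable_fun R \<epsilon>" "eventually (\<lambda>t. 0 < \<epsilon> t) at_top"
    unfolding \<epsilon>_def[abs_def] using gt
    by (auto intro!: definable_diff definable_ident unbD(1)[OF f])
  from index_exists[OF this] obtain r where r: "index \<epsilon> r" by blast
  consider "r > 1" | "r = 1" | "r < 1"
    by linarith
  then show ?thesis
  proof cases
    case 1
    then obtain p where p: "p \<in> \<rat>" "1 < p" "p < r"
      using Rats_dense_in_real by blast
    \<comment> \<open>As \<open>f\<close> dominates \<open>pw p\<close>, its \<open>m\<close>-th
      iterate dominates \<open>pw (p ^ m)\<close> and hence \<open>pw 2\<close>.\<close>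
    obtain m where m: "2 < p ^ m"
      using real_arch_pow[OF p(2)] by blast
    have up: "unb (pw p)" "unb (pw (p ^ m))" "unb (pw 2)"
      using p by (auto intro!: unb_pw)
    have "eventually (\<lambda>t. pw p t \<le> f t) at_top"
      using index_lower[OF r p(1,3), of 1] eventually_pos
      by eventually_elim (simp add: \<epsilon>_def pw_def)
    from germ_le_abs[OF up(1) f this]
    have "G.le (abs_germ (pw (p ^ m))) (abs_germ f \<up> m)"
      using G.nat_pow_mono[of "abs_germ (pw p)" "abs_germ f" m] p up f by (simp add: pow_pw abs_in_carrier)
    moreover have "eventually (\<lambda>t. pw 2 t \<le> pw (p ^ m) t) at_top"
      using eventually_gt_at_top[of 1]
    proof eventually_elim
      case (elim t)
      have "t powr 2 \<le> t powr (p ^ m)"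
        using elim m by (intro powr_mono) auto
      then show ?case
        using elim by (simp add: pw_def)
    qed
    from germ_le_abs[OF up(3,2) this]
    have "G.le (abs_germ (pw 2)) (abs_germ (pw (p ^ m)))" .
    ultimately have le1: "G.le (abs_germ (pw 2)) (abs_germ f \<up> m)"
      using G.le_trans[of "abs_germ (pw 2)" "abs_germ (pw (p ^ m))" "abs_germ f \<up> m"] up f
      by (simp add: abs_in_carrier)
    obtain n where n: "0 < n" "eventually (\<lambda>t. f t \<le> t powr real n) at_top"
      using polynomially_bounded[OF f] by blast
    have "eventually (\<lambda>t. f t \<le> pw (2 ^ n) t) at_top"
      using n(2) eventually_gt_at_top[of 1]
    proof eventually_elim
      case (elim t)
      have "real n \<le> 2 ^ n"
        using of_nat_mono[OF less_imp_le[OF less_exp[of n]], where ?'a = real] by simp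
      then have "t powr n \<le> t powr (2 ^ n)"
        using elim by (intro powr_mono) auto
      then have "f t \<le> t powr (2 ^ n)"
        using elim by linarith
      then show ?case
        using elim by (simp add: pw_def)
    qed
    from germ_le_abs[OF f _ this]
    have le2: "G.le (abs_germ f) (abs_germ (pw 2) \<up> n)"
      by (simp add: pow_pw unb_pw)
    have "abs_germ (pw 2) \<in> G.positive"
      using scaling_square by (simp add: G.scaling_def)
    from G.asymp_eqI[OF this F le1 le2] show ?thesis
      using scaling_square by blast
  next
    case 2
    have "index (\<lambda>t. \<epsilon> t * pw (- 1) t) 0"
      using index_mult_zero[OF r] 2 by simp
    from index_zero_bounded[OF this] index_zero_bounded_below[OF this]
    obtain b a where ab: "b > 0" "eventually (\<lambda>t. \<epsilon> t * pw (- 1) t < b) at_top"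
      "a > 0" "eventually (\<lambda>t. a < \<epsilon> t * pw (- 1) t) at_top"
      by blast
    have "eventually (\<lambda>t. (1 + a) * t \<le> f t \<and> f t \<le> (1 + b) * t) at_top"
      using ab(2,4) eventually_pos
    proof eventually_elim
      case (elim t)
      then have eq: "\<epsilon> t * pw (- 1) t = \<epsilon> t / t"
        by (simp add: pw_def powr_minus divide_inverse)
      have "a < \<epsilon> t / t" "\<epsilon> t / t < b"
        using elim unfolding eq by simp_all
      then have "a * t < \<epsilon> t" "\<epsilon> t < b * t"
        using elim by (simp_all add: field_simps)
      then show ?case
        by (simp add: \<epsilon>_def algebra_simps)
    qed
    then have "eventually (\<lambda>t. (1 + a) * t \<le> f t) at_top" "eventually (\<lambda>t. f t \<le> (1 + b) * t) at_top"
      by (auto elim: eventually_mono)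
    then have "G.flowable (abs_germ f)"
      using flowable_if_near_dilation[OF f, of "1 + a" "1 + b"] ab by simp
    then show ?thesis
      by (rule G.flowable_imp_scaling[OF F])
  next
    case 3
    \<comment> \<open>In the coordinate \<open>t ^ n\<close> the displacement becomes roughly
      \<open>\<epsilon> (t ^ n) / (n * t ^ (n - 1))\<close>. With \<open>1 / n < 1 - r\<close>,
      \<open>\<epsilon> s\<close> is of lower order than \<open>s powr (1 - 1 / n)\<close>, so this
      tends to 0.\<close>
    then obtain n' where n': "inverse (real (Suc n')) < 1 - r"
      using reals_Archimedean[of "1 - r"] by auto
    define n where "n = Suc n'"
    have n: "n > 0" "r < 1 - 1 / real n"
      using n' by (simp_all add: n_def inverse_eq_divide)
    have u: "unb (pw (1 / n))" "unb (pw n)"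
      using n by (auto intro!: unb_pw)
    define g where "g t = pw (1 / n) (f (pw n t))" for t
    have g: "unb g"
      unfolding g_def[abs_def] by (intro unb_comp[OF u(1)] unb_comp[OF f] u(2))
    have g_gt: "eventually (\<lambda>t. t < g t) at_top"
      using unb_eventually[OF u(2) gt] eventually_pos
    proof eventually_elim
      case (elim t)
      have "t = (t powr n) powr (1 / n)"
        using elim n by (simp add: powr_powr)
      also have "\<dots> < f (t powr n) powr (1 / n)"
        using elim n by (intro powr_less_mono2) (auto simp: pw_def)
      also have "\<dots> = g t"
        using elim n by (auto simp: g_def pw_def intro: less_trans[of 0 "t powr n"])
      finally show ?case .
    qed
    have g_le: "eventually (\<lambda>t. g t \<le> t + d) at_top" if d: "d > 0" for d
    proof -
      have "eventually (\<lambda>t. inverse d * \<epsilon> t \<le> t powr (1 - 1 / n)) at_top"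
        using n by (intro index_upper[OF r]) auto
      from unb_eventually[OF u(2) this] show ?thesis
        using g_gt eventually_pos
      proof eventually_elim
        case (elim t)
        have t: "pw n t = t ^ n" "t ^ n > 0"
          using elim by (simp_all add: pw_def powr_realpow)
        have "(t ^ n) powr (1 - 1 / n) = t ^ n / t"
          using elim n by (simp add: powr_diff powr_powr flip: powr_realpow)
        then have "inverse d * \<epsilon> (t ^ n) \<le> t ^ n / t"
          using elim(1) unfolding t by simp
        then have "f (t ^ n) \<le> t ^ n * (1 + d / t)"
          using d elim by (simp add: \<epsilon>_def field_simps)
        also have "\<dots> \<le> t ^ n * (1 + real n * (d / t))"
        proof -
          have "1 * (d / t) \<le> real n * (d / t)"
            using d elim n by (intro mult_right_mono) auto
          then show ?thesis
            using t by (intro mult_left_mono) auto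
        qed
        \<comment> \<open>Bernoulli's inequality replaces the derivative of the root and yields
          \<open>f (t ^ n) \<le> (t + d) ^ n\<close>.\<close>
        also have "\<dots> \<le> t ^ n * (1 + d / t) ^ n"
        proof (intro mult_left_mono Bernoulli_inequality)
          have "0 \<le> d / t"
            using d elim by simp
          then show "-1 \<le> d / t"
            by linarith
        qed (use t in simp)
        also have "\<dots> = (t + d) ^ n"
          using elim by (simp add: power_mult_distrib[symmetric] field_simps)
        finally have le: "f (t ^ n) \<le> (t + d) ^ n" .
        have gt: "g t = pw (1 / n) (f (t ^ n))"
          by (simp only: g_def t(1))
        show ?case
        proof (cases "f (t ^ n) > 0")
          case True
          then have "g t = f (t ^ n) powr (1 / n)"
            by (simp add: gt pw_def)
          also have "\<dots> \<le> ((t + d) ^ n) powr (1 / n)"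
            using le True n by (intro powr_mono2) auto
          also have "\<dots> = t + d"
            using d elim n by (simp add: powr_powr flip: powr_realpow)
          finally show ?thesis .
        next
          case False
          then show ?thesis
            using d elim by (simp add: gt pw_def)
        qed
      qed
    qed
    have "((\<lambda>t. g t - t) \<longlongrightarrow> 0) at_top"
    proof (rule order_tendstoI)
      fix l :: real assume "l < 0"
      then show "eventually (\<lambda>t. l < g t - t) at_top"
        using g_gt by (auto elim: eventually_mono)
    next
      fix c :: real assume "0 < c"
      then have "eventually (\<lambda>t. g t \<le> t + c / 2) at_top"
        by (intro g_le) simp
      then show "eventually (\<lambda>t. g t - t < c) at_top"
        by eventually_elim (use \<open>0 < c\<close> in linarith)
    qed
    from flowable_if_small_displacement[OF g g_gt this]
    have fl: "G.flowable (abs_germ g)" .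
    have inv: "eventually (\<lambda>t. pw n (pw (1 / n) t) = t) at_top"
      using eventually_pos by eventually_elim (use n in \<open>auto simp: pw_def powr_powr\<close>)
    have "G.flowable (abs_germ f)"
      using flowable_conj_abs[OF f u inv] fl unfolding g_def[abs_def] by blast
    then show ?thesis
      by (rule G.flowable_imp_scaling[OF F])
  qed
qed

end

section \<open>Levels and scaling elements when \<open>exp\<close> is definable\<close>

definition lg :: "real \<Rightarrow> real" where
  "lg x = (if 0 < x then ln x else 0)"

abbreviation ge :: germ where
  "ge \<equiv> abs_germ exp"

definition shift :: "real \<Rightarrow> germ" where
  "shift c = abs_germ (\<lambda>t. t + c)"

text \<open>With \<open>j = k - l\<close>, this is the relation that levelledness imposes on a germ of level \<open>l\<close>.\<close>

definition between_shifts :: "germ \<Rightarrow> nat \<Rightarrow> nat \<Rightarrow> bool" where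
  "between_shifts F k j \<longleftrightarrow>
     (G.le F (ge \<up> k \<odot> shift 1 \<odot> ginv (ge \<up> j))) \<and>
     (G.le (ge \<up> k \<odot> shift (-1) \<odot> ginv (ge \<up> j)) F)"

context
  assumes exp: "definable_fun R exp"
begin

lemma unb_exp: "unb exp"
  using exp exp_at_top by (simp add: unb_def)

lemma eventually_lg: "eventually (\<lambda>t. lg t = ln t) at_top"
  using eventually_pos by eventually_elim (simp add: lg_def)

lemma unb_lg: "unb lg"
  unfolding unb_def
proof
  have "dpred R (\<lambda>v. 0 < v 0 \<and> exp (v 1) = v 0 \<or> \<not> 0 < v 0 \<and> v 1 = 0)"
    by (intro dpred_intros dterm_intros dterm_fun[OF exp])
  then have "dpred R (\<lambda>v. v 1 = lg (v 0))"
    by (rule dpred_cong) (auto simp: lg_def dest: ln_unique)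
  then show "definable_fun R lg"
    by (simp add: definable_fun_iff)
  show "filterlim lg at_top at_top"
    using filterlim_cong[OF refl refl eventually_lg] ln_at_top by simp
qed

lemma lg_exp: "lg (exp x) = x"
  by (simp add: lg_def)

lemma eventually_funpow_lg: "eventually (\<lambda>t. (lg ^^ k) t = (ln ^^ k) t) at_top"
proof (induction k)
  case (Suc k)
  from Suc unb_eventually[OF unb_funpow[OF unb_lg, of k] eventually_lg] show ?case
    by eventually_elim simp
qed simp

lemma ge_carrier [simp]: "ge \<in> carrier GR"
  by (rule abs_in_carrier[OF unb_exp])

lemma shift_carrier [simp]: "shift c \<in> carrier GR"
  unfolding shift_def by (rule abs_in_carrier[OF unb_shift])

lemma shift_mult: "shift a \<odot> shift b = shift (a + b)"
  by (simp add: shift_def mult_abs unb_shift algebra_simps)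

lemma shift_zero: "shift 0 = gid"
  by (simp add: shift_def one_abs)

lemma inv_shift: "ginv shift a = shift (- a)"
  using shift_mult[of "- a" a] shift_zero by (intro G.inv_equality) simp_all

lemma pow_shift: "shift a \<up> n = shift (real n * a)"
  by (induction n) (simp_all add: shift_zero[symmetric] shift_mult algebra_simps)

lemma inv_ge: "ginv ge = abs_germ lg"
  by (rule inv_abs[OF unb_exp unb_lg]) (simp add: lg_exp)

lemma shift_less_ge: "germ_less (shift c) ge"
proof -
  have "eventually (\<lambda>t. t + c < exp t) at_top"
    using eventually_ge_at_top[of "2 * \<bar>c\<bar>"] eventually_ge_at_top[of 1]
  proof eventually_elim
    case (elim t)
    have "2 * \<bar>c\<bar> * 1 \<le> t * t"
      using elim by (intro mult_mono) auto
    moreover have "1 + t + t\<^sup>2 / 2 \<le> exp t"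
      using elim by (intro exp_lower_Taylor_quadratic) auto
    ultimately show ?case
      by (simp add: power2_eq_square abs_le_iff)
  qed
  then show ?thesis
    by (simp add: shift_def germ_less_abs unb_shift unb_exp)
qed

lemma between_shifts_exists:
  assumes lev: "levelled R" and f: "unb f" and gt: "eventually (\<lambda>t. t < f t) at_top"
  shows "\<exists>k l. l \<le> k \<and> between_shifts (abs_germ f) k (k - l)"
proof -
  obtain l :: nat where "eventually (\<lambda>k. eventually (\<lambda>t.
      - 1 \<le> iter_log (int k) (f t) - iter_log (int k - int l) t \<and>
      iter_log (int k) (f t) - iter_log (int k - int l) t \<le> 1) at_top) sequentially"
    using lev f gt unfolding levelled_def unb_def by blast
  then obtain K where K: "\<And>k. k \<ge> K \<Longrightarrow> eventually (\<lambda>t.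
      - 1 \<le> iter_log (int k) (f t) - iter_log (int k - int l) t \<and>
      iter_log (int k) (f t) - iter_log (int k - int l) t \<le> 1) at_top"
    unfolding eventually_sequentially by blast
  \<comment> \<open>\<open>k \<ge> l\<close> makes \<open>k - l\<close> a genuine number of
    logarithms, so that \<open>iter_log\<close> does not switch to iterates of
    \<open>exp\<close>.\<close>
  define k where "k = max K l"
  define j where "j = k - l"
  have k: "k \<ge> K" "l \<le> k"
    by (auto simp: k_def)
  have il: "iter_log (int k) = ln ^^ k" "iter_log (int k - int l) = ln ^^ j"
    using k(2) by (auto simp: iter_log_def j_def simp flip: of_nat_diff)
  have u: "unb (lg ^^ k)" "unb (lg ^^ j)"
    by (simp_all add: unb_funpow unb_lg)
  have bound: "eventually (\<lambda>t. (lg ^^ j) t + - 1 \<le> (lg ^^ k) (f t) \<and> (lg ^^ k) (f t) \<le> (lg ^^ j) t + 1) at_top"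
    using K[OF k(1)] unb_eventually[OF f eventually_funpow_lg[of k]] eventually_funpow_lg[of j]
    unfolding il by eventually_elim simp
  define F where "F = abs_germ f"
  define a where "a = ge \<up> k"
  define b where "b = ginv (ge \<up> j)"
  have G: "F \<in> carrier GR" "a \<in> carrier GR" "b \<in> carrier GR"
    using f by (simp_all add: F_def a_def b_def abs_in_carrier)
  have lgk: "abs_germ (lg ^^ i) = ginv (ge \<up> i)" for i
    by (simp add: pow_abs[OF unb_lg, symmetric] inv_ge[symmetric] G.nat_pow_inv)
  have "abs_germ (\<lambda>t. (lg ^^ k) (f t)) = ginv a \<odot> F"
    "abs_germ (\<lambda>t. (lg ^^ j) t + c) = shift c \<odot> b" for c
    using f u by (simp_all add: F_def a_def b_def lgk[symmetric] shift_def mult_abs unb_shift)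
  note eqs = this
  have bounds: "eventually (\<lambda>t. (lg ^^ j) t + - 1 \<le> (lg ^^ k) (f t)) at_top"
    "eventually (\<lambda>t. (lg ^^ k) (f t) \<le> (lg ^^ j) t + 1) at_top"
    using bound by (auto elim: eventually_mono)
  have ul: "unb (\<lambda>t. (lg ^^ k) (f t))" "unb (\<lambda>t. (lg ^^ j) t + c)" for c
    using unb_comp[OF u(1) f] unb_comp[OF unb_shift u(2)] by blast+
  have cancel: "a \<odot> (ginv a \<odot> F) = F"
    using G by (simp add: G.m_assoc[symmetric])
  have "G.le (shift (- 1) \<odot> b) (ginv a \<odot> F)"
    using germ_le_abs[OF ul(2,1) bounds(1)] unfolding eqs .
  then have 1: "G.le (a \<odot> (shift (- 1) \<odot> b)) F"
    using G.le_mult_mono[of a a "shift (- 1) \<odot> b" "ginv a \<odot> F"] G cancel by simp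
  have "G.le (ginv a \<odot> F) (shift 1 \<odot> b)"
    using germ_le_abs[OF ul(1,2) bounds(2)] unfolding eqs .
  then have 2: "G.le F (a \<odot> (shift 1 \<odot> b))"
    using G.le_mult_mono[of a a "ginv a \<odot> F" "shift 1 \<odot> b"] G cancel by simp
  have "between_shifts F k j"
    unfolding between_shifts_def a_def[symmetric] b_def[symmetric]
    using 1 2 G by (simp add: G.m_assoc)
  then show ?thesis
    using k(2) unfolding F_def j_def by blast
qed

lemma conj_pow:
  assumes "a \<in> carrier GR" "x \<in> carrier GR"
  shows "(a \<odot> x \<odot> ginv a) \<up> n = a \<odot> x \<up> n \<odot> ginv a"
proof (induction n)
  case (Suc n)
  have "ginv a \<odot> (a \<odot> y) = y" if "y \<in> carrier GR" for y
    using assms that by (simp add: G.m_assoc[symmetric])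
  then show ?case
    using Suc assms by (simp add: G.m_assoc)
qed (use assms in simp)

text \<open>The \<open>n\<close>-th power is bounded by the conjugate of \<open>shift n\<close> by
  \<open>e\<close>. As \<open>shift n\<close> lies below \<open>ge\<close>, and \<open>e\<close>, a
  power of \<open>ge\<close>, commutes with \<open>ge\<close>, that conjugate lies below
  \<open>ge\<close> too.\<close>

lemma conj_shift_pow_less_ge:
  assumes X: "X \<in> carrier GR" and e: "e = ge \<up> j"
    and le: "G.le X (e \<odot> shift 1 \<odot> ginv e)"
  shows "germ_less (X \<up> n) ge"
proof -
  have eG: "e \<in> carrier GR"
    by (simp add: e)
  have comm: "e \<odot> ge = ge \<odot> e"
    unfolding e by (rule G.nat_pow_comm[of ge j 1, simplified])
  have "e \<odot> shift n \<odot> ginv e = (e \<odot> shift 1 \<odot> ginv e) \<up> n"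
    using eG by (simp add: conj_pow pow_shift)
  then have 1: "G.le (X \<up> n) (e \<odot> shift n \<odot> ginv e)"
    using G.nat_pow_mono[OF X _ le, of n] eG by simp
  have "germ_less (e \<odot> shift n) (ge \<odot> e)"
    unfolding comm[symmetric] by (rule G.lt_mult_left[OF eG _ _ shift_less_ge]) simp_all
  then have "germ_less (e \<odot> shift n \<odot> ginv e) ge"
    using eG by (subst G.lt_mult_inv_iff) simp_all
  with 1 show ?thesis
    using G.le_lt_trans[of "X \<up> n" "e \<odot> shift n \<odot> ginv e" ge] X eG by simp
qed

end

lemma germ_leD:
  assumes "unb f" "unb g" "G.le (abs_germ f) (abs_germ g)"
  shows "eventually (\<lambda>t. f t \<le> g t) at_top"
  using assms by (auto simp: germ_less_abs abs_germ_eq_iff elim: eventually_mono)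

context
  assumes exp: "definable_fun R exp" and lev: "levelled R"
begin

lemma ge_carrier' [simp]: "ge \<in> carrier GR"
  by (rule ge_carrier[OF exp])

lemma shift_carrier' [simp]: "shift c \<in> carrier GR"
  by (rule shift_carrier[OF exp])

lemmas shift_simps = shift_mult[OF exp] shift_zero[OF exp] inv_shift[OF exp] pow_shift[OF exp]

lemma ge_positive: "ge \<in> G.positive"
  using shift_less_ge[OF exp, of 0] by (simp add: G.positive_def shift_simps)

lemma ge_pow_ge_one: "germ_less gid (ge \<up> n) \<or> gid = ge \<up> n"
  using G.nat_pow_mono[of "gid" ge n] ge_positive by (simp add: G.positive_def)

lemma ge_pow_split:
  assumes "(l::nat) \<le> k"
  shows "ge \<up> l = ge \<up> k \<odot> ginv (ge \<up> (k - l))"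
proof -
  have "ge \<up> k = ge \<up> l \<odot> ge \<up> (k - l)"
    using assms by (simp add: G.nat_pow_mult)
  then show ?thesis
    by (simp add: G.m_assoc)
qed

lemma positive_between_shifts:
  assumes "F \<in> G.positive"
  shows "\<exists>k l. l \<le> k \<and> between_shifts F k (k - l)"
proof -
  obtain f where "unb f" "F = abs_germ f"
    using assms by (auto simp: G.positive_def carrier_iff)
  then show ?thesis
    using between_shifts_exists[OF exp lev] assms positive_abs by blast
qed

text \<open>The bounds on \<open>F\<close> are \<open>a \<odot> ginv b\<close> with one shift
  inserted in the middle, so the quotients on either side are at most conjugates of
  \<open>shift 1\<close>. In \<open>scaling_ge\<close> the first two goals serve positive germs and
  the last two inverses of positive germs.\<close>

lemma between_shifts_cancel:
  assumes F: "F \<in> carrier GR" and bs: "between_shifts F k j"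
    and a: "a = ge \<up> k" and b: "b = ge \<up> j"
  shows "G.le (F \<odot> ginv (a \<odot> ginv b)) (a \<odot> shift 1 \<odot> ginv a)" (is ?goal1)
    and "G.le (a \<odot> ginv b \<odot> ginv F) (a \<odot> shift 1 \<odot> ginv a)" (is ?goal2)
    and "G.le (ginv (a \<odot> ginv b) \<odot> F) (b \<odot> shift 1 \<odot> ginv b)" (is ?goal3)
    and "G.le (ginv F \<odot> (a \<odot> ginv b)) (b \<odot> shift 1 \<odot> ginv b)" (is ?goal4)
proof -
  have ab: "a \<in> carrier GR" "b \<in> carrier GR"
    by (simp_all add: a b)
  define U where "U = a \<odot> shift 1 \<odot> ginv b"
  define L where "L = a \<odot> shift (- 1) \<odot> ginv b"
  define c where "c = a \<odot> ginv b"
  have UL: "U \<in> carrier GR" "L \<in> carrier GR" "c \<in> carrier GR"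
    using ab by (simp_all add: U_def L_def c_def)
  have FU: "G.le F U" and LF: "G.le L F"
    using bs unfolding between_shifts_def U_def L_def a b by blast+
  have inv_L: "G.le (ginv F) (ginv L)"
    using LF G.inv_le_inv_iff[OF F UL(2)] by blast
  have cancel: "ginv x \<odot> (x \<odot> y) = y" "x \<odot> (ginv x \<odot> y) = y"
    if "x \<in> carrier GR" "y \<in> carrier GR" for x y
    using that by (simp_all add: G.m_assoc[symmetric])
  have "U \<odot> ginv c = a \<odot> shift 1 \<odot> ginv a"
    "c \<odot> ginv L = a \<odot> shift 1 \<odot> ginv a"
    "ginv c \<odot> U = b \<odot> shift 1 \<odot> ginv b"
    "ginv L \<odot> c = b \<odot> shift 1 \<odot> ginv b"
    using ab by (simp_all add: U_def L_def c_def G.m_assoc G.inv_mult_group cancel shift_simps)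
  note eqs = this
  show ?goal1
    unfolding c_def[symmetric] eqs(1)[symmetric]
    by (rule G.le_mult_mono[OF _ _ _ _ FU]) (use F UL in simp_all)
  show ?goal2
    unfolding c_def[symmetric] eqs(2)[symmetric]
    by (rule G.le_mult_mono[OF _ _ _ _ _ inv_L]) (use F UL in simp_all)
  show ?goal3
    unfolding c_def[symmetric] eqs(3)[symmetric]
    by (rule G.le_mult_mono[OF _ _ _ _ _ FU]) (use F UL in simp_all)
  show ?goal4
    unfolding c_def[symmetric] eqs(4)[symmetric]
    by (rule G.le_mult_mono[OF _ _ _ _ inv_L]) (use F UL in simp_all)
qed

text \<open>A germ of level \<open>l\<close> is approximated by the \<open>l\<close>-fold iterate of
  \<open>exp\<close>: by \<open>between_shifts_cancel\<close> the quotient and its inverse are at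
  most a conjugate of \<open>shift 1\<close>, all of whose powers lie below \<open>exp\<close>.
  Below the identity, \<open>ginv F\<close> is approximated and the approximant inverted.\<close>

lemma scaling_ge: "G.scaling ge"
proof (rule G.scalingI[OF ge_positive])
  fix F assume F: "F \<in> carrier GR"
  note pow = G.centraliser_closed(3)[OF ge_carrier' G.self_in_centraliser[OF ge_carrier']]
  consider "F = gid" | "F \<in> G.positive" | "ginv F \<in> G.positive"
    using G.positive_or_inv_positive[OF F] by blast
  then show "\<exists>g\<in>centraliser GR ge. \<forall>n::nat. germ_less ((g \<odot> ginv F) \<up> n) ge \<and>
      germ_less (ginv (g \<odot> ginv F) \<up> n) ge"
  proof cases
    case 1
    show ?thesis
      using pow[of 0] ge_positive 1 by (intro bexI[of _ "gid"]) (simp_all add: G.positive_def)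
  next
    case 2
    then obtain k l where kl: "l \<le> k" "between_shifts F k (k - l)"
      using positive_between_shifts by blast
    define g where "g = ge \<up> l"
    have gG: "g \<in> carrier GR"
      by (simp add: g_def)
    have X: "g \<odot> ginv F \<in> carrier GR" "ginv (g \<odot> ginv F) \<in> carrier GR"
      using gG F by simp_all
    have inv: "ginv (g \<odot> ginv F) = F \<odot> ginv g"
      using gG F by (simp add: G.inv_mult_group)
    note c = between_shifts_cancel[OF F kl(2) refl refl, folded ge_pow_split[OF kl(1)] g_def]
    show ?thesis
      using conj_shift_pow_less_ge[OF exp X(1) refl c(2)]
        conj_shift_pow_less_ge[OF exp X(2) refl c(1)[folded inv]] pow[of l]
      by (intro bexI[of _ g]) (simp_all add: g_def)
  next
    case 3
    then obtain k l where kl: "l \<le> k" "between_shifts (ginv F) k (k - l)"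
      using positive_between_shifts by blast
    define g where "g = ge \<up> l"
    have gG: "g \<in> carrier GR"
      by (simp add: g_def)
    have X: "ginv g \<odot> ginv F \<in> carrier GR" "ginv (ginv g \<odot> ginv F) \<in> carrier GR"
      using gG F by simp_all
    have inv: "ginv (ginv g \<odot> ginv F) = ginv (ginv F) \<odot> g"
      using gG F by (simp add: G.inv_mult_group)
    note c = between_shifts_cancel[OF G.inv_closed[OF F] kl(2) refl refl, folded ge_pow_split[OF kl(1)] g_def]
    show ?thesis
      using conj_shift_pow_less_ge[OF exp X(1) refl c(3)]
        conj_shift_pow_less_ge[OF exp X(2) refl c(4)[folded inv]]
        G.centraliser_closed(2)[OF ge_carrier' pow[of l], folded g_def]
      by (intro bexI[of _ "ginv g"]) simp_all
  qed
qed

text \<open>Passing to \<open>ln (u (exp t))\<close> contracts displacements: it is at most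
  \<open>ln (exp t + 1)\<close>, hence at most \<open>t + exp (- t)\<close>, and the displacement
  tends to 0.\<close>

lemma flowable_if_bounded_displacement:
  assumes u: "unb u" and gt: "eventually (\<lambda>t. t < u t) at_top" and le: "eventually (\<lambda>t. u t \<le> t + 1) at_top"
  shows "G.flowable (abs_germ u)"
proof -
  note unb_exp = unb_exp[OF exp] and unb_lg = unb_lg[OF exp]
  define v where "v t = lg (u (exp t))" for t
  have v: "unb v"
    unfolding v_def[abs_def] by (intro unb_comp[OF unb_lg] unb_comp[OF u unb_exp])
  have bounds: "eventually (\<lambda>t. t < v t \<and> v t \<le> t + exp (- t)) at_top"
    using unb_eventually[OF unb_exp gt] unb_eventually[OF unb_exp le]
  proof eventually_elim
    case (elim t)
    define s where "s = exp t"
    have s: "s > 0" "s < u s" "u s \<le> s + 1" "ln s = t"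
      using elim by (simp_all add: s_def)
    have vt: "v t = ln (u s)"
      using s by (simp add: v_def lg_def flip: s_def)
    have "t < ln (u s)"
      using s ln_less_cancel_iff[of s "u s"] by simp
    moreover have "s * (1 + 1 / s) = s + 1"
      using s by (simp add: field_simps)
    then have "ln (u s) \<le> ln (s * (1 + 1 / s))"
      using s by simp
    moreover have "ln (s * (1 + 1 / s)) = t + ln (1 + 1 / s)"
      using s by (subst ln_mult) (auto simp: add_pos_pos less_imp_neq[symmetric])
    moreover have "ln (1 + 1 / s) \<le> 1 / s"
      using s by (intro ln_add_one_self_le_self) simp
    moreover have "1 / s = exp (- t)"
      by (simp add: s_def exp_minus inverse_eq_divide)
    ultimately show ?case
      by (simp add: vt)
  qed
  have "((\<lambda>t. v t - t) \<longlongrightarrow> 0) at_top"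
  proof (rule tendsto_sandwich[OF _ _ tendsto_const])
    show "eventually (\<lambda>t. 0 \<le> v t - t) at_top" "eventually (\<lambda>t. v t - t \<le> exp (- t)) at_top"
      using bounds by (auto elim: eventually_mono)
    show "((\<lambda>t::real. exp (- t)) \<longlongrightarrow> 0) at_top"
      by (rule filterlim_compose[OF exp_at_bot filterlim_uminus_at_bot_at_top])
  qed
  moreover have "eventually (\<lambda>t. t < v t) at_top"
    using bounds by (auto elim: eventually_mono)
  ultimately have "G.flowable (abs_germ v)"
    by (intro flowable_if_small_displacement[OF v])
  moreover have "eventually (\<lambda>x. exp (lg x) = x) at_top"
    using eventually_pos by eventually_elim (simp add: lg_def)
  ultimately show ?thesis
    using flowable_conj_abs[OF u unb_lg unb_exp] unfolding v_def[abs_def] by blast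
qed

text \<open>At level 0, conjugation by iterated logarithms puts \<open>F\<close> between the
  identity and \<open>shift 1\<close>. At positive level, \<open>F\<close> is comparable to
  \<open>ge\<close>: its square exceeds \<open>ge\<close>, and \<open>F\<close> is at most
  \<open>ge \<up> Suc k\<close>.\<close>

lemma exists_scaling_if_exp:
  assumes F: "F \<in> G.positive"
  shows "\<exists>s. G.scaling s \<and> G.asymp_eq s F"
proof -
  have FG: "F \<in> carrier GR"
    using F by (simp add: G.positive_def)
  obtain k l where kl: "l \<le> k" "between_shifts F k (k - l)"
    using positive_between_shifts[OF F] by blast
  define a where "a = ge \<up> k"
  define b where "b = ge \<up> (k - l)"
  have ab: "a \<in> carrier GR" "b \<in> carrier GR"
    by (simp_all add: a_def b_def)
  have FU: "G.le F (a \<odot> shift 1 \<odot> ginv b)"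
    and LF: "G.le (a \<odot> shift (- 1) \<odot> ginv b) F"
    using kl(2) unfolding between_shifts_def a_def b_def by blast+
  have cancel: "ginv x \<odot> (x \<odot> y) = y" "x \<odot> (ginv x \<odot> y) = y"
    if "x \<in> carrier GR" "y \<in> carrier GR" for x y
    using that by (simp_all add: G.m_assoc[symmetric])
  show ?thesis
  proof (cases l)
    case 0
    then have b: "b = a"
      by (simp add: a_def b_def)
    define U where "U = ginv a \<odot> F \<odot> a"
    have "U \<in> carrier GR"
      using ab FG by (simp add: U_def)
    then obtain u where u: "unb u" "U = abs_germ u"
      by (auto simp: carrier_iff)
    have "germ_less (ginv a \<odot> gid \<odot> a) U"
      unfolding U_def using F FG ab by (intro G.lt_mult_right G.lt_mult_left) (auto simp: G.positive_def)
    then have "germ_less gid U"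
      using ab by simp
    then have "germ_less (abs_germ (\<lambda>t. t)) (abs_germ u)"
      unfolding one_abs u(2) .
    then have 1: "eventually (\<lambda>t. t < u t) at_top"
      using u by (simp add: germ_less_abs unb_ident)
    have "G.le (ginv a \<odot> F) (ginv a \<odot> (a \<odot> shift 1 \<odot> ginv a))"
      by (rule G.le_mult_mono[OF _ _ _ _ _ FU[unfolded b]]) (use ab FG in simp_all)
    then have "G.le U (ginv a \<odot> (a \<odot> shift 1 \<odot> ginv a) \<odot> a)"
      unfolding U_def by (rule G.le_mult_mono[rotated 4]) (use ab FG in simp_all)
    then have "G.le (abs_germ u) (shift 1)"
      using ab by (simp add: u(2) G.m_assoc cancel)
    then have 2: "eventually (\<lambda>t. u t \<le> t + 1) at_top"
      using germ_leD[OF u(1) unb_shift] by (simp add: shift_def)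
    have "G.flowable U"
      unfolding u(2) by (rule flowable_if_bounded_displacement[OF u(1) 1 2])
    then have "G.flowable F"
      using G.flowable_conj[OF FG, of "ginv a"] ab by (simp add: U_def)
    then show ?thesis
      by (rule G.flowable_imp_scaling[OF F])
  next
    case (Suc l')
    \<comment> \<open>Replacing the exponent \<open>k - l\<close> by \<open>k - 1\<close>, which is
      at least as large, weakens the lower bound to a conjugate of
      \<open>w = ge \<odot> shift (- 1)\<close> by \<open>c = ge \<up> i\<close>.\<close>
    define i where "i = k - 1"
    have k: "k = Suc i" "k - l \<le> i"
      using kl(1) Suc by (simp_all add: i_def)
    define c where "c = ge \<up> i"
    have cG: "c \<in> carrier GR"
      by (simp add: c_def)
    have ac: "a = c \<odot> ge" "a = ge \<odot> c"
      by (simp_all add: a_def c_def k(1) G.nat_pow_Suc2 del: G.nat_pow_Suc) (simp add: G.nat_pow_Suc2[symmetric])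
    have "c = b \<odot> ge \<up> (i - (k - l))"
      using k(2) by (simp add: b_def c_def G.nat_pow_mult)
    moreover have "G.le (b \<odot> gid) (b \<odot> ge \<up> (i - (k - l)))"
      by (rule G.le_mult_mono[OF _ _ _ _ _ ge_pow_ge_one]) (use ab in simp_all)
    ultimately have bc: "G.le (ginv c) (ginv b)"
      using ab cG by (simp add: G.inv_le_inv_iff)
    define w where "w = ge \<odot> shift (- 1)"
    have wG: "w \<in> carrier GR"
      by (simp add: w_def)
    have "G.le (a \<odot> shift (- 1) \<odot> ginv c) (a \<odot> shift (- 1) \<odot> ginv b)"
      by (rule G.le_mult_mono[OF _ _ _ _ _ bc]) (use ab cG in simp_all)
    then have "G.le (a \<odot> shift (- 1) \<odot> ginv c) F"
      using G.le_trans[OF _ _ FG _ LF] ab cG by simp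
    then have "G.le (c \<odot> w \<odot> ginv c) F"
      using cG by (simp add: ac(1) w_def G.m_assoc)
    then have "G.le ((c \<odot> w \<odot> ginv c) \<up> 2) (F \<up> 2)"
      by (rule G.nat_pow_mono[rotated 2]) (use cG wG FG in simp_all)
    then have F2: "G.le (c \<odot> w \<up> 2 \<odot> ginv c) (F \<up> 2)"
      using conj_pow[OF exp cG wG] by simp
    \<comment> \<open>\<open>exp t > t + 2\<close> makes \<open>exp (t - 1) - 1\<close> exceed the
      identity, so the square of \<open>w\<close> exceeds \<open>ge\<close>; conjugation by
      \<open>c\<close> then fixes \<open>ge\<close>.\<close>
    have "germ_less (shift (- 1) \<odot> shift 2 \<odot> shift (- 1)) (shift (- 1) \<odot> ge \<odot> shift (- 1))"
      by (intro G.lt_mult_right G.lt_mult_left shift_less_ge[OF exp]) simp_all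
    then have "germ_less (ge \<odot> gid) (ge \<odot> (shift (- 1) \<odot> ge \<odot> shift (- 1)))"
      by (intro G.lt_mult_left) (simp_all add: shift_simps)
    also have "ge \<odot> (shift (- 1) \<odot> ge \<odot> shift (- 1)) = w \<up> 2"
      by (simp add: w_def numeral_2_eq_2 G.m_assoc)
    finally have "germ_less ge (w \<up> 2)"
      by simp
    then have "germ_less (c \<odot> ge \<odot> ginv c) (c \<odot> w \<up> 2 \<odot> ginv c)"
      using cG wG by (intro G.lt_mult_right G.lt_mult_left) simp_all
    then have "germ_less ge (c \<odot> w \<up> 2 \<odot> ginv c)"
      using cG by (simp add: ac(1)[symmetric]) (simp add: ac(2) G.m_assoc)
    then have le1: "G.le ge (F \<up> 2)"
      using G.lt_le_trans[OF _ _ _ _ F2, of ge] cG wG FG by simp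
    have b1: "G.le (ginv b) gid"
      using G.inv_le_inv_iff[of b "gid"] ge_pow_ge_one[of "k - l"] ab by (simp add: b_def)
    have a1: "G.le (a \<odot> shift 1) (a \<odot> ge)"
      using G.lt_mult_left[OF ab(1) _ _ shift_less_ge[OF exp, of 1]] by simp
    have "G.le (a \<odot> shift 1 \<odot> ginv b) (a \<odot> ge \<odot> gid)"
      by (rule G.le_mult_mono[OF _ _ _ _ a1 b1]) (use ab in simp_all)
    then have "G.le F (a \<odot> ge \<odot> gid)"
      using G.le_trans[OF FG _ _ FU] ab by simp
    then have le2: "G.le F (ge \<up> Suc k)"
      using ab by (simp add: a_def)
    show ?thesis
      using scaling_ge G.asymp_eqI[OF ge_positive F le1 le2] by blast
  qed
qed

end

end

theorem mainTheorem1: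
  fixes R :: "('f, 'r) real_field_expansion"
  assumes "o_minimal R"
    and "levelled R"
  shows "growth_order_group (germ_group R) germ_less \<and>
    (\<forall>g \<in> carrier (germ_group R). g \<noteq> \<one>\<^bsub>germ_group R\<^esub> \<longrightarrow>
       archimedean_ordered_group
         ((germ_group R)\<lparr>carrier := centraliser (germ_group R) g\<rparr>) germ_less)"
proof -
  interpret o_minimal_expansion R
    by unfold_locales (rule assms(1))
  have "\<exists>s. G.scaling s \<and> G.asymp_eq s F" if F: "F \<in> G.positive" for F
  proof (cases "definable_fun R exp")
    case True
    then show ?thesis
      using exists_scaling_if_exp assms(2) F by blast
  next
    case False
    obtain f where "unb f" "F = abs_germ f"
      using F by (auto simp: G.positive_def carrier_iff)
    then show ?thesis
      using exists_scaling_if_not_exp[OF False] F positive_abs by blast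
  qed
  then show ?thesis
    using G.growth_order_groupI G.archimedean_centraliser by blast
qed

end
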